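(* Let $\mathcal{M}\subset\mathbb{R}^d$ be an orientable, compact, boundaryless, connected, smooth $n$-dimensional submanifold with $n<d$, equipped with the induced metric and Riemannian volume form $dV$. Let $\nu:\mathcal{M}\to\mathbb{R}_{>0}$ be a positive (source) probability density and $\mu:\mathcal{M}\to\mathbb{R}_{>0}$ a continuous (target) probability density. Let $\pi$ denote the closest-point projection onto $\mathcal{M}$ (smooth on a neighborhood $\Omega$ of $\mathcal{M}$) and $P_x=I-N_xN_x^T$ the orthogonal projection matrix onto $T_x\mathcal{M}$, where $N_x$ has orthonormal columns spanning $(T_x\mathcal{M})^\perp$. For an MLP $v_\theta:\mathbb{R}^d\to\mathbb{R}^d$ define $u(x)=P_{\pi(x)}v_\theta(\pi(x))$ and $\bar\mu(x)=\nu(x)-\operatorname{div}_E u(x)$ for $x\in\mathcal{M}$. Then for every $\epsilon>0$ there exist an MLP $v_\theta$ (with an $l$-finite smooth activation for some $l\ge 2$, e.g. sigmoid, $\tanh$ or Softplus) and weights $\theta$ such that $\max_{x\in\mathcal{M}}|\mu(x)-\bar\mu(x)|<\epsilon$.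
   Context: $\operatorname{div}_E$ is the Euclidean divergence in $\mathbb{R}^d$. An activation $\sigma:\mathbb{R}\to\mathbb{R}$ is $l$-finite if it is $l$ times continuously differentiable and $0<\int_{-\infty}^{\infty}|\sigma^{(l)}(s)|\,ds<\infty$. An MLP is a composition of affine maps and coordinatewise activations.
   Formalization: The source density ν is additionally assumed continuous: the divergence of u is continuous on M, so uniform approximation for every ε is impossible when ν is discontinuous and μ is continuous. *)

theory Defs
  imports "HOL-Analysis.Analysis"
begin

fun Ck_on :: "nat \<Rightarrow> 'a::euclidean_space set \<Rightarrow> ('a \<Rightarrow> 'b::real_normed_vector) \<Rightarrow> bool" where
  "Ck_on 0 S f = continuous_on S f"
| "Ck_on (Suc k) S f =
     ((\<forall>x\<in>S. f differentiable (at x)) \<and>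
      (\<forall>v. Ck_on k S (\<lambda>x. frechet_derivative f (at x) v)))"

definition smooth_on :: "'a::euclidean_space set \<Rightarrow> ('a \<Rightarrow> 'b::real_normed_vector) \<Rightarrow> bool" where
  "smooth_on S f \<longleftrightarrow> (\<forall>k. Ck_on k S f)"

definition smooth_real_fun :: "(real \<Rightarrow> real) \<Rightarrow> bool" where
  "smooth_real_fun \<sigma> \<longleftrightarrow> (\<forall>k x. ((deriv ^^ k) \<sigma>) differentiable (at x))"

definition l_finite :: "nat \<Rightarrow> (real \<Rightarrow> real) \<Rightarrow> bool" where
  "l_finite l \<sigma> \<longleftrightarrow>
     (\<forall>k<l. \<forall>x. ((deriv ^^ k) \<sigma>) differentiable (at x)) \<and>
     continuous_on UNIV ((deriv ^^ l) \<sigma>) \<and>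
     (\<lambda>s. \<bar>(deriv ^^ l) \<sigma> s\<bar>) integrable_on (UNIV :: real set) \<and>
     0 < integral (UNIV :: real set) (\<lambda>s. \<bar>(deriv ^^ l) \<sigma> s\<bar>)"

definition local_param ::
  "(real^'d) set \<Rightarrow> (real^'n) set \<Rightarrow> (real^'n \<Rightarrow> real^'d) \<Rightarrow> bool" where
  "local_param M U \<phi> \<longleftrightarrow>
     open U \<and> smooth_on U \<phi> \<and>
     (\<exists>\<psi>. homeomorphism U (\<phi> ` U) \<phi> \<psi>) \<and>
     (\<exists>W. open W \<and> \<phi> ` U = M \<inter> W) \<and>
     (\<forall>u\<in>U. inj (frechet_derivative \<phi> (at u)))"

definition submanifold :: "'n::finite itself \<Rightarrow> (real^'d) set \<Rightarrow> bool" where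
  "submanifold _ M \<longleftrightarrow>
     (\<forall>p\<in>M. \<exists>(U::(real^'n) set) \<phi>. local_param M U \<phi> \<and> p \<in> \<phi> ` U)"

definition orientable :: "'n::finite itself \<Rightarrow> (real^'d) set \<Rightarrow> bool" where
  "orientable _ M \<longleftrightarrow>
     (\<exists>A :: ((real^'n) set \<times> (real^'n \<Rightarrow> real^'d)) set.
        (\<forall>(U,\<phi>)\<in>A. local_param M U \<phi>) \<and>
        M \<subseteq> (\<Union>(U,\<phi>)\<in>A. \<phi> ` U) \<and>
        (\<forall>(U,\<phi>)\<in>A. \<forall>(V,\<psi>)\<in>A. \<forall>u\<in>U. \<phi> u \<in> \<psi> ` V \<longrightarrow>
           det (matrix (frechet_derivative (inv_into V \<psi> \<circ> \<phi>) (at u))) > 0))"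

definition tangent_space :: "'n::finite itself \<Rightarrow> (real^'d) set \<Rightarrow> real^'d \<Rightarrow> (real^'d) set" where
  "tangent_space _ M x =
     {w. \<exists>(U::(real^'n) set) \<phi> u. local_param M U \<phi> \<and> u \<in> U \<and> \<phi> u = x \<and>
          w \<in> range (frechet_derivative \<phi> (at u))}"

definition tangent_proj :: "'n::finite itself \<Rightarrow> (real^'d) set \<Rightarrow> real^'d \<Rightarrow> real^'d \<Rightarrow> real^'d" where
  "tangent_proj n M x v =
     (THE w. w \<in> tangent_space n M x \<and> (\<forall>t\<in>tangent_space n M x. (v - w) \<bullet> t = 0))"

text \<open>Closest-point projection onto M (well defined near M).\<close>
definition closest_point :: "(real^'d) set \<Rightarrow> real^'d \<Rightarrow> real^'d" where
  "closest_point M x = (THE y. y \<in> M \<and> (\<forall>z\<in>M. dist x y \<le> dist x z))"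

definition div_E :: "('a::euclidean_space \<Rightarrow> 'a) \<Rightarrow> 'a \<Rightarrow> real" where
  "div_E u x = (\<Sum>i\<in>Basis. frechet_derivative u (at x) i \<bullet> i)"

text \<open>Integral over M with respect to the Riemannian volume dV of the induced metric,
  computed by splitting M into finitely many disjoint Borel pieces, each inside one
  local parametrisation: sum of int_E f(phi u) sqrt(det(Dphi^T Dphi)) du.\<close>
definition manifold_has_integral ::
  "'n::finite itself \<Rightarrow> (real^'d) set \<Rightarrow> (real^'d \<Rightarrow> real) \<Rightarrow> real \<Rightarrow> bool" where
  "manifold_has_integral _ M f I \<longleftrightarrow>
     (\<exists>(ps :: ((real^'n) set \<times> (real^'n \<Rightarrow> real^'d) \<times> (real^'n) set) list) Is.
        length Is = length ps \<and>
        (\<forall>i<length ps. case ps ! i of (U, \<phi>, E) \<Rightarrow>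
            local_param M U \<phi> \<and> E \<in> sets borel \<and> E \<subseteq> U \<and>
            ((\<lambda>u. f (\<phi> u) *
                 sqrt (det (transpose (matrix (frechet_derivative \<phi> (at u))) **
                            matrix (frechet_derivative \<phi> (at u)))))
              has_integral (Is ! i)) E) \<and>
        (\<forall>i<length ps. \<forall>j<length ps. i \<noteq> j \<longrightarrow>
            (case ps ! i of (_, \<phi>, E) \<Rightarrow> \<phi> ` E) \<inter> (case ps ! j of (_, \<phi>, E) \<Rightarrow> \<phi> ` E) = {}) \<and>
        M = (\<Union>i<length ps. case ps ! i of (_, \<phi>, E) \<Rightarrow> \<phi> ` E) \<and>
        sum_list Is = I)"

definition prob_density :: "'n::finite itself \<Rightarrow> (real^'d) set \<Rightarrow> (real^'d \<Rightarrow> real) \<Rightarrow> bool" where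
  "prob_density n M f \<longleftrightarrow> (\<forall>x\<in>M. f x > 0) \<and> manifold_has_integral n M f 1"

fun mlp_hidden :: "(real \<Rightarrow> real) \<Rightarrow> (nat \<times> (nat \<Rightarrow> nat \<Rightarrow> real) \<times> (nat \<Rightarrow> real)) list
                   \<Rightarrow> (nat \<Rightarrow> real) \<Rightarrow> (nat \<Rightarrow> real)" where
  "mlp_hidden \<sigma> [] h = h"
| "mlp_hidden \<sigma> ((m, W, b) # Ls) h = mlp_hidden \<sigma> Ls (\<lambda>i. \<sigma> (b i + (\<Sum>j<m. W i j * h j)))"

text \<open>v : R^d -> R^d is an MLP with activation sigma: affine input layer, hidden layers
  (affine map of the previous width m followed by coordinatewise sigma), affine output.\<close>
definition mlp :: "(real \<Rightarrow> real) \<Rightarrow> (real^'d \<Rightarrow> real^'d) \<Rightarrow> bool" where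
  "mlp \<sigma> v \<longleftrightarrow>
     (\<exists>(W0 :: nat \<Rightarrow> 'd \<Rightarrow> real) b0 Ls m (V :: 'd \<Rightarrow> nat \<Rightarrow> real) (c :: 'd \<Rightarrow> real).
        v = (\<lambda>x. \<chi> j. c j + (\<Sum>i<m. V j i *
               mlp_hidden \<sigma> Ls (\<lambda>i. \<sigma> (b0 i + (\<Sum>k\<in>UNIV. W0 i k * x $ k))) i)))"

end

(*
  On a compact submanifold the divergence of a projected field P(pi) v(pi) at a point of M depends only on
  v and its first derivative there, with bounded coefficients, so it is enough to solve the divergence
  equation approximately with C^1 fields and to approximate these in C^1 by networks.

  Networks: since sigma is smooth and no derivative of it vanishes identically, difference quotients in the
  weights give all monomials, hence all C^1 ridge functions; ridge functions of exp form an algebra, whose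
  C^1 closure contains product bumps, and mollification by bumps gives every compactly supported C^1 function.

  Divergence equation: in a chart the field (q / J) d phi(h) has divergence (D q)(h) / J, where J is the
  volume density. Taking for q the integral of a bump along a segment gives the difference of two translated
  bumps, so mollification shows that a function supported in a chart with integral zero is a uniform limit of
  divergences. Connectedness lets one move mass from chart to chart, so any two probability densities
  differ by a limit of divergences.
*)
theory Submission
  imports Defs
begin

hide_const (open) Polynomial.content

section \<open>C1 closures of spans\<close>

text \<open>The densities are merely continuous and only a uniform approximation is asked for, so
  the equation div u = \<nu> - \<mu> is never solved. It suffices that the right-hand side lies in
  the uniform closure of the divergences, a linear space, which replaces elliptic theory by explicit
  fields in charts. Two obstacles shape the rest. The field u is defined through the closest-point
  map, so its divergence needs the derivative of that map at points of M; this derivative is the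
  tangential projection, because M has quadratic contact with its tangent planes. And the integral
  of a density is defined by some decomposition of M into Borel pieces of parametrisations, possibly
  a different one for each density. Comparing masses therefore needs the change of variables
  formula, and the auxiliary bumps are shown to have mass one for every decomposition. That no
  derivative of \<sigma> vanishes identically comes from l-finiteness: a nonzero polynomial is not
  absolutely integrable on the line.\<close>

text \<open>A pair stands for a function together with its gradient; the type does not enforce the relation.\<close>

type_synonym 'a c1pair = "('a \<Rightarrow> real) \<times> ('a \<Rightarrow> 'a)"

text \<open>Built one summand at a time, so that properties of the span follow by rule induction,
  with both components always changing together.\<close>

inductive_set C1_span :: "('a::real_inner) c1pair set \<Rightarrow> 'a c1pair set" for B where
  zero: "(\<lambda>_. 0, \<lambda>_. 0) \<in> C1_span B"
| step: "\<lbrakk>(f, F) \<in> B; (g, G) \<in> C1_span B\<rbrakk>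
          \<Longrightarrow> (\<lambda>x. a * f x + g x, \<lambda>x. a *\<^sub>R F x + G x) \<in> C1_span B"

lemma C1_span_lin:
  assumes "(f, F) \<in> C1_span B" "(g, G) \<in> C1_span B"
  shows "(\<lambda>x. a * f x + g x, \<lambda>x. a *\<^sub>R F x + G x) \<in> C1_span B"
  using assms(1)
proof (induction f F rule: C1_span.induct)
  case zero
  then show ?case using assms(2) by simp
next
  case (step f F h H c)
  have "(\<lambda>x. (a * c) * f x + (a * h x + g x), \<lambda>x. (a * c) *\<^sub>R F x + (a *\<^sub>R H x + G x)) \<in> C1_span B"
    by (rule C1_span.step[OF step.hyps(1) step.IH])
  then show ?case by (simp add: algebra_simps)
qed

lemma C1_span_base: "(f, F) \<in> B \<Longrightarrow> (f, F) \<in> C1_span B"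
  using C1_span.step[OF _ C1_span.zero, of f F B 1] by simp

text \<open>Value and gradient are approximated at once, and only on \<open>K\<close>. No relation
  between \<open>f\<close> and \<open>F\<close> is imposed, so closure properties are pure estimates
  and derivatives enter only for concrete pairs.\<close>

definition C1_closure :: "'a set \<Rightarrow> ('a::real_inner) c1pair set \<Rightarrow> 'a c1pair set" where
  "C1_closure K S = {(f, F). \<forall>\<epsilon>>0. \<exists>(g, G)\<in>S. \<forall>x\<in>K. \<bar>f x - g x\<bar> \<le> \<epsilon> \<and> norm (F x - G x) \<le> \<epsilon>}"

lemma C1_closureI:
  assumes "\<And>\<epsilon>. \<epsilon> > 0 \<Longrightarrow> \<exists>g G. (g, G) \<in> S \<and> (\<forall>x\<in>K. \<bar>f x - g x\<bar> \<le> \<epsilon> \<and> norm (F x - G x) \<le> \<epsilon>)"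
  shows "(f, F) \<in> C1_closure K S"
  using assms unfolding C1_closure_def by fastforce

lemma C1_closureE:
  assumes "(f, F) \<in> C1_closure K S" "\<epsilon> > 0"
  obtains g G where "(g, G) \<in> S" "\<And>x. x \<in> K \<Longrightarrow> \<bar>f x - g x\<bar> \<le> \<epsilon>"
    "\<And>x. x \<in> K \<Longrightarrow> norm (F x - G x) \<le> \<epsilon>"
  using assms unfolding C1_closure_def by fastforce

lemma C1_closure_base: "(f, F) \<in> S \<Longrightarrow> (f, F) \<in> C1_closure K S"
  by (rule C1_closureI) (auto intro!: exI[of _ f] exI[of _ F])

lemma C1_closure_closure:
  assumes "(f, F) \<in> C1_closure K (C1_closure K S)"
  shows "(f, F) \<in> C1_closure K S"
proof (rule C1_closureI)
  fix \<epsilon> :: real assume "\<epsilon> > 0"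
  obtain g G where g: "(g, G) \<in> C1_closure K S" "\<And>x. x \<in> K \<Longrightarrow> \<bar>f x - g x\<bar> \<le> \<epsilon>/2"
    "\<And>x. x \<in> K \<Longrightarrow> norm (F x - G x) \<le> \<epsilon>/2"
    using C1_closureE[OF assms, of "\<epsilon>/2"] \<open>\<epsilon> > 0\<close> by auto
  obtain h H where h: "(h, H) \<in> S" "\<And>x. x \<in> K \<Longrightarrow> \<bar>g x - h x\<bar> \<le> \<epsilon>/2"
    "\<And>x. x \<in> K \<Longrightarrow> norm (G x - H x) \<le> \<epsilon>/2"
    using C1_closureE[OF g(1), of "\<epsilon>/2"] \<open>\<epsilon> > 0\<close> by auto
  have "\<bar>f x - h x\<bar> \<le> \<epsilon> \<and> norm (F x - H x) \<le> \<epsilon>" if "x \<in> K" for x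
  proof
    show "\<bar>f x - h x\<bar> \<le> \<epsilon>" using g(2)[OF that] h(2)[OF that] by linarith
    show "norm (F x - H x) \<le> \<epsilon>"
      using g(3)[OF that] h(3)[OF that] norm_triangle_ineq[of "F x - G x" "G x - H x"] by simp
  qed
  then show "\<exists>g G. (g, G) \<in> S \<and> (\<forall>x\<in>K. \<bar>f x - g x\<bar> \<le> \<epsilon> \<and> norm (F x - G x) \<le> \<epsilon>)"
    using h(1) by blast
qed

lemma C1_closure_mono:
  assumes "\<And>f F. (f, F) \<in> S \<Longrightarrow> (f, F) \<in> C1_closure K T" "(f, F) \<in> C1_closure K S"
  shows "(f, F) \<in> C1_closure K T"
proof (rule C1_closure_closure, rule C1_closureI)
  fix \<epsilon> :: real assume "\<epsilon> > 0"
  with assms C1_closureE[OF assms(2) this]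
  show "\<exists>g G. (g, G) \<in> C1_closure K T \<and> (\<forall>x\<in>K. \<bar>f x - g x\<bar> \<le> \<epsilon> \<and> norm (F x - G x) \<le> \<epsilon>)"
    by metis
qed

definition lin_closed :: "('a::real_inner) c1pair set \<Rightarrow> bool" where
  "lin_closed S \<longleftrightarrow> (\<lambda>_. 0, \<lambda>_. 0) \<in> S \<and>
     (\<forall>f F g G a. (f, F) \<in> S \<longrightarrow> (g, G) \<in> S \<longrightarrow>
        (\<lambda>x. a * f x + g x, \<lambda>x. a *\<^sub>R F x + G x) \<in> S)"

lemma lin_closedD:
  "lin_closed S \<Longrightarrow> (f, F) \<in> S \<Longrightarrow> (g, G) \<in> S \<Longrightarrow> (\<lambda>x. a * f x + g x, \<lambda>x. a *\<^sub>R F x + G x) \<in> S"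
  "lin_closed S \<Longrightarrow> (\<lambda>_. 0, \<lambda>_. 0) \<in> S"
  by (auto simp: lin_closed_def)

lemma lin_closed_C1_span: "lin_closed (C1_span B)"
  by (simp add: lin_closed_def C1_span.zero C1_span_lin)

lemma lin_closed_scale: "lin_closed S \<Longrightarrow> (f, F) \<in> S \<Longrightarrow> (\<lambda>x. a * f x, \<lambda>x. a *\<^sub>R F x) \<in> S"
  using lin_closedD(1)[of S f F "\<lambda>_. 0" "\<lambda>_. 0" a] lin_closedD(2)[of S] by simp

lemma lin_closed_sum:
  assumes "lin_closed S" "finite I" "\<And>i. i \<in> I \<Longrightarrow> (f i, F i) \<in> S"
  shows "(\<lambda>x. \<Sum>i\<in>I. a i * f i x, \<lambda>x. \<Sum>i\<in>I. a i *\<^sub>R F i x) \<in> S"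
  using assms(2,3)
proof (induction I rule: finite_induct)
  case empty
  then show ?case using assms(1) by (simp add: lin_closed_def)
next
  case (insert j I)
  then show ?case using lin_closedD(1)[OF assms(1), of "f j" "F j"] by simp
qed

lemma lin_closed_closure:
  assumes "lin_closed S"
  shows "lin_closed (C1_closure K S)"
  unfolding lin_closed_def
proof (intro conjI allI impI)
  show "(\<lambda>_. 0, \<lambda>_. 0) \<in> C1_closure K S"
    using assms by (auto intro: C1_closure_base simp: lin_closed_def)
  fix f F g G and a :: real
  assume f: "(f, F) \<in> C1_closure K S" and g: "(g, G) \<in> C1_closure K S"
  show "(\<lambda>x. a * f x + g x, \<lambda>x. a *\<^sub>R F x + G x) \<in> C1_closure K S"
  proof (rule C1_closureI)
    fix \<epsilon> :: real assume e: "\<epsilon> > 0"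
    define \<delta> where "\<delta> = \<epsilon> / (\<bar>a\<bar> + 1)"
    have d: "\<delta> > 0" "(\<bar>a\<bar> + 1) * \<delta> = \<epsilon>" using e by (auto simp: \<delta>_def add_nonneg_pos)
    obtain h H where h: "(h, H) \<in> S" "\<And>x. x \<in> K \<Longrightarrow> \<bar>f x - h x\<bar> \<le> \<delta>"
      "\<And>x. x \<in> K \<Longrightarrow> norm (F x - H x) \<le> \<delta>"
      using C1_closureE[OF f d(1)] by metis
    obtain k L where k: "(k, L) \<in> S" "\<And>x. x \<in> K \<Longrightarrow> \<bar>g x - k x\<bar> \<le> \<delta>"
      "\<And>x. x \<in> K \<Longrightarrow> norm (G x - L x) \<le> \<delta>"
      using C1_closureE[OF g d(1)] by metis
    have "\<bar>(a * f x + g x) - (a * h x + k x)\<bar> \<le> \<epsilon> \<and>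
        norm ((a *\<^sub>R F x + G x) - (a *\<^sub>R H x + L x)) \<le> \<epsilon>" if x: "x \<in> K" for x
    proof
      have "\<bar>(a * f x + g x) - (a * h x + k x)\<bar> = \<bar>a * (f x - h x) + (g x - k x)\<bar>"
        by (simp add: algebra_simps)
      also have "\<dots> \<le> \<bar>a\<bar> * \<bar>f x - h x\<bar> + \<bar>g x - k x\<bar>"
        by (metis abs_mult abs_triangle_ineq)
      also have "\<dots> \<le> \<bar>a\<bar> * \<delta> + \<delta>" using h(2) k(2) x by (intro add_mono mult_left_mono) auto
      finally show "\<bar>(a * f x + g x) - (a * h x + k x)\<bar> \<le> \<epsilon>" using d(2) by (simp add: algebra_simps)
      have "norm ((a *\<^sub>R F x + G x) - (a *\<^sub>R H x + L x)) = norm (a *\<^sub>R (F x - H x) + (G x - L x))"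
        by (simp add: algebra_simps)
      also have "\<dots> \<le> \<bar>a\<bar> * norm (F x - H x) + norm (G x - L x)"
        by (metis norm_scaleR norm_triangle_ineq)
      also have "\<dots> \<le> \<bar>a\<bar> * \<delta> + \<delta>" using h(3) k(3) x by (intro add_mono mult_left_mono) auto
      finally show "norm ((a *\<^sub>R F x + G x) - (a *\<^sub>R H x + L x)) \<le> \<epsilon>"
        using d(2) by (simp add: algebra_simps)
    qed
    moreover have "(\<lambda>x. a * h x + k x, \<lambda>x. a *\<^sub>R H x + L x) \<in> S"
      using assms h(1) k(1) by (simp add: lin_closed_def)
    ultimately show "\<exists>g' G'. (g', G') \<in> S \<and> (\<forall>x\<in>K. \<bar>(a * f x + g x) - g' x\<bar> \<le> \<epsilon> \<and>
        norm ((a *\<^sub>R F x + G x) - G' x) \<le> \<epsilon>)" by blast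
  qed
qed

text \<open>Multiplication is continuous for uniform convergence of bounded functions;
  \<open>S\<close> supplies the boundedness and the closure under products paired with their Leibniz
  gradients.\<close>

lemma C1_closure_mult:
  assumes f: "(f, F) \<in> C1_closure K S" and g: "(g, G) \<in> C1_closure K S"
    and mult: "\<And>f F g G. (f, F) \<in> S \<Longrightarrow> (g, G) \<in> S \<Longrightarrow>
        (\<lambda>x. f x * g x, \<lambda>x. f x *\<^sub>R G x + g x *\<^sub>R F x) \<in> S"
    and bd: "\<And>f F. (f, F) \<in> S \<Longrightarrow> bounded (f ` K) \<and> bounded (F ` K)"
  shows "(\<lambda>x. f x * g x, \<lambda>x. f x *\<^sub>R G x + g x *\<^sub>R F x) \<in> C1_closure K S"
proof (rule C1_closureI)
  fix \<epsilon> :: real assume e: "\<epsilon> > 0"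
  have bound: "\<exists>C\<ge>1. \<forall>x\<in>K. \<bar>f x\<bar> \<le> C \<and> norm (F x) \<le> C" if f: "(f, F) \<in> C1_closure K S" for f F
  proof -
    obtain h H where h: "(h, H) \<in> S" "\<And>x. x \<in> K \<Longrightarrow> \<bar>f x - h x\<bar> \<le> 1"
      "\<And>x. x \<in> K \<Longrightarrow> norm (F x - H x) \<le> 1" using C1_closureE[OF f, of 1] by auto
    obtain B C where "\<forall>x\<in>K. \<bar>h x\<bar> \<le> B" "\<forall>x\<in>K. norm (H x) \<le> C"
      using bd[OF h(1)] unfolding bounded_iff by auto
    then have "\<forall>x\<in>K. \<bar>f x\<bar> \<le> max (B + 1) (C + 1) \<and> norm (F x) \<le> max (B + 1) (C + 1)"
      using h(2,3) by (smt (verit) norm_triangle_ineq2)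
    then show ?thesis by (intro exI[of _ "max 1 (max (B + 1) (C + 1))"]) (auto simp: le_max_iff_disj)
  qed
  obtain A where A: "A \<ge> 1" "\<And>x. x \<in> K \<Longrightarrow> \<bar>f x\<bar> \<le> A" "\<And>x. x \<in> K \<Longrightarrow> norm (F x) \<le> A"
    using bound[OF f] by blast
  obtain B where B: "B \<ge> 1" "\<And>x. x \<in> K \<Longrightarrow> \<bar>g x\<bar> \<le> B" "\<And>x. x \<in> K \<Longrightarrow> norm (G x) \<le> B"
    using bound[OF g] by blast
  \<comment> \<open>The factor 2 pays for the two summands of the Leibniz gradient; the cap 1 turns
    the quadratic error \<open>\<delta> * \<delta>\<close> into a linear one.\<close>
  define \<delta> where "\<delta> = min 1 (\<epsilon> / (2 * (A + B + 1)))"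
  have d: "\<delta> > 0" "\<delta> \<le> 1" using e A B by (auto simp: \<delta>_def)
  have "2 * (A + B + 1) * \<delta> \<le> 2 * (A + B + 1) * (\<epsilon> / (2 * (A + B + 1)))"
    using A B unfolding \<delta>_def by (intro mult_left_mono) auto
  then have d2: "2 * (A + B + 1) * \<delta> \<le> \<epsilon>" using A B by simp
  obtain h H where h: "(h, H) \<in> S" "\<And>x. x \<in> K \<Longrightarrow> \<bar>f x - h x\<bar> \<le> \<delta>"
    "\<And>x. x \<in> K \<Longrightarrow> norm (F x - H x) \<le> \<delta>"
    using C1_closureE[OF f d(1)] by metis
  obtain k L where k: "(k, L) \<in> S" "\<And>x. x \<in> K \<Longrightarrow> \<bar>g x - k x\<bar> \<le> \<delta>"
    "\<And>x. x \<in> K \<Longrightarrow> norm (G x - L x) \<le> \<delta>"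
    using C1_closureE[OF g d(1)] by metis
  \<comment> \<open>The type of \<open>v\<close> stays open, so that one estimate serves a product
    of two values and a value times a gradient.\<close>
  have gen: "norm (u *\<^sub>R v - u' *\<^sub>R v') \<le> (A + B + 1) * \<delta>"
    if "\<bar>u\<bar> \<le> C" "norm v \<le> D" "\<bar>u - u'\<bar> \<le> \<delta>" "norm (v - v') \<le> \<delta>" "C + D \<le> A + B" "0 \<le> C" "0 \<le> D"
    for u u' C D and v v' :: "'c::real_normed_vector"
  proof -
    have "u *\<^sub>R v - u' *\<^sub>R v' = u *\<^sub>R (v - v') + (u - u') *\<^sub>R v - (u - u') *\<^sub>R (v - v')"
      by (simp add: algebra_simps)
    also have "norm \<dots> \<le> \<bar>u\<bar> * norm (v - v') + \<bar>u - u'\<bar> * norm v + \<bar>u - u'\<bar> * norm (v - v')"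
      by (smt (verit) norm_scaleR norm_triangle_ineq norm_triangle_ineq4)
    also have "\<dots> \<le> C * \<delta> + \<delta> * D + \<delta> * 1"
      using that d by (intro add_mono mult_mono) auto
    also have "\<dots> = (C + D + 1) * \<delta>" by (simp add: algebra_simps)
    also have "\<dots> \<le> (A + B + 1) * \<delta>" using that d by (intro mult_right_mono) auto
    finally show ?thesis .
  qed
  have "\<bar>f x * g x - h x * k x\<bar> \<le> \<epsilon> \<and>
        norm ((f x *\<^sub>R G x + g x *\<^sub>R F x) - (h x *\<^sub>R L x + k x *\<^sub>R H x)) \<le> \<epsilon>" if x: "x \<in> K" for x
  proof
    have "\<bar>f x * g x - h x * k x\<bar> \<le> (A + B + 1) * \<delta>"
      using gen[of "f x" A "g x" B "h x" "k x"] A B h k x by auto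
    also have "\<dots> \<le> 2 * (A + B + 1) * \<delta>" using d A B by simp
    finally show "\<bar>f x * g x - h x * k x\<bar> \<le> \<epsilon>" using d2 by linarith
    have "norm (f x *\<^sub>R G x - h x *\<^sub>R L x) \<le> (A + B + 1) * \<delta>"
      using A B h k x by (intro gen[of _ A _ B]) auto
    moreover have "norm (g x *\<^sub>R F x - k x *\<^sub>R H x) \<le> (A + B + 1) * \<delta>"
      using A B h k x by (intro gen[of _ B _ A]) auto
    ultimately have "norm ((f x *\<^sub>R G x - h x *\<^sub>R L x) + (g x *\<^sub>R F x - k x *\<^sub>R H x)) \<le> \<epsilon>"
      using d2 norm_triangle_ineq[of "f x *\<^sub>R G x - h x *\<^sub>R L x" "g x *\<^sub>R F x - k x *\<^sub>R H x"] by linarith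
    then show "norm ((f x *\<^sub>R G x + g x *\<^sub>R F x) - (h x *\<^sub>R L x + k x *\<^sub>R H x)) \<le> \<epsilon>"
      by (simp add: algebra_simps)
  qed
  then show "\<exists>g' G'. (g', G') \<in> S \<and> (\<forall>x\<in>K. \<bar>f x * g x - g' x\<bar> \<le> \<epsilon> \<and>
        norm ((f x *\<^sub>R G x + g x *\<^sub>R F x) - G' x) \<le> \<epsilon>)"
    using mult[OF h(1) k(1)] by blast
qed

definition ridge :: "(real \<Rightarrow> real) \<Rightarrow> ('a::real_inner) c1pair set" where
  "ridge \<sigma> = {(\<lambda>x. \<sigma> (w \<bullet> x + b), \<lambda>x. deriv \<sigma> (w \<bullet> x + b) *\<^sub>R w) | w b. True}"

lemma ridgeI: "(\<lambda>x. \<sigma> (w \<bullet> x + b), \<lambda>x. deriv \<sigma> (w \<bullet> x + b) *\<^sub>R w) \<in> ridge \<sigma>"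
  unfolding ridge_def by blast

text \<open>Inserting \<open>w \<bullet> x\<close> for the scalar variable turns a scalar unit of
  weight \<open>c\<close> into the unit of weight \<open>c *\<^sub>R w\<close>, so approximation on
  an interval passes to \<open>K\<close>. The gradient error is multiplied by
  \<open>norm w\<close>.\<close>

lemma ridge_lift:
  fixes w :: "'a::real_inner"
  assumes "(g, g') \<in> C1_closure {-R..R} (C1_span (ridge \<sigma>))" and K: "\<And>x. x \<in> K \<Longrightarrow> \<bar>w \<bullet> x\<bar> \<le> R"
  shows "(\<lambda>x. g (w \<bullet> x), \<lambda>x. g' (w \<bullet> x) *\<^sub>R w) \<in> C1_closure K (C1_span (ridge \<sigma>))"
proof (rule C1_closureI)
  fix \<epsilon> :: real assume e: "\<epsilon> > 0"
  have lift: "(\<lambda>x. h (w \<bullet> x), \<lambda>x. h' (w \<bullet> x) *\<^sub>R w) \<in> C1_span (ridge \<sigma>)"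
    if "(h, h') \<in> C1_span (ridge \<sigma>)" for h h'
    using that
  proof (induction h h' rule: C1_span.induct)
    case zero
    then show ?case by (simp add: C1_span.zero)
  next
    case (step f F g G a)
    then obtain c b where f: "f = (\<lambda>x. \<sigma> (c * x + b))" "F = (\<lambda>x. deriv \<sigma> (c * x + b) * c)"
      by (auto simp: ridge_def)
    have "(\<lambda>x. \<sigma> ((c *\<^sub>R w) \<bullet> x + b), \<lambda>x. deriv \<sigma> ((c *\<^sub>R w) \<bullet> x + b) *\<^sub>R (c *\<^sub>R w)) \<in> ridge \<sigma>"
      by (rule ridgeI)
    from C1_span.step[OF this step.IH, of a] show ?case
      by (simp add: f algebra_simps)
  qed
  define \<delta> where "\<delta> = \<epsilon> / (norm w + 1)"
  have "norm w + 1 > 0" by (simp add: add_nonneg_pos)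
  then have d: "\<delta> > 0" "(norm w + 1) * \<delta> = \<epsilon>" using e by (auto simp: \<delta>_def)
  obtain h h' where h: "(h, h') \<in> C1_span (ridge \<sigma>)" "\<And>x. x \<in> {-R..R} \<Longrightarrow> \<bar>g x - h x\<bar> \<le> \<delta>"
    "\<And>x. x \<in> {-R..R} \<Longrightarrow> norm (g' x - h' x) \<le> \<delta>"
    using C1_closureE[OF assms(1) d(1)] by metis
  have "\<bar>g (w \<bullet> x) - h (w \<bullet> x)\<bar> \<le> \<epsilon> \<and> norm (g' (w \<bullet> x) *\<^sub>R w - h' (w \<bullet> x) *\<^sub>R w) \<le> \<epsilon>" if "x \<in> K" for x
  proof
    have wx: "w \<bullet> x \<in> {-R..R}" using K[OF that] by auto
    have "\<delta> \<le> \<epsilon>" "norm w * \<delta> \<le> \<epsilon>" using d by (auto simp: algebra_simps)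
    then show "\<bar>g (w \<bullet> x) - h (w \<bullet> x)\<bar> \<le> \<epsilon>" using h(2)[OF wx] by simp
    have "norm (g' (w \<bullet> x) *\<^sub>R w - h' (w \<bullet> x) *\<^sub>R w) = \<bar>g' (w \<bullet> x) - h' (w \<bullet> x)\<bar> * norm w"
      by (metis norm_scaleR scaleR_left_diff_distrib)
    also have "\<dots> \<le> \<delta> * norm w" using h(3)[OF wx] by (intro mult_right_mono) auto
    finally show "norm (g' (w \<bullet> x) *\<^sub>R w - h' (w \<bullet> x) *\<^sub>R w) \<le> \<epsilon>"
      using \<open>norm w * \<delta> \<le> \<epsilon>\<close> by (simp add: mult.commute)
  qed
  then show "\<exists>g'a G. (g'a, G) \<in> C1_span (ridge \<sigma>) \<and>
      (\<forall>x\<in>K. \<bar>g (w \<bullet> x) - g'a x\<bar> \<le> \<epsilon> \<and> norm (g' (w \<bullet> x) *\<^sub>R w - G x) \<le> \<epsilon>)"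
    using lift[OF h(1)] by blast
qed

section \<open>Ridge functions\<close>

text \<open>The mean value inequality bounds the error by the oscillation of the derivative over the
  step, and uniform continuity on the compact product makes that oscillation small for all
  \<open>x\<close> at once.\<close>

lemma difference_quotient_uniform:
  fixes \<Phi> \<Phi>' :: "real \<Rightarrow> 'a::metric_space \<Rightarrow> 'b::real_normed_vector"
  assumes K: "compact K"
    and der: "\<And>l x. x \<in> K \<Longrightarrow> ((\<lambda>l. \<Phi> l x) has_vector_derivative \<Phi>' l x) (at l)"
    and cont: "continuous_on ({l0..l0+1} \<times> K) (\<lambda>(l, x). \<Phi>' l x)"
    and e: "\<epsilon> > 0"
  obtains h where "h > 0" "\<And>x. x \<in> K \<Longrightarrow> norm ((\<Phi> (l0 + h) x - \<Phi> l0 x) /\<^sub>R h - \<Phi>' l0 x) \<le> \<epsilon>"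
proof -
  have "uniformly_continuous_on ({l0..l0+1} \<times> K) (\<lambda>(l, x). \<Phi>' l x)"
    by (intro compact_uniformly_continuous cont compact_Times K) auto
  then obtain d where d: "d > 0" "\<And>p q. p \<in> {l0..l0+1} \<times> K \<Longrightarrow> q \<in> {l0..l0+1} \<times> K \<Longrightarrow> dist q p < d \<Longrightarrow>
      dist (case q of (l, x) \<Rightarrow> \<Phi>' l x) (case p of (l, x) \<Rightarrow> \<Phi>' l x) < \<epsilon>"
    using e unfolding uniformly_continuous_on_def by metis
  define h where "h = min 1 (d/2)"
  have h: "h > 0" "h \<le> 1" "h < d" using d(1) by (auto simp: h_def)
  have "norm ((\<Phi> (l0 + h) x - \<Phi> l0 x) /\<^sub>R h - \<Phi>' l0 x) \<le> \<epsilon>" if x: "x \<in> K" for x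
  proof -
    have "norm (\<Phi> (l0 + h) x - \<Phi> l0 x - (\<lambda>t. t *\<^sub>R \<Phi>' l0 x) (l0 + h - l0)) \<le> norm (l0 + h - l0) * \<epsilon>"
    proof (rule differentiable_bound_linearization[where S = "{l0..l0+h}" and
          f' = "\<lambda>l t. t *\<^sub>R \<Phi>' l x" and ?x0.0 = l0])
      fix t assume "t \<in> {0..1::real}"
      then show "l0 + t *\<^sub>R (l0 + h - l0) \<in> {l0..l0 + h}" using h by (auto simp: mult_left_le_one_le)
    next
      fix l assume l: "l \<in> {l0..l0+h}"
      show "((\<lambda>a. \<Phi> a x) has_derivative (\<lambda>t. t *\<^sub>R \<Phi>' l x)) (at l within {l0..l0+h})"
        using der[OF x, of l] unfolding has_vector_derivative_def by (rule has_derivative_at_withinI)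
      have "dist (\<Phi>' l x) (\<Phi>' l0 x) < \<epsilon>"
        using d(2)[of "(l0, x)" "(l, x)"] l h x by (auto simp: dist_Pair_Pair dist_real_def)
      then have *: "norm (\<Phi>' l x - \<Phi>' l0 x) \<le> \<epsilon>" by (simp add: dist_norm)
      show "onorm ((\<lambda>t. t *\<^sub>R \<Phi>' l x) - (\<lambda>t. t *\<^sub>R \<Phi>' l0 x)) \<le> \<epsilon>"
      proof (rule onorm_bound)
        fix t :: real
        have "norm (((\<lambda>t. t *\<^sub>R \<Phi>' l x) - (\<lambda>t. t *\<^sub>R \<Phi>' l0 x)) t) = \<bar>t\<bar> * norm (\<Phi>' l x - \<Phi>' l0 x)"
          by (simp flip: scaleR_diff_right)
        also have "\<dots> \<le> \<bar>t\<bar> * \<epsilon>" using * by (intro mult_left_mono) auto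
        finally show "norm (((\<lambda>t. t *\<^sub>R \<Phi>' l x) - (\<lambda>t. t *\<^sub>R \<Phi>' l0 x)) t) \<le> \<epsilon> * norm t"
          by (simp add: mult.commute)
      qed (use e in simp)
    qed (use h in auto)
    then have "norm (\<Phi> (l0 + h) x - \<Phi> l0 x - h *\<^sub>R \<Phi>' l0 x) \<le> h * \<epsilon>" using h by simp
    moreover have "(\<Phi> (l0 + h) x - \<Phi> l0 x) /\<^sub>R h - \<Phi>' l0 x = (\<Phi> (l0 + h) x - \<Phi> l0 x - h *\<^sub>R \<Phi>' l0 x) /\<^sub>R h"
      using h by (simp add: scaleR_right_diff_distrib)
    ultimately have "norm ((\<Phi> (l0 + h) x - \<Phi> l0 x) /\<^sub>R h - \<Phi>' l0 x) =
        norm (\<Phi> (l0 + h) x - \<Phi> l0 x - h *\<^sub>R \<Phi>' l0 x) / h" using h by (simp add: divide_inverse)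
    also have "\<dots> \<le> h * \<epsilon> / h"
      using \<open>norm (\<Phi> (l0 + h) x - \<Phi> l0 x - h *\<^sub>R \<Phi>' l0 x) \<le> h * \<epsilon>\<close> h(1) by (intro divide_right_mono) auto
    finally show ?thesis using h(1) by simp
  qed
  then show ?thesis using that h(1) by blast
qed

lemma smooth_real_funD:
  assumes "smooth_real_fun \<sigma>"
  shows "((deriv ^^ k) \<sigma> has_field_derivative (deriv ^^ Suc k) \<sigma> x) (at x)"
    and "continuous_on S ((deriv ^^ k) \<sigma>)"
proof -
  have d: "(deriv ^^ k) \<sigma> differentiable (at x)" for x
    using assms by (auto simp: smooth_real_fun_def)
  then show "((deriv ^^ k) \<sigma> has_field_derivative (deriv ^^ Suc k) \<sigma> x) (at x)"
    using field_differentiable_def real_differentiable_def DERIV_deriv_iff_real_differentiable by fastforce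
  show "continuous_on S ((deriv ^^ k) \<sigma>)"
    by (intro continuous_at_imp_continuous_on ballI differentiable_imp_continuous_within d)
qed

text \<open>The first function is the k-th derivative of \<sigma>(l r + b) with respect to the
  weight \<open>l\<close>; the second is its derivative in \<open>r\<close>. Each further derivative
  in \<open>l\<close> is a limit of difference quotients of pairs already obtained at
  \<open>l\<close> and \<open>l + h\<close>, hence the induction for all \<open>l\<close>.\<close>

lemma power_deriv_in_closure:
  fixes \<sigma> :: "real \<Rightarrow> real"
  assumes \<sigma>: "smooth_real_fun \<sigma>"
  shows "(\<lambda>r. r ^ k * (deriv ^^ k) \<sigma> (l * r + b),
          \<lambda>r. real k * r ^ (k - 1) * (deriv ^^ k) \<sigma> (l * r + b) + r ^ k * (l * (deriv ^^ Suc k) \<sigma> (l * r + b)))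
        \<in> C1_closure {-R..R} (C1_span (ridge \<sigma>))"
proof (induction k arbitrary: l)
  case 0
  have "(\<lambda>r. \<sigma> (l \<bullet> r + b), \<lambda>r. deriv \<sigma> (l \<bullet> r + b) *\<^sub>R l) \<in> C1_span (ridge \<sigma>)"
    by (intro C1_span_base ridgeI)
  then show ?case by (auto intro!: C1_closure_base simp: mult.commute)
next
  case (Suc k)
  define f where "f = (\<lambda>l r. r ^ k * (deriv ^^ k) \<sigma> (l * r + b))"
  define F where "F = (\<lambda>l r. real k * r ^ (k - 1) * (deriv ^^ k) \<sigma> (l * r + b) +
      r ^ k * (l * (deriv ^^ Suc k) \<sigma> (l * r + b)))"
  define g where "g = (\<lambda>l r. r ^ Suc k * (deriv ^^ Suc k) \<sigma> (l * r + b))"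
  define G where "G = (\<lambda>l r. real (Suc k) * r ^ k * (deriv ^^ Suc k) \<sigma> (l * r + b) +
      r ^ Suc k * (l * (deriv ^^ Suc (Suc k)) \<sigma> (l * r + b)))"
  let ?S = "C1_closure {-R..R} (C1_span (ridge \<sigma>))"
  have lin: "lin_closed ?S" by (intro lin_closed_closure lin_closed_C1_span)
  have IH: "(f l, F l) \<in> ?S" for l unfolding f_def F_def by (rule Suc.IH)
  have pk: "real k * r ^ (k - 1) * r = real k * r ^ k" for r :: real by (cases k) auto
  have chain: "((\<lambda>l. (deriv ^^ j) \<sigma> (l * r + b)) has_field_derivative r * (deriv ^^ Suc j) \<sigma> (l * r + b)) (at l)" for j l r
  proof -
    have "((\<lambda>l. (deriv ^^ j) \<sigma> (l * r + b)) has_field_derivative (deriv ^^ Suc j) \<sigma> (l * r + b) * r) (at l)"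
      by (rule DERIV_chain2[OF smooth_real_funD(1)[OF \<sigma>]]) (auto intro!: derivative_eq_intros)
    then show ?thesis by (simp add: mult.commute)
  qed
  have derf: "((\<lambda>l. f l r) has_field_derivative g l r) (at l)" for l r
    unfolding f_def g_def using DERIV_cmult[OF chain, of "r ^ k" k r l] by (simp add: mult_ac)
  have derF: "((\<lambda>l. F l r) has_field_derivative G l r) (at l)" for l r
    unfolding F_def G_def
    by (rule DERIV_cong, rule DERIV_add[OF DERIV_cmult[OF chain] DERIV_cmult[OF DERIV_mult[OF DERIV_ident chain]]])
      (use pk[of r] in \<open>cases k; simp add: algebra_simps\<close>)
  have "\<exists>h H. (h, H) \<in> ?S \<and> (\<forall>r\<in>{-R..R}. \<bar>g l r - h r\<bar> \<le> \<epsilon> \<and> norm (G l r - H r) \<le> \<epsilon>)"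
    if e: "\<epsilon> > 0" for \<epsilon>
  proof -
    \<comment> \<open>Value and derivative form one map into a product space, so a single step size
      works for both.\<close>
    obtain h where h: "h > 0"
      "\<And>r. r \<in> {-R..R} \<Longrightarrow> norm (((f (l + h) r, F (l + h) r) - (f l r, F l r)) /\<^sub>R h - (g l r, G l r)) \<le> \<epsilon>"
    proof (rule difference_quotient_uniform[where \<Phi> = "\<lambda>l r. (f l r, F l r)" and \<Phi>' = "\<lambda>l r. (g l r, G l r)"
          and K = "{-R..R}" and \<epsilon> = \<epsilon> and ?l0.0 = l])
      show "((\<lambda>l. (f l x, F l x)) has_vector_derivative (g l x, G l x)) (at l)" for l x
        using derf[of x l] derF[of x l]
        by (intro has_vector_derivative_Pair) (auto simp: has_real_derivative_iff_has_vector_derivative)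
      have c: "continuous_on T (\<lambda>x. (deriv ^^ j) \<sigma> (fst x * snd x + b))" for j and T :: "(real \<times> real) set"
        by (rule continuous_on_compose2[OF smooth_real_funD(2)[OF \<sigma>, of UNIV]]) (auto intro!: continuous_intros)
      show "continuous_on ({l..l + 1} \<times> {-R..R}) (\<lambda>(l, x). (g l x, G l x))"
        unfolding g_def G_def split_beta by (intro continuous_intros c)
    qed (use e in auto)
    let ?h = "\<lambda>r. (1/h) * f (l + h) r + (-(1/h)) * f l r" and ?H = "\<lambda>r. (1/h) *\<^sub>R F (l + h) r + (-(1/h)) *\<^sub>R F l r"
    have mem: "(?h, ?H) \<in> ?S"
      by (rule lin_closedD(1)[OF lin IH lin_closed_scale[OF lin IH]])
    have "\<bar>g l r - ?h r\<bar> \<le> \<epsilon> \<and> norm (G l r - ?H r) \<le> \<epsilon>" if r: "r \<in> {-R..R}" for r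
    proof -
      have eq: "((f (l + h) r, F (l + h) r) - (f l r, F l r)) /\<^sub>R h - (g l r, G l r) = (?h r - g l r, ?H r - G l r)"
        using h(1) by (simp add: field_simps)
      have "norm (?h r - g l r) \<le> \<epsilon>" "norm (?H r - G l r) \<le> \<epsilon>"
        using h(2)[OF r] norm_fst_le[of "?h r - g l r" "?H r - G l r"] norm_snd_le[of "?H r - G l r" "?h r - g l r"]
        unfolding eq by linarith+
      then show ?thesis by (metis norm_minus_commute real_norm_def)
    qed
    then show ?thesis using mem by blast
  qed
  then have "(g l, G l) \<in> ?S"
    by (rule C1_closure_closure[OF C1_closureI])
  then show ?case by (simp add: g_def G_def)
qed

text \<open>For smooth \<sigma> this says that \<sigma> is not a polynomial; in this form it lets
  each monomial be isolated.\<close>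

definition nonpoly :: "(real \<Rightarrow> real) \<Rightarrow> bool" where
  "nonpoly \<sigma> \<longleftrightarrow> (\<forall>k. \<exists>b. (deriv ^^ k) \<sigma> b \<noteq> 0)"

text \<open>At weight 0 \<open>power_deriv_in_closure\<close> leaves r^k times a constant, and a
  bias where the k-th derivative of \<sigma> is nonzero yields the monomial. A polynomial close to
  \<open>g'\<close> is then integrated from 0, which controls value and derivative together.\<close>

lemma C1_function_in_ridge_closure_1d:
  fixes g g' :: "real \<Rightarrow> real"
  assumes \<sigma>: "smooth_real_fun \<sigma>" "nonpoly \<sigma>" and R: "R \<ge> 0"
    and g: "\<And>r. (g has_field_derivative g' r) (at r)" and g': "continuous_on UNIV g'"
  shows "(g, g') \<in> C1_closure {-R..R} (C1_span (ridge \<sigma>))"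
proof -
  let ?S = "C1_closure {-R..R} (C1_span (ridge \<sigma>))"
  have lin: "lin_closed ?S" by (intro lin_closed_closure lin_closed_C1_span)
  have mono: "(\<lambda>r. r ^ k, \<lambda>r. real k * r ^ (k - 1)) \<in> ?S" for k
  proof -
    obtain b where b: "(deriv ^^ k) \<sigma> b \<noteq> 0" using \<sigma>(2) by (auto simp: nonpoly_def)
    from lin_closed_scale[OF lin power_deriv_in_closure[OF \<sigma>(1), of k 0 b R], of "1 / (deriv ^^ k) \<sigma> b"] b
    show ?thesis by simp
  qed
  show ?thesis
  proof (rule C1_closure_closure, rule C1_closureI)
    fix \<epsilon> :: real assume e: "\<epsilon> > 0"
    \<comment> \<open>Makes both \<open>\<delta>\<close> and \<open>R * \<delta>\<close>, the error
      after integrating over a length up to \<open>R\<close>, at most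
      \<open>\<epsilon>\<close>.\<close>
    define \<delta> where "\<delta> = \<epsilon> / (R + 1)"
    have d: "\<delta> > 0" "\<delta> \<le> \<epsilon>" "R * \<delta> \<le> \<epsilon>" using e R by (auto simp: \<delta>_def field_simps)
    obtain p where p: "real_polynomial_function p" "\<And>x. x \<in> {-R..R} \<Longrightarrow> \<bar>g' x - p x\<bar> < \<delta>"
      using Stone_Weierstrass_real_polynomial_function[of "{-R..R}" g' \<delta>] g' d(1)
      by (metis compact_Icc continuous_on_subset subset_UNIV)
    obtain a n where pa: "p = (\<lambda>x. \<Sum>i\<le>n. a i * x ^ i)"
      using p(1) unfolding real_polynomial_function_iff_sum by blast
    define q where "q = (\<lambda>x. g 0 + (\<Sum>i\<le>n. a i / real (Suc i) * x ^ Suc i))"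
    have "(\<lambda>x. g 0 * x ^ 0 + (\<Sum>i\<le>n. (a i / real (Suc i)) * x ^ Suc i),
        \<lambda>x. g 0 *\<^sub>R (real 0 * x ^ (0 - 1)) + (\<Sum>i\<le>n. (a i / real (Suc i)) *\<^sub>R (real (Suc i) * x ^ (Suc i - 1)))) \<in> ?S"
      by (intro lin_closedD(1)[OF lin] mono lin_closed_sum[OF lin] finite_atMost)
    then have qS: "(q, p) \<in> ?S" by (simp add: q_def pa)
    have derq: "(q has_field_derivative p r) (at r)" for r
    proof -
      have "((\<lambda>x. a i / real (Suc i) * x ^ Suc i) has_field_derivative a i * r ^ i) (at r)" for i
        by (rule derivative_eq_intros refl)+ (simp add: field_simps)
      then have "(q has_field_derivative 0 + p r) (at r)" unfolding q_def pa
        by (intro DERIV_add DERIV_const DERIV_sum)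
      then show ?thesis by simp
    qed
    have "\<bar>g x - q x\<bar> \<le> \<epsilon> \<and> norm (g' x - p x) \<le> \<epsilon>" if x: "x \<in> {-R..R}" for x
    proof
      show "norm (g' x - p x) \<le> \<epsilon>" using p(2)[OF x] d(2) by simp
      have "norm ((g x - q x) - (g 0 - q 0)) \<le> \<delta> * norm (x - 0)"
      proof (rule field_differentiable_bound[where S = "{-R..R}" and f' = "\<lambda>x. g' x - p x"])
        fix z assume "z \<in> {-R..R}"
        show "((\<lambda>x. g x - q x) has_field_derivative g' z - p z) (at z within {-R..R})"
          by (intro derivative_intros DERIV_subset[OF g] DERIV_subset[OF derq]) auto
        show "norm (g' z - p z) \<le> \<delta>" using p(2)[OF \<open>z \<in> {-R..R}\<close>] by simp
      qed (use x R in auto)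
      moreover have "g 0 - q 0 = 0" by (simp add: q_def)
      moreover have "\<delta> * \<bar>x\<bar> \<le> \<delta> * R" using x d by (intro mult_left_mono) auto
      ultimately show "\<bar>g x - q x\<bar> \<le> \<epsilon>" using d(3) by (simp add: mult.commute)
    qed
    then show "\<exists>h H. (h, H) \<in> ?S \<and> (\<forall>x\<in>{-R..R}. \<bar>g x - h x\<bar> \<le> \<epsilon> \<and> norm (g' x - H x) \<le> \<epsilon>)"
      using qS by blast
  qed
qed

lemma C1_ridge_in_closure:
  fixes w :: "'a::real_inner"
  assumes \<sigma>: "smooth_real_fun \<sigma>" "nonpoly \<sigma>" and K: "bounded K"
    and g: "\<And>r. (g has_field_derivative g' r) (at r)" and g': "continuous_on UNIV g'"
  shows "(\<lambda>x. g (w \<bullet> x), \<lambda>x. g' (w \<bullet> x) *\<^sub>R w) \<in> C1_closure K (C1_span (ridge \<sigma>))"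
proof -
  obtain C where C: "C \<ge> 0" "\<And>x. x \<in> K \<Longrightarrow> norm x \<le> C"
    using K by (metis bounded_pos less_imp_le)
  have "\<bar>w \<bullet> x\<bar> \<le> norm w * C" if "x \<in> K" for x
    by (rule order_trans[OF Cauchy_Schwarz_ineq2]) (intro mult_left_mono C(2)[OF that] norm_ge_zero)
  moreover have "(g, g') \<in> C1_closure {-(norm w * C)..norm w * C} (C1_span (ridge \<sigma>))"
    using C(1) by (intro C1_function_in_ridge_closure_1d[OF \<sigma> _ g g']) simp
  ultimately show ?thesis using ridge_lift by blast
qed

section \<open>Exponential ridge functions\<close>

lemma deriv_exp_real: "(deriv ^^ k) (exp :: real \<Rightarrow> real) = exp"
proof (induction k)
  case (Suc k)
  have "deriv (exp :: real \<Rightarrow> real) = exp" by (rule ext) (rule DERIV_imp_deriv[OF DERIV_exp])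
  then show ?case using Suc by simp
qed simp

lemma smooth_exp: "smooth_real_fun exp"
  unfolding smooth_real_fun_def deriv_exp_real
  using DERIV_exp real_differentiable_def by blast

lemma nonpoly_exp: "nonpoly exp"
  by (simp add: nonpoly_def deriv_exp_real)

text \<open>The product of two exponential units is a single unit whose weight and bias are the
  sums; this is the reason for using exp as an intermediate activation. Bilinearity gives the rest
  by a double induction.\<close>

lemma exp_ridge_mult:
  assumes "(f, F) \<in> C1_span (ridge exp)" "(g, G) \<in> C1_span (ridge exp)"
  shows "(\<lambda>x. f x * g x, \<lambda>x. f x *\<^sub>R G x + g x *\<^sub>R F x) \<in> C1_span (ridge exp)"
  using assms(1)
proof (induction f F rule: C1_span.induct)
  case zero
  then show ?case by (simp add: C1_span.zero)
next
  case (step u U h H a)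
  have dexp: "deriv (exp :: real \<Rightarrow> real) = exp" using deriv_exp_real[of 1] by simp
  obtain w b where u: "u = (\<lambda>x. exp (w \<bullet> x + b))" "U = (\<lambda>x. exp (w \<bullet> x + b) *\<^sub>R w)"
    using step.hyps(1) by (auto simp: ridge_def dexp)
  have "(\<lambda>x. u x * g x, \<lambda>x. u x *\<^sub>R G x + g x *\<^sub>R U x) \<in> C1_span (ridge exp)"
    using assms(2)
  proof (induction g G rule: C1_span.induct)
    case zero
    then show ?case by (simp add: C1_span.zero)
  next
    case (step v V k L c)
    obtain w' b' where v: "v = (\<lambda>x. exp (w' \<bullet> x + b'))" "V = (\<lambda>x. exp (w' \<bullet> x + b') *\<^sub>R w')"
      using step.hyps(1) by (auto simp: ridge_def dexp)
    have "(\<lambda>x. exp ((w + w') \<bullet> x + (b + b')), \<lambda>x. deriv exp ((w + w') \<bullet> x + (b + b')) *\<^sub>R (w + w')) \<in> ridge exp"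
      by (rule ridgeI)
    from C1_span.step[OF this step.IH, of c] show ?case
      by (simp add: u v dexp algebra_simps inner_add_left flip: exp_add)
  qed
  from C1_span_lin[OF this step.IH, of a] show ?case
    by (simp add: algebra_simps)
qed

lemma exp_ridge_bounded:
  fixes K :: "'a::real_inner set"
  assumes "(f, F) \<in> C1_span (ridge exp)" "compact K"
  shows "bounded (f ` K) \<and> bounded (F ` K)"
proof -
  have dexp: "deriv (exp :: real \<Rightarrow> real) = exp" using deriv_exp_real[of 1] by simp
  have "continuous_on K f \<and> continuous_on K F"
    using assms(1)
    by (induction f F rule: C1_span.induct) (auto simp: ridge_def dexp intro!: continuous_intros)
  then show ?thesis by (simp add: compact_continuous_image[OF _ assms(2)] compact_imp_bounded)
qed

lemma exp_closure_mult:
  fixes K :: "'a::real_inner set"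
  assumes "compact K" "(f, F) \<in> C1_closure K (C1_span (ridge exp))" "(g, G) \<in> C1_closure K (C1_span (ridge exp))"
  shows "(\<lambda>x. f x * g x, \<lambda>x. f x *\<^sub>R G x + g x *\<^sub>R F x) \<in> C1_closure K (C1_span (ridge exp))"
  by (rule C1_closure_mult[OF assms(2,3) exp_ridge_mult exp_ridge_bounded[OF _ assms(1)]])

text \<open>An exponential ridge function is a C1 function of \<open>w \<bullet> x\<close>, so it is
  itself a limit of \<sigma>-ridge functions; everything approximated with exp is thereby
  approximated with \<sigma>.\<close>

lemma exp_closure_subset:
  assumes \<sigma>: "smooth_real_fun \<sigma>" "nonpoly \<sigma>" and K: "bounded K"
    and f: "(f, F) \<in> C1_closure K (C1_span (ridge exp))"
  shows "(f, F) \<in> C1_closure K (C1_span (ridge \<sigma>))"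
proof (rule C1_closure_mono[OF _ f])
  fix f F assume "(f, F) \<in> C1_span (ridge exp :: 'a c1pair set)"
  then show "(f, F) \<in> C1_closure K (C1_span (ridge \<sigma>))"
  proof (induction f F rule: C1_span.induct)
    case zero
    then show ?case by (intro C1_closure_base C1_span.zero)
  next
    case (step f F g G a)
    have dexp: "deriv (exp :: real \<Rightarrow> real) = exp" using deriv_exp_real[of 1] by simp
    obtain w b where f: "f = (\<lambda>x. exp (w \<bullet> x + b))" "F = (\<lambda>x. exp (w \<bullet> x + b) *\<^sub>R w)"
      using step.hyps(1) by (auto simp: ridge_def dexp)
    have "(f, F) \<in> C1_closure K (C1_span (ridge \<sigma>))" unfolding f
      by (rule C1_ridge_in_closure[OF \<sigma> K, of "\<lambda>r. exp (r + b)" "\<lambda>r. exp (r + b)"])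
        (auto intro!: derivative_eq_intros continuous_intros)
    then show ?case using step.IH by (intro lin_closedD(1) lin_closed_closure lin_closed_C1_span)
  qed
qed

text \<open>If some derivative vanished identically, the l-th derivative would be a polynomial. A
  nonzero polynomial stays away from 0 far out to the right, so its absolute value has no finite
  integral, and the zero polynomial contradicts the positive integral.\<close>

lemma l_finite_nonpoly:
  assumes \<sigma>: "smooth_real_fun \<sigma>" "l_finite l \<sigma>"
  shows "nonpoly \<sigma>"
proof -
  define g where "g = (deriv ^^ l) \<sigma>"
  have gint: "(\<lambda>s. \<bar>g s\<bar>) integrable_on UNIV" and gpos: "0 < integral UNIV (\<lambda>s. \<bar>g s\<bar>)"
    using \<sigma>(2) by (auto simp: l_finite_def g_def)
  \<comment> \<open>Antidifferentiation, m times downwards from a vanishing derivative: every step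
    adds a constant and raises the degree bound by one.\<close>
  have poly: "\<exists>c n. \<forall>x. (deriv ^^ j) \<sigma> x = (\<Sum>i\<le>n. c i * x ^ i)"
    if "\<forall>x. (deriv ^^ (j + m)) \<sigma> x = 0" for m j
    using that
  proof (induction m arbitrary: j)
    case 0
    then show ?case by (intro exI[of _ "\<lambda>_. 0"] exI[of _ 0]) simp
  next
    case (Suc m)
    then obtain c n where cn: "\<And>x. (deriv ^^ Suc j) \<sigma> x = (\<Sum>i\<le>n. c i * x ^ i)"
      using Suc.IH[of "Suc j"] by auto
    define q where "q = (\<lambda>x. (deriv ^^ j) \<sigma> 0 + (\<Sum>i\<le>n. c i / real (Suc i) * x ^ Suc i))"
    have "((\<lambda>x. (deriv ^^ j) \<sigma> x - q x) has_field_derivative 0) (at r)" for r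
    proof -
      have "((\<lambda>x. c i / real (Suc i) * x ^ Suc i) has_field_derivative c i * r ^ i) (at r)" for i
        by (rule derivative_eq_intros refl)+ (simp add: field_simps)
      then have "(q has_field_derivative 0 + (deriv ^^ Suc j) \<sigma> r) (at r)" unfolding q_def cn
        by (intro DERIV_add DERIV_const DERIV_sum)
      then have "((\<lambda>x. (deriv ^^ j) \<sigma> x - q x) has_field_derivative
          (deriv ^^ Suc j) \<sigma> r - (0 + (deriv ^^ Suc j) \<sigma> r)) (at r)"
        by (rule DERIV_diff[OF smooth_real_funD(1)[OF \<sigma>(1)]])
      then show ?thesis by (simp del: funpow.simps)
    qed
    then have "(deriv ^^ j) \<sigma> x - q x = (deriv ^^ j) \<sigma> 0 - q 0" for x
      by (rule DERIV_isconst_all[rule_format, where f = "\<lambda>x. (deriv ^^ j) \<sigma> x - q x"])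
    moreover have "q 0 = (deriv ^^ j) \<sigma> 0" by (simp add: q_def)
    ultimately have "(deriv ^^ j) \<sigma> x = q x" for x by simp
    moreover have "\<exists>c n. \<forall>x. q x = (\<Sum>i\<le>n. c i * x ^ i)"
      unfolding q_def
      by (intro exI[of _ "case_nat ((deriv ^^ j) \<sigma> 0) (\<lambda>i. c i / real (Suc i))"] exI[of _ "Suc n"])
        (simp add: sum.atMost_Suc_shift del: sum.atMost_Suc)
    ultimately show ?case by simp
  qed
  show ?thesis
  proof (rule ccontr)
    assume "\<not> nonpoly \<sigma>"
    then obtain k where k: "\<forall>x. (deriv ^^ k) \<sigma> x = 0" by (auto simp: nonpoly_def)
    have "\<forall>x. (deriv ^^ (k + m)) \<sigma> x = 0" for m
    proof (induction m)
      case (Suc m)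
      then have "(deriv ^^ (k + m)) \<sigma> = (\<lambda>_. 0)" by auto
      then show ?case by simp
    qed (use k in simp)
    \<comment> \<open>Once the k-th derivative vanishes so do all later ones; \<open>l + k\<close>
      is the form that \<open>poly\<close> expects at \<open>j = l\<close>.\<close>
    from this[of l] have "\<forall>x. (deriv ^^ (l + k)) \<sigma> x = 0" by (simp add: add.commute)
    from poly[OF this] obtain c n where cn: "\<And>x. g x = (\<Sum>i\<le>n. c i * x ^ i)" unfolding g_def by blast
    \<comment> \<open>A nonconstant polynomial is eventually at least 1 in absolute value; a
      constant one is nonzero because the integral is positive.\<close>
    have "\<exists>B>0. \<exists>X. \<forall>x\<ge>X. B \<le> \<bar>g x\<bar>"
    proof (cases "\<exists>k. k \<noteq> 0 \<and> k \<le> n \<and> c k \<noteq> 0")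
      case True
      from polyfun_extremal[OF this, of 1] have "eventually (\<lambda>x. \<bar>g x\<bar> \<ge> 1) at_infinity"
        by (simp add: cn)
      then obtain X where "\<forall>x. norm x \<ge> X \<longrightarrow> \<bar>g x\<bar> \<ge> 1"
        by (auto simp: eventually_at_infinity)
      then show ?thesis by (intro exI[of _ 1] conjI exI[of _ X]) auto
    next
      case False
      then have gc: "g x = c 0" for x
        unfolding cn by (subst sum.remove[of _ 0]) (auto intro!: sum.neutral)
      have "c 0 \<noteq> 0" using gpos by (auto simp: gc)
      then show ?thesis by (intro exI[of _ "\<bar>c 0\<bar>"]) (simp add: gc)
    qed
    then obtain B X where B: "B > 0" "\<And>x. x \<ge> X \<Longrightarrow> B \<le> \<bar>g x\<bar>" by blast
    define I where "I = integral UNIV (\<lambda>s. \<bar>g s\<bar>)"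
    \<comment> \<open>Then \<open>B * N = I + B\<close>, so an interval of length \<open>N\<close>
      alone contributes more than the whole integral.\<close>
    define N where "N = I / B + 1"
    have N: "N > 0" "B * N > I" using B gpos by (auto simp: N_def I_def field_simps add_pos_pos)
    have int: "(\<lambda>s. \<bar>g s\<bar>) integrable_on {X..X+N}"
      using integrable_on_subcbox[OF gint, of X "X + N"] by simp
    have "integral {X..X+N} (\<lambda>_. B) \<le> integral {X..X+N} (\<lambda>s. \<bar>g s\<bar>)"
      using B(2) by (intro integral_le int) auto
    also have "\<dots> \<le> I" unfolding I_def
      using integral_subset_le[OF _ int gint] by simp
    finally show False using N by (simp add: mult.commute)
  qed
qed

section \<open>Bumps and mollification\<close>

lemma DERIV_pos_part_square: "((\<lambda>t. (max 0 t)\<^sup>2) has_field_derivative 2 * max 0 t) (at (t::real))"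
proof -
  have pos: "((\<lambda>t. (max 0 t)\<^sup>2) has_field_derivative 2 * max 0 t) (at t)" if "t > 0" for t :: real
  proof (rule has_field_derivative_transform_within_open[where S = "{0<..}" and f = "\<lambda>t. t\<^sup>2"])
    show "((\<lambda>t. t\<^sup>2) has_real_derivative 2 * max 0 t) (at t)"
      using that by (auto intro!: derivative_eq_intros)
  qed (use that in auto)
  have neg: "((\<lambda>t. (max 0 t)\<^sup>2) has_field_derivative 2 * max 0 t) (at t)" if "t < 0" for t :: real
  proof (rule has_field_derivative_transform_within_open[where S = "{..<0}" and f = "\<lambda>t. 0"])
    show "((\<lambda>t. 0) has_real_derivative 2 * max 0 t) (at t)"
      using that by (auto intro!: derivative_eq_intros)
  qed (use that in auto)
  have "((\<lambda>h::real. (max 0 h)\<^sup>2 / h) \<longlongrightarrow> 0) (at 0)"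
  proof (rule Lim_null_comparison)
    show "\<forall>\<^sub>F h::real in at 0. norm ((max 0 h)\<^sup>2 / h) \<le> \<bar>h\<bar>"
      by (intro always_eventually allI) (auto simp: max_def power2_eq_square)
    show "((\<lambda>h::real. \<bar>h\<bar>) \<longlongrightarrow> 0) (at 0)" by (intro tendsto_rabs_zero tendsto_ident_at)
  qed
  then have "((\<lambda>t::real. (max 0 t)\<^sup>2) has_field_derivative 2 * max 0 0) (at 0)"
    by (simp add: DERIV_def)
  then show ?thesis using pos neg by (metis linorder_neqE_linordered_idom)
qed

text \<open>Squaring the positive part makes the function C1 with an explicit derivative, and bumps
  are never differentiated more than once.\<close>

definition bump1 :: "real \<Rightarrow> real" where "bump1 t = (max 0 (1 - t\<^sup>2))\<^sup>2"
definition bump1' :: "real \<Rightarrow> real" where "bump1' t = 2 * max 0 (1 - t\<^sup>2) * (- 2 * t)"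

lemma DERIV_bump1: "(bump1 has_field_derivative bump1' t) (at t)"
  unfolding bump1_def [abs_def] bump1'_def
  by (rule DERIV_chain2[OF DERIV_pos_part_square]) (auto intro!: derivative_eq_intros)

lemma continuous_on_bump1': "continuous_on S bump1'"
  unfolding bump1'_def[abs_def] by (intro continuous_intros)

lemma bump1_nonneg: "bump1 t \<ge> 0" and bump1_0: "bump1 0 = 1"
  and bump1_outside: "\<bar>t\<bar> \<ge> 1 \<Longrightarrow> bump1 t = 0"
proof -
  assume "\<bar>t\<bar> \<ge> 1"
  then have "t\<^sup>2 \<ge> 1" by (metis one_le_power power2_abs)
  then show "bump1 t = 0" by (simp add: bump1_def)
qed (auto simp: bump1_def)

text \<open>The second component is the Leibniz gradient, so that any class of pairs closed under
  the product rule is closed under finite products.\<close>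

definition pprod :: "'a::real_inner set \<Rightarrow> ('a \<Rightarrow> 'a c1pair) \<Rightarrow> 'a c1pair" where
  "pprod I f = (\<lambda>x. \<Prod>i\<in>I. fst (f i) x, \<lambda>x. \<Sum>i\<in>I. (\<Prod>j\<in>I - {i}. fst (f j) x) *\<^sub>R snd (f i) x)"

lemma pprod_induct:
  assumes "finite I" "P (\<lambda>_. 1, \<lambda>_. 0)" "\<And>i. i \<in> I \<Longrightarrow> P (f i)"
    and mult: "\<And>f F g G. P (f, F) \<Longrightarrow> P (g, G) \<Longrightarrow> P (\<lambda>x. f x * g x, \<lambda>x. f x *\<^sub>R G x + g x *\<^sub>R F x)"
  shows "P (pprod I f)"
  using assms(1,3)
proof (induction I rule: finite_induct)
  case empty
  then show ?case using assms(2) by (simp add: pprod_def)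
next
  case (insert k I)
  have "P (\<lambda>x. fst (f k) x * fst (pprod I f) x, \<lambda>x. fst (f k) x *\<^sub>R snd (pprod I f) x + fst (pprod I f) x *\<^sub>R snd (f k) x)"
    using insert by (intro mult) auto
  moreover have "(\<lambda>x. fst (f k) x *\<^sub>R snd (pprod I f) x + fst (pprod I f) x *\<^sub>R snd (f k) x) = snd (pprod (insert k I) f)"
  proof
    fix x
    have "(\<Sum>i\<in>I. (\<Prod>j\<in>insert k I - {i}. fst (f j) x) *\<^sub>R snd (f i) x) =
        (\<Sum>i\<in>I. fst (f k) x *\<^sub>R ((\<Prod>j\<in>I - {i}. fst (f j) x) *\<^sub>R snd (f i) x))"
    proof (rule sum.cong)
      fix i assume "i \<in> I"
      then have "insert k I - {i} = insert k (I - {i})" using insert.hyps by auto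
      then show "(\<Prod>j\<in>insert k I - {i}. fst (f j) x) *\<^sub>R snd (f i) x =
          fst (f k) x *\<^sub>R ((\<Prod>j\<in>I - {i}. fst (f j) x) *\<^sub>R snd (f i) x)"
        using insert.hyps by simp
    qed simp
    then show "fst (f k) x *\<^sub>R snd (pprod I f) x + fst (pprod I f) x *\<^sub>R snd (f k) x = snd (pprod (insert k I) f) x"
      using insert.hyps by (simp add: pprod_def scaleR_sum_right)
  qed
  moreover have "(\<lambda>x. fst (f k) x * fst (pprod I f) x) = fst (pprod (insert k I) f)"
    using insert.hyps by (simp add: pprod_def)
  ultimately show ?case by simp
qed

text \<open>A product of one-variable bumps rather than a radial one: each factor is a ridge
  function in a coordinate direction, so the product lies in the closure of the exponential algebra.
  The value at 0 is 1; normalisation is left to \<open>bump_mass\<close>.\<close>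

definition bump_pair :: "real \<Rightarrow> ('a::euclidean_space) c1pair" where
  "bump_pair \<epsilon> = pprod Basis (\<lambda>i. (\<lambda>x. bump1 ((i \<bullet> x) / \<epsilon>), \<lambda>x. (bump1' ((i \<bullet> x) / \<epsilon>) / \<epsilon>) *\<^sub>R i))"

definition "bump \<epsilon> = fst (bump_pair \<epsilon>)"
definition "bump' \<epsilon> = snd (bump_pair \<epsilon>)"

lemma bump_eq: "bump \<epsilon> x = (\<Prod>i\<in>Basis. bump1 ((i \<bullet> x) / \<epsilon>))"
  by (simp add: bump_def bump_pair_def pprod_def)

lemma bump_nonneg: "bump \<epsilon> x \<ge> 0"
  by (simp add: bump_eq prod_nonneg bump1_nonneg)

lemma bump_0: "bump \<epsilon> 0 = 1"
  by (simp add: bump_eq bump1_0)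

lemma bump_outside:
  assumes "\<epsilon> > 0" "x \<notin> cbox (- (\<epsilon> *\<^sub>R One)) (\<epsilon> *\<^sub>R One)"
  shows "bump \<epsilon> x = 0"
proof -
  obtain i :: 'a where i: "i \<in> Basis" "\<bar>i \<bullet> x\<bar> > \<epsilon>"
    proof -
    obtain i :: 'a where "i \<in> Basis" "\<not> (- \<epsilon> \<le> x \<bullet> i \<and> x \<bullet> i \<le> \<epsilon>)"
      using assms(2) by (auto simp: mem_box)
    then show ?thesis by (intro that[of i]) (auto simp: inner_commute)
  qed
  then have "bump1 ((i \<bullet> x) / \<epsilon>) = 0" using assms(1) by (intro bump1_outside) auto
  then show ?thesis using i unfolding bump_eq by (intro prod_zero) auto
qed

lemma bump_C1:
  fixes x :: "'a::euclidean_space" and S :: "'a set"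
  shows "GDERIV (bump \<epsilon>) x :> bump' \<epsilon> x" "continuous_on S (bump' \<epsilon>)" "continuous_on S (bump \<epsilon>)"
proof -
  have "(\<forall>x. GDERIV (fst p) x :> snd p x) \<and> continuous_on UNIV (snd p)"
    if "p = bump_pair \<epsilon>" for p :: "'a c1pair"
    unfolding that bump_pair_def
  proof (rule pprod_induct, goal_cases)
    case (3 i)
    have "GDERIV (\<lambda>x. bump1 ((i \<bullet> x) / \<epsilon>)) x :> (bump1' ((i \<bullet> x) / \<epsilon>)) *\<^sub>R ((1 / \<epsilon>) *\<^sub>R i)" for x
      by (rule GDERIV_DERIV_compose[OF _ DERIV_bump1])
        (auto simp: gderiv_def inner_commute divide_inverse intro!: derivative_eq_intros)
    moreover have "continuous_on UNIV (\<lambda>x. (bump1' ((i \<bullet> x) / \<epsilon>) / \<epsilon>) *\<^sub>R i)"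
      unfolding divide_inverse
      by (intro continuous_intros continuous_on_compose2[OF continuous_on_bump1'[of UNIV]]) auto
    ultimately show ?case by simp
  next
    case (4 f F g G)
    have "continuous_on UNIV f" "continuous_on UNIV g"
      using 4 by (auto simp: continuous_on_eq_continuous_within gderiv_def intro: has_derivative_continuous)
    then show ?case using 4 by (auto intro!: GDERIV_mult continuous_intros)
  qed (auto intro: GDERIV_const)
  from this[OF refl] have *: "GDERIV (bump \<epsilon>) x :> bump' \<epsilon> x" and **: "continuous_on UNIV (bump' \<epsilon> :: 'a \<Rightarrow> 'a)" for x :: 'a
    by (auto simp: bump_def bump'_def)
  show "GDERIV (bump \<epsilon>) x :> bump' \<epsilon> x" "continuous_on S (bump' \<epsilon>)"
    using * ** by (auto intro: continuous_on_subset)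
  show "continuous_on S (bump \<epsilon>)"
    using * by (auto simp: continuous_on_eq_continuous_within gderiv_def
        intro: has_derivative_continuous has_derivative_at_withinI)
qed

lemma bump_in_exp_closure:
  fixes K :: "'a::euclidean_space set"
  assumes K: "compact K"
  shows "(\<lambda>x. bump \<epsilon> (x - y), \<lambda>x. bump' \<epsilon> (x - y)) \<in> C1_closure K (C1_span (ridge exp))"
proof -
  define f where "f = (\<lambda>i::'a. (\<lambda>x. bump1 ((i \<bullet> x + (- (i \<bullet> y))) / \<epsilon>), \<lambda>x. (bump1' ((i \<bullet> x + (- (i \<bullet> y))) / \<epsilon>) / \<epsilon>) *\<^sub>R i))"
  have "pprod Basis f \<in> C1_closure K (C1_span (ridge exp))"
  proof (rule pprod_induct)
    show "(\<lambda>_. 1, \<lambda>_. 0) \<in> C1_closure K (C1_span (ridge exp))"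
      using C1_ridge_in_closure[OF smooth_exp nonpoly_exp compact_imp_bounded[OF K], of "\<lambda>_. 1" "\<lambda>_. 0" 0] by simp
    show "f i \<in> C1_closure K (C1_span (ridge exp))" for i
      unfolding f_def
    proof (rule C1_ridge_in_closure[OF smooth_exp nonpoly_exp compact_imp_bounded[OF K],
          of "\<lambda>r. bump1 ((r + (- (i \<bullet> y))) / \<epsilon>)" "\<lambda>r. bump1' ((r + (- (i \<bullet> y))) / \<epsilon>) / \<epsilon>"])
      show "((\<lambda>r. bump1 ((r + (- (i \<bullet> y))) / \<epsilon>)) has_real_derivative bump1' ((r + (- (i \<bullet> y))) / \<epsilon>) / \<epsilon>) (at r)" for r
      proof -
        have "((\<lambda>r. (r + (- (i \<bullet> y))) / \<epsilon>) has_real_derivative 1 / \<epsilon>) (at r)"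
          by (intro DERIV_cdivide) (auto intro!: derivative_eq_intros)
        from DERIV_chain2[OF DERIV_bump1 this] show ?thesis by simp
      qed
      show "continuous_on UNIV (\<lambda>r. bump1' ((r + (- (i \<bullet> y))) / \<epsilon>) / \<epsilon>)"
        unfolding divide_inverse
        by (intro continuous_intros continuous_on_compose2[OF continuous_on_bump1'[of UNIV]]) auto
    qed
  qed (use exp_closure_mult[OF K] in auto)
  moreover have "pprod Basis f = (\<lambda>x. bump \<epsilon> (x - y), \<lambda>x. bump' \<epsilon> (x - y))"
    by (simp add: bump_def bump'_def bump_pair_def pprod_def f_def inner_diff_right)
  ultimately show ?thesis by simp
qed

text \<open>By uniform continuity one tagged division serves all \<open>x\<close>. The weights are
  the exact integrals of \<open>f\<close> over the cells, not samples of \<open>f\<close>, so they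
  sum to the integral of \<open>f\<close>. A zero mean thus survives discretisation, which the
  argument in a chart relies on.\<close>

lemma riemann_sum_uniform:
  fixes F :: "'a::euclidean_space \<Rightarrow> 'b::metric_space \<Rightarrow> 'c::banach" and f :: "'a \<Rightarrow> real"
  assumes B: "compact B" and F: "continuous_on (cbox a b \<times> B) (\<lambda>(y, x). F y x)"
    and f: "continuous_on (cbox a b) f" and e: "\<epsilon> > 0"
  obtains I :: "('a \<times> 'a set) set" and m where "finite I" "\<And>i. i \<in> I \<Longrightarrow> fst i \<in> cbox a b"
    "sum m I = integral (cbox a b) f"
    "\<And>x. x \<in> B \<Longrightarrow> norm (integral (cbox a b) (\<lambda>y. f y *\<^sub>R F y x) - (\<Sum>i\<in>I. m i *\<^sub>R F (fst i) x)) \<le> \<epsilon>"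
proof -
  obtain C where C: "C > 0" "\<And>y. y \<in> cbox a b \<Longrightarrow> \<bar>f y\<bar> \<le> C"
    using compact_imp_bounded[OF compact_continuous_image[OF f compact_cbox]]
    unfolding bounded_pos by auto
  \<comment> \<open>The added 1 keeps the denominator positive for a degenerate box.\<close>
  define \<eta> where "\<eta> = \<epsilon> / (C * (content (cbox a b) + 1))"
  have c0: "content (cbox a b) \<ge> 0" by simp
  have eta: "\<eta> > 0" "C * \<eta> * content (cbox a b) \<le> \<epsilon>"
  proof -
    have "C * (content (cbox a b) + 1) > 0" using C(1) c0 by (intro mult_pos_pos add_nonneg_pos) auto
    then show "\<eta> > 0" using e by (simp add: \<eta>_def)
    have "C * \<eta> * content (cbox a b) \<le> C * \<eta> * (content (cbox a b) + 1)"
      using \<open>\<eta> > 0\<close> C(1) by (intro mult_left_mono) auto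
    also have "\<dots> = \<eta> * (C * (content (cbox a b) + 1))" by (simp add: mult_ac)
    also have "\<dots> = \<epsilon>" unfolding \<eta>_def
      by (rule nonzero_eq_divide_eq[THEN iffD1, OF _ refl]) (use \<open>C * (content (cbox a b) + 1) > 0\<close> in linarith)
    finally show "C * \<eta> * content (cbox a b) \<le> \<epsilon>" .
  qed
  have "uniformly_continuous_on (cbox a b \<times> B) (\<lambda>(y, x). F y x)"
    by (intro compact_uniformly_continuous F compact_Times B compact_cbox)
  then obtain d where d: "d > 0" "\<And>p q. p \<in> cbox a b \<times> B \<Longrightarrow> q \<in> cbox a b \<times> B \<Longrightarrow> dist q p < d \<Longrightarrow>
      dist (case q of (y, x) \<Rightarrow> F y x) (case p of (y, x) \<Rightarrow> F y x) < \<eta>"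
    using eta(1) unfolding uniformly_continuous_on_def by metis
  obtain I where I: "I tagged_division_of (cbox a b)" "(\<lambda>y. ball y d) fine I"
    using fine_division_exists[OF gauge_ball[OF d(1)], of a b] .
  have fin: "finite I" using I(1) by blast
  define m where "m = (\<lambda>i::'a \<times> 'a set. integral (snd i) f)"
  have fi: "f integrable_on cbox a b" by (intro integrable_continuous f)
  show ?thesis
  proof (rule that[of I m])
    show "fst i \<in> cbox a b" if "i \<in> I" for i using I(1) that by (cases i) (auto dest: tagged_division_ofD)
    show "sum m I = integral (cbox a b) f"
      using integral_combine_tagged_division_topdown[OF fi I(1)] by (simp add: m_def split_beta)
    fix x assume x: "x \<in> B"
    have Fx: "continuous_on (cbox a b) (\<lambda>y. F y x)"
    proof -
      have "continuous_on (cbox a b) (\<lambda>y. case (y, x) of (y, x) \<Rightarrow> F y x)"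
        by (rule continuous_on_compose2[OF F]) (use x in \<open>auto intro!: continuous_intros\<close>)
      then show ?thesis by simp
    qed
    have gi: "(\<lambda>y. f y *\<^sub>R F y x) integrable_on cbox a b"
      by (intro integrable_continuous continuous_intros f Fx)
    have cell: "norm (integral (snd i) (\<lambda>y. f y *\<^sub>R F y x) - m i *\<^sub>R F (fst i) x) \<le> C * \<eta> * content (snd i)"
      if i: "i \<in> I" for i
    proof -
      obtain t k where tk: "i = (t, k)" by (cases i)
      have k: "k \<subseteq> cbox a b" "t \<in> k" "\<exists>u v. k = cbox u v"
        using tagged_division_ofD[OF I(1)] i tk by blast+
      then obtain u v where uv: "k = cbox u v" by blast
      have tb: "t \<in> cbox a b" using k by auto
      have kd: "k \<subseteq> ball t d" using I(2) i tk by (auto simp: fine_def)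
      have i1: "(\<lambda>y. f y *\<^sub>R F y x) integrable_on k" "f integrable_on k"
        using integrable_on_subcbox[OF gi] integrable_on_subcbox[OF fi] k uv by auto
      have i2: "(\<lambda>y. f y *\<^sub>R F t x) integrable_on k"
        using i1(2) by (rule integrable_on_scaleR_left)
      have "integral k (\<lambda>y. f y *\<^sub>R F y x) - m i *\<^sub>R F t x = integral k (\<lambda>y. f y *\<^sub>R F y x - f y *\<^sub>R F t x)"
        using integral_diff[OF i1(1) i2] integral_unique[OF has_integral_scaleR_left[OF integrable_integral[OF i1(2)], of "F t x"]]
        by (simp add: m_def tk)
      also have "norm \<dots> \<le> (C * \<eta>) * content (cbox u v)"
        unfolding uv
      proof (rule integrable_bound)
        show "0 \<le> C * \<eta>" using C(1) eta(1) by simp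
        show "(\<lambda>y. f y *\<^sub>R F y x - f y *\<^sub>R F t x) integrable_on cbox u v"
          using integrable_diff[OF i1(1) i2] uv by simp
        fix y assume "y \<in> cbox u v"
        then have y: "y \<in> cbox a b" "dist t y < d" using k kd uv by auto
        have "dist (F y x) (F t x) < \<eta>"
          using d(2)[of "(t, x)" "(y, x)"] y tb x by (auto simp: dist_Pair_Pair dist_commute)
        then have "\<bar>f y\<bar> * norm (F y x - F t x) \<le> C * \<eta>"
          using C y by (intro mult_mono) (auto simp: dist_norm)
        then show "norm (f y *\<^sub>R F y x - f y *\<^sub>R F t x) \<le> C * \<eta>"
          by (simp flip: scaleR_diff_right)
      qed
      finally show ?thesis using tk uv by simp
    qed
    have "integral (cbox a b) (\<lambda>y. f y *\<^sub>R F y x) - (\<Sum>i\<in>I. m i *\<^sub>R F (fst i) x) =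
        (\<Sum>i\<in>I. integral (snd i) (\<lambda>y. f y *\<^sub>R F y x) - m i *\<^sub>R F (fst i) x)"
      using integral_combine_tagged_division_topdown[OF gi I(1)] by (simp add: split_beta sum_subtractf)
    also have "norm \<dots> \<le> (\<Sum>i\<in>I. C * \<eta> * content (snd i))"
      by (rule sum_norm_le) (rule cell)
    also have "\<dots> = C * \<eta> * content (cbox a b)"
      using additive_content_tagged_division[OF I(1)] by (simp add: split_beta flip: sum_distrib_left)
    finally show "norm (integral (cbox a b) (\<lambda>y. f y *\<^sub>R F y x) - (\<Sum>i\<in>I. m i *\<^sub>R F (fst i) x)) \<le> \<epsilon>"
      using eta(2) by linarith
  qed (rule fin)
qed

section \<open>Mollification\<close>

abbreviation "cube r \<equiv> cbox (- (r *\<^sub>R One)) (r *\<^sub>R One)"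

definition bump_mass :: "'a::euclidean_space itself \<Rightarrow> real \<Rightarrow> real" where
  "bump_mass _ \<epsilon> = integral (cube \<epsilon>) (bump \<epsilon> :: 'a \<Rightarrow> real)"

lemma bump_mass_pos:
  assumes "\<epsilon> > 0"
  shows "bump_mass TYPE('a::euclidean_space) \<epsilon> > 0"
proof (rule ccontr)
  let ?b = "bump \<epsilon> :: 'a \<Rightarrow> real"
  assume "\<not> bump_mass TYPE('a) \<epsilon> > 0"
  moreover have "bump_mass TYPE('a) \<epsilon> \<ge> 0"
    unfolding bump_mass_def
    by (intro integral_nonneg integrable_continuous bump_C1 bump_nonneg)
  ultimately have "integral (cube \<epsilon>) ?b = 0" by (simp add: bump_mass_def)
  moreover have "box (- (\<epsilon> *\<^sub>R One)) (\<epsilon> *\<^sub>R One :: 'a) \<noteq> {}"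
    using assms by (simp add: box_ne_empty)
  moreover have "(0 :: 'a) \<in> cube \<epsilon>" using assms by (simp add: mem_box)
  ultimately have "?b 0 = 0"
    using has_integral_0_cbox_imp_0[of "- (\<epsilon> *\<^sub>R One)" "\<epsilon> *\<^sub>R One" ?b 0] bump_C1(3) bump_nonneg
    by (metis integrable_continuous integrable_integral)
  then show False by (simp add: bump_0)
qed

text \<open>Substitute y = x - z; since \<open>f\<close> and the bump vanish off their boxes, both
  integrals equal the one over the whole space.\<close>

lemma convolution_commute:
  fixes f :: "'a::euclidean_space \<Rightarrow> 'b::euclidean_space"
  assumes e: "\<epsilon> > 0" and f: "continuous_on UNIV f" and supp: "\<And>y. y \<notin> cbox a b \<Longrightarrow> f y = 0"
  shows "integral (cbox a b) (\<lambda>y. bump \<epsilon> (x - y) *\<^sub>R f y) = integral (cube \<epsilon>) (\<lambda>z. bump \<epsilon> z *\<^sub>R f (x - z))"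
proof -
  let ?h = "\<lambda>z. bump \<epsilon> z *\<^sub>R f (x - z)" and ?g = "\<lambda>y. bump \<epsilon> (x - y) *\<^sub>R f y"
  have c: "continuous_on S (\<lambda>y. f (x - y))" "continuous_on S (\<lambda>y. bump \<epsilon> (x - y))" for S
    by (rule continuous_on_compose2[OF f] continuous_on_compose2[OF bump_C1(3)[of UNIV]];
        auto intro!: continuous_intros)+
  have "?h integrable_on cube \<epsilon>"
    by (intro integrable_continuous continuous_intros bump_C1 c)
  then have "(?h has_integral integral (cube \<epsilon>) ?h) (cube \<epsilon>)" by (rule integrable_integral)
  from has_integral_affinity[OF this, of "-1" x]
  have "((\<lambda>y. ?h (-y + x)) has_integral integral (cube \<epsilon>) ?h) ((\<lambda>y. - y + x) ` cube \<epsilon>)"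
    by simp
  then have "(?g has_integral integral (cube \<epsilon>) ?h) ((\<lambda>y. - y + x) ` cube \<epsilon>)"
    by simp
  moreover have "?g y = 0" if "y \<notin> (\<lambda>y. - y + x) ` cube \<epsilon>" for y
  proof -
    have "x - y \<notin> cube \<epsilon>"
      using that by (metis (no_types, lifting) add_uminus_conv_diff diff_add_cancel image_eqI minus_diff_eq)
    then show ?thesis by (simp add: bump_outside[OF e])
  qed
  ultimately have "(?g has_integral integral (cube \<epsilon>) ?h) UNIV"
    by (rule has_integral_on_superset) auto
  moreover have "(?g has_integral integral (cbox a b) ?g) UNIV"
    by (rule has_integral_on_superset[OF integrable_integral])
      (auto intro!: integrable_continuous continuous_intros c continuous_on_subset[OF f] simp: supp)
  ultimately show ?thesis by (rule has_integral_unique[symmetric])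
qed

text \<open>Points at distance below 1 lie either both in a slightly enlarged compact ball or both
  where \<open>f\<close> vanishes.\<close>

lemma compact_support_uniformly_continuous:
  fixes f :: "'a::euclidean_space \<Rightarrow> 'b::euclidean_space"
  assumes f: "continuous_on UNIV f" and supp: "\<And>y. y \<notin> cbox a b \<Longrightarrow> f y = 0" and "\<eta> > 0"
  obtains d where "d > 0" "\<And>x y. dist x y < d \<Longrightarrow> dist (f x) (f y) < \<eta>"
proof -
  obtain R where R: "cbox a b \<subseteq> ball 0 R"
    using bounded_cbox bounded_subset_ballD by blast
  have "uniformly_continuous_on (cball 0 (R + 1)) f"
    by (intro compact_uniformly_continuous continuous_on_subset[OF f]) auto
  then obtain d where d: "d > 0" "\<And>x y. x \<in> cball 0 (R + 1) \<Longrightarrow> y \<in> cball 0 (R + 1) \<Longrightarrow> dist x y < d \<Longrightarrow> dist (f x) (f y) < \<eta>"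
    using \<open>\<eta> > 0\<close> unfolding uniformly_continuous_on_def by metis
  show ?thesis
  proof (rule that[of "min d 1"])
    fix x y :: 'a assume xy: "dist x y < min d 1"
    have "norm x \<le> norm y + dist x y" "norm y \<le> norm x + dist x y"
      by (metis dist_norm norm_triangle_sub, metis dist_norm dist_commute norm_triangle_sub)
    then consider "x \<in> cball 0 (R + 1)" "y \<in> cball 0 (R + 1)" | "x \<notin> ball 0 R" "y \<notin> ball 0 R"
      using xy by fastforce
    then show "dist (f x) (f y) < \<eta>"
    proof cases
      case 2
      then have "f x = 0" "f y = 0" using R supp by blast+
      then show ?thesis using \<open>\<eta> > 0\<close> by simp
    qed (use d xy in auto)
  qed (use d in simp)
qed

text \<open>The estimate holds for every \<epsilon> up to \<delta>, so that a function and its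
  gradient can be mollified with a common \<epsilon>.\<close>

lemma mollify:
  fixes f :: "'a::euclidean_space \<Rightarrow> 'b::euclidean_space"
  assumes f: "continuous_on UNIV f" and supp: "\<And>y. y \<notin> cbox a b \<Longrightarrow> f y = 0" and "\<eta> > 0"
  obtains \<delta> where "\<delta> > 0" "\<And>\<epsilon> x. 0 < \<epsilon> \<Longrightarrow> \<epsilon> \<le> \<delta> \<Longrightarrow>
     norm ((1 / bump_mass TYPE('a) \<epsilon>) *\<^sub>R integral (cbox a b) (\<lambda>y. bump \<epsilon> (x - y) *\<^sub>R f y) - f x) \<le> \<eta>"
proof -
  obtain d where d: "d > 0" "\<And>x y. dist x y < d \<Longrightarrow> dist (f x) (f y) < \<eta>"
    using compact_support_uniformly_continuous[OF assms] by blast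
  \<comment> \<open>Points of the cube of half side \<epsilon> have norm at most
    \<open>\<epsilon> * norm One\<close>; the factor 2 keeps this strictly below
    \<open>d\<close>.\<close>
  define \<delta> where "\<delta> = d / (2 * norm (One :: 'a))"
  have One0: "norm (One :: 'a) > 0" by simp
  show ?thesis
  proof (rule that[of \<delta>])
    show "\<delta> > 0" using d(1) One0 by (simp add: \<delta>_def)
    fix \<epsilon> x assume e: "0 < \<epsilon>" "\<epsilon> \<le> \<delta>"
    let ?N = "bump_mass TYPE('a) \<epsilon>"
    have N: "?N > 0" using e by (intro bump_mass_pos)
    have c: "continuous_on S (\<lambda>y. f (x - y))" for S
      by (rule continuous_on_compose2[OF f]) (auto intro!: continuous_intros)
    have i1: "(\<lambda>z. bump \<epsilon> z *\<^sub>R f (x - z)) integrable_on cube \<epsilon>" "(\<lambda>z :: 'a. bump \<epsilon> z *\<^sub>R f x) integrable_on cube \<epsilon>"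
      by (intro integrable_continuous continuous_intros bump_C1 c)+
    have nz: "norm z < d" if "z \<in> cube \<epsilon>" for z :: 'a
    proof -
      have "norm z \<le> norm (\<epsilon> *\<^sub>R One :: 'a)"
        using that e by (intro norm_le_componentwise) (force simp: mem_box)
      also have "\<dots> = \<epsilon> * norm (One :: 'a)" using e by simp
      also have "\<dots> \<le> \<delta> * norm (One :: 'a)" using e by (intro mult_right_mono) auto
      also have "\<dots> < d" using d(1) One0 by (simp add: \<delta>_def)
      finally show ?thesis .
    qed
    have Nf: "integral (cube \<epsilon>) (\<lambda>z :: 'a. bump \<epsilon> z *\<^sub>R f x) = ?N *\<^sub>R f x"
      unfolding bump_mass_def
      by (rule integral_unique[OF has_integral_scaleR_left[OF integrable_integral[OF integrable_continuous[OF bump_C1(3)]]]])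
    have "integral (cube \<epsilon>) (\<lambda>z. bump \<epsilon> z *\<^sub>R f (x - z)) - ?N *\<^sub>R f x =
        integral (cube \<epsilon>) (\<lambda>z. bump \<epsilon> z *\<^sub>R f (x - z) - bump \<epsilon> z *\<^sub>R f x)"
      using integral_diff[OF i1] Nf by simp
    also have "norm \<dots> \<le> integral (cube \<epsilon>) (\<lambda>z :: 'a. \<eta> * bump \<epsilon> z)"
    proof (rule integral_norm_bound_integral)
      show "(\<lambda>z. bump \<epsilon> z *\<^sub>R f (x - z) - bump \<epsilon> z *\<^sub>R f x) integrable_on cube \<epsilon>"
        using i1 by (rule integrable_diff)
      show "(\<lambda>z :: 'a. \<eta> * bump \<epsilon> z) integrable_on cube \<epsilon>"
        by (intro integrable_continuous continuous_intros bump_C1)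
      fix z :: 'a assume z: "z \<in> cube \<epsilon>"
      have "dist (f (x - z)) (f x) < \<eta>" using nz[OF z] by (intro d(2)) (simp add: dist_norm)
      then have "bump \<epsilon> z * norm (f (x - z) - f x) \<le> bump \<epsilon> z * \<eta>"
        by (intro mult_left_mono bump_nonneg) (simp add: dist_norm)
      then show "norm (bump \<epsilon> z *\<^sub>R f (x - z) - bump \<epsilon> z *\<^sub>R f x) \<le> \<eta> * bump \<epsilon> z"
        by (simp add: bump_nonneg mult.commute flip: scaleR_diff_right)
    qed
    also have "\<dots> = \<eta> * ?N" by (simp add: bump_mass_def)
    finally have *: "norm (integral (cbox a b) (\<lambda>y. bump \<epsilon> (x - y) *\<^sub>R f y) - ?N *\<^sub>R f x) \<le> \<eta> * ?N"
      using convolution_commute[where a = a and b = b and x = x, OF e(1) f supp] by simp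
    have "(1 / ?N) *\<^sub>R integral (cbox a b) (\<lambda>y. bump \<epsilon> (x - y) *\<^sub>R f y) - f x =
        (1 / ?N) *\<^sub>R (integral (cbox a b) (\<lambda>y. bump \<epsilon> (x - y) *\<^sub>R f y) - ?N *\<^sub>R f x)"
      using N by (simp add: scaleR_diff_right)
    also have "norm \<dots> \<le> (1 / ?N) * (\<eta> * ?N)" using * N by (simp add: pos_divide_le_eq)
    finally show "norm ((1 / ?N) *\<^sub>R integral (cbox a b) (\<lambda>y. bump \<epsilon> (x - y) *\<^sub>R f y) - f x) \<le> \<eta>"
      using N by simp
  qed
qed

text \<open>Differentiation under the integral sign; \<open>blinfun_inner_right\<close> turns
  gradients into operators for the Leibniz rule, and the integral is pulled back out of the inner
  product.\<close>

lemma GDERIV_integral: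
  fixes \<Phi> :: "'a::euclidean_space \<Rightarrow> 'b::euclidean_space \<Rightarrow> real"
  assumes der: "\<And>x t. t \<in> cbox a b \<Longrightarrow> GDERIV (\<lambda>x. \<Phi> x t) x :> \<Psi> x t"
    and cont: "continuous_on (UNIV \<times> cbox a b) (\<lambda>(x, t). \<Psi> x t)"
    and int: "\<And>x. continuous_on (cbox a b) (\<Phi> x)"
  shows "GDERIV (\<lambda>x. integral (cbox a b) (\<Phi> x)) x :> integral (cbox a b) (\<Psi> x)"
proof -
  have cont': "continuous_on (UNIV \<times> cbox a b) (\<lambda>(x, t). blinfun_inner_right (\<Psi> x t))"
    using bounded_linear.continuous_on[OF bounded_linear_blinfun_inner_right cont] by (simp add: split_beta)
  have "((\<lambda>x. integral (cbox a b) (\<Phi> x)) has_derivative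
      blinfun_apply (integral (cbox a b) (\<lambda>t. blinfun_inner_right (\<Psi> x t)))) (at x within UNIV)"
  proof (rule leibniz_rule[OF _ _ cont'])
    show "((\<lambda>x. \<Phi> x t) has_derivative blinfun_apply (blinfun_inner_right (\<Psi> x t))) (at x within UNIV)"
      if "t \<in> cbox a b" for x t
      using der[OF that, of x] by (simp add: gderiv_def inner_commute[of _ "\<Psi> x t"])
  qed (auto intro: integrable_continuous int)
  moreover have c: "continuous_on (cbox a b) (\<Psi> x)"
  proof -
    have "continuous_on (cbox a b) (\<lambda>t. case (x, t) of (x, t) \<Rightarrow> \<Psi> x t)"
      by (rule continuous_on_compose2[OF cont]) (auto intro!: continuous_intros)
    then show ?thesis by simp
  qed
  have "blinfun_apply (integral (cbox a b) (\<lambda>t. blinfun_inner_right (\<Psi> x t))) = (\<lambda>h. h \<bullet> integral (cbox a b) (\<Psi> x))"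
  proof
    fix h
    have "(\<lambda>t. blinfun_inner_right (\<Psi> x t)) integrable_on cbox a b"
      by (intro integrable_continuous bounded_linear.continuous_on[OF bounded_linear_blinfun_inner_right c])
    then have "blinfun_apply (integral (cbox a b) (\<lambda>t. blinfun_inner_right (\<Psi> x t))) h =
        integral (cbox a b) (\<lambda>t. \<Psi> x t \<bullet> h)"
      by (subst blinfun_apply_integral) auto
    also have "\<dots> = integral (cbox a b) (\<Psi> x) \<bullet> h"
      using integral_linear[OF integrable_continuous[OF c] bounded_linear_inner_left[of h]] by (simp add: o_def)
    finally show "blinfun_apply (integral (cbox a b) (\<lambda>t. blinfun_inner_right (\<Psi> x t))) h = h \<bullet> integral (cbox a b) (\<Psi> x)"
      by (simp add: inner_commute)
  qed
  ultimately show ?thesis by (simp add: gderiv_def)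
qed

lemma GDERIV_unique: "GDERIV f x :> D \<Longrightarrow> GDERIV f x :> D' \<Longrightarrow> D = D'"
  unfolding gderiv_def using has_derivative_unique by (metis inner_commute vector_eq_rdot)

lemma GDERIV_diff_arg: "GDERIV f (x - y) :> D \<Longrightarrow> GDERIV (\<lambda>x. f (x - y)) x :> D"
  unfolding gderiv_def
  by (rule has_derivative_compose[where f = "\<lambda>x. x - y", simplified]) (auto intro!: derivative_eq_intros)

text \<open>The convolution of \<open>f\<close> with a bump is differentiated in two ways. With the
  derivative on the bump it is an integral of translated bump pairs, a limit of Riemann sums in the
  closure; with the derivative on \<open>f\<close> it is the mollification of \<open>F\<close>,
  hence close to \<open>F\<close>. Uniqueness of the gradient identifies the two.\<close>

lemma C1_compact_support_in_exp_closure: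
  fixes f :: "'a::euclidean_space \<Rightarrow> real"
  assumes K: "compact K" and der: "\<And>x. GDERIV f x :> F x" and F: "continuous_on UNIV F"
    and supp: "\<And>x. x \<notin> cbox a b \<Longrightarrow> f x = 0"
  shows "(f, F) \<in> C1_closure K (C1_span (ridge exp))"
proof (rule C1_closure_closure, rule C1_closureI)
  fix \<eta> :: real assume eta: "\<eta> > 0"
  have f: "continuous_on UNIV f"
    using der by (auto simp: continuous_on_eq_continuous_within gderiv_def intro: has_derivative_continuous)
  have suppF: "F x = 0" if "x \<notin> cbox a b" for x
  proof -
    have "GDERIV f x :> 0"
      unfolding gderiv_def
    proof (rule has_derivative_transform_within_open)
      show "((\<lambda>x. 0) has_derivative (\<lambda>h. h \<bullet> 0)) (at x)" by simp
      show "open (- cbox a b)" by (simp add: open_Compl closed_cbox)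
    qed (use that supp in auto)
    then show ?thesis using GDERIV_unique der by blast
  qed
  obtain \<delta>1 where d1: "\<delta>1 > 0" "\<And>\<epsilon> x. 0 < \<epsilon> \<Longrightarrow> \<epsilon> \<le> \<delta>1 \<Longrightarrow>
     norm ((1 / bump_mass TYPE('a) \<epsilon>) *\<^sub>R integral (cbox a b) (\<lambda>y. bump \<epsilon> (x - y) *\<^sub>R f y) - f x) \<le> \<eta>"
    using mollify[OF f supp eta] by blast
  obtain \<delta>2 where d2: "\<delta>2 > 0" "\<And>\<epsilon> x. 0 < \<epsilon> \<Longrightarrow> \<epsilon> \<le> \<delta>2 \<Longrightarrow>
     norm ((1 / bump_mass TYPE('a) \<epsilon>) *\<^sub>R integral (cbox a b) (\<lambda>y. bump \<epsilon> (x - y) *\<^sub>R F y) - F x) \<le> \<eta>"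
    using mollify[OF F suppF eta] by blast
  define \<epsilon> where "\<epsilon> = min \<delta>1 \<delta>2"
  have e: "\<epsilon> > 0" "\<epsilon> \<le> \<delta>1" "\<epsilon> \<le> \<delta>2" using d1 d2 by (auto simp: \<epsilon>_def)
  define c where "c = 1 / bump_mass TYPE('a) \<epsilon>"
  define g where "g = (\<lambda>x. integral (cbox a b) (\<lambda>y. f y * bump \<epsilon> (x - y)))"
  define G where "G = (\<lambda>x. integral (cbox a b) (\<lambda>y. f y *\<^sub>R bump' \<epsilon> (x - y)))"
  have cb: "continuous_on S (\<lambda>p. bump' \<epsilon> (fst p - snd p))" "continuous_on S (\<lambda>p. bump \<epsilon> (fst p - snd p))" for S :: "('a \<times> 'a) set"
    by (rule continuous_on_compose2[OF bump_C1(2)[of UNIV]] continuous_on_compose2[OF bump_C1(3)[of UNIV]];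
        auto intro!: continuous_intros)+
  have cb1: "continuous_on S (\<lambda>y. bump \<epsilon> (x - y))" for S and x :: 'a
    by (rule continuous_on_compose2[OF bump_C1(3)[of UNIV]]) (auto intro!: continuous_intros)
  have cf: "continuous_on S (\<lambda>p. f (fst p - snd p))" "continuous_on S (\<lambda>p. F (fst p - snd p))"
    "continuous_on S (\<lambda>p. f (snd p))" "continuous_on S (\<lambda>p. f (fst p))" for S :: "('a \<times> 'a) set"
    by (rule continuous_on_compose2[OF f] continuous_on_compose2[OF F]; auto intro!: continuous_intros)+
  have cb2: "continuous_on S (\<lambda>p. bump \<epsilon> (snd p))" for S :: "('a \<times> 'a) set"
    by (rule continuous_on_compose2[OF bump_C1(3)[of UNIV]]) (auto intro!: continuous_intros)
  have cf1: "continuous_on S (\<lambda>y. f (x - y))" for S x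
    by (rule continuous_on_compose2[OF f]) (auto intro!: continuous_intros)
  have G1: "GDERIV g x :> G x" for x
    unfolding g_def G_def
  proof (rule GDERIV_integral)
    show "GDERIV (\<lambda>x. f t * bump \<epsilon> (x - t)) x :> f t *\<^sub>R bump' \<epsilon> (x - t)" for x t
      by (rule GDERIV_subst[OF GDERIV_mult[OF GDERIV_const GDERIV_diff_arg[OF bump_C1(1)]]]) simp
  qed (auto simp: split_beta intro!: continuous_intros cb cf cb1 continuous_on_subset[OF f])
  have g1: "g x = integral (cbox a b) (\<lambda>y. bump \<epsilon> (x - y) *\<^sub>R f y)" for x
    by (simp add: g_def mult.commute)
  have g2: "g = (\<lambda>x. integral (cube \<epsilon>) (\<lambda>z. bump \<epsilon> z * f (x - z)))"
    using convolution_commute[where a = a and b = b, OF e(1) f supp] by (intro ext) (simp add: g1)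
  have "GDERIV g x :> integral (cube \<epsilon>) (\<lambda>z. bump \<epsilon> z *\<^sub>R F (x - z))" for x
    unfolding g2
  proof (rule GDERIV_integral)
    show "GDERIV (\<lambda>x. bump \<epsilon> t * f (x - t)) x :> bump \<epsilon> t *\<^sub>R F (x - t)" for x t
      by (rule GDERIV_subst[OF GDERIV_mult[OF GDERIV_const GDERIV_diff_arg[OF der]]]) simp
  qed (auto simp: split_beta intro!: continuous_intros cb2 cf cf1 bump_C1)
  then have G2: "G x = integral (cbox a b) (\<lambda>y. bump \<epsilon> (x - y) *\<^sub>R F y)" for x
    using convolution_commute[where a = a and b = b and x = x, OF e(1) F suppF] GDERIV_unique[OF G1] by simp
  have near: "\<bar>f x - c * g x\<bar> \<le> \<eta>" "norm (F x - c *\<^sub>R G x) \<le> \<eta>" for x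
  proof -
    have "norm (c *\<^sub>R g x - f x) \<le> \<eta>" using d1(2)[OF e(1,2), of x] by (simp only: c_def g1)
    then show "\<bar>f x - c * g x\<bar> \<le> \<eta>" by (simp only: real_norm_def real_scaleR_def abs_minus_commute[of "f x"])
    have "norm (c *\<^sub>R G x - F x) \<le> \<eta>" using d2(2)[OF e(1,3), of x] by (simp only: c_def G2)
    then show "norm (F x - c *\<^sub>R G x) \<le> \<eta>" by (simp only: norm_minus_commute[of "F x"])
  qed
  have "(g, G) \<in> C1_closure K (C1_closure K (C1_span (ridge exp)))"
  proof (rule C1_closureI)
    fix \<tau> :: real assume tau: "\<tau> > 0"
    \<comment> \<open>The Riemann sum is taken for bump and gradient as one pair, so both components
      share tags and weights.\<close>
    obtain I :: "('a \<times> 'a set) set" and m where I: "finite I"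
      "\<And>x. x \<in> K \<Longrightarrow> norm (integral (cbox a b) (\<lambda>y. f y *\<^sub>R (bump \<epsilon> (x - y), bump' \<epsilon> (x - y))) -
          (\<Sum>i\<in>I. m i *\<^sub>R (bump \<epsilon> (x - fst i), bump' \<epsilon> (x - fst i)))) \<le> \<tau>"
    proof (rule riemann_sum_uniform[OF K, where F = "\<lambda>y x. (bump \<epsilon> (x - y), bump' \<epsilon> (x - y))" and f = f and \<epsilon> = \<tau>
            and a = a and b = b])
      have "continuous_on S (\<lambda>p. bump' \<epsilon> (snd p - fst p))" "continuous_on S (\<lambda>p. bump \<epsilon> (snd p - fst p))" for S :: "('a \<times> 'a) set"
        by (rule continuous_on_compose2[OF bump_C1(2)[of UNIV]] continuous_on_compose2[OF bump_C1(3)[of UNIV]];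
          auto intro!: continuous_intros)+
      then show "continuous_on (cbox a b \<times> K) (\<lambda>(y, x). (bump \<epsilon> (x - y), bump' \<epsilon> (x - y)))"
        by (auto simp: split_beta intro!: continuous_intros)
    qed (use tau continuous_on_subset[OF f] in auto)
    let ?h = "\<lambda>x. \<Sum>i\<in>I. m i * bump \<epsilon> (x - fst i)" and ?H = "\<lambda>x. \<Sum>i\<in>I. m i *\<^sub>R bump' \<epsilon> (x - fst i)"
    have "(?h, ?H) \<in> C1_closure K (C1_span (ridge exp))"
      by (intro lin_closed_sum lin_closed_closure lin_closed_C1_span I(1) bump_in_exp_closure K)
    moreover have "\<bar>g x - ?h x\<bar> \<le> \<tau> \<and> norm (G x - ?H x) \<le> \<tau>" if x: "x \<in> K" for x
    proof -
      have cb3: "continuous_on (cbox a b) (\<lambda>y. bump' \<epsilon> (x - y))"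
        by (rule continuous_on_compose2[OF bump_C1(2)[of UNIV]]) (auto intro!: continuous_intros)
      have int: "(\<lambda>y. f y *\<^sub>R (bump \<epsilon> (x - y), bump' \<epsilon> (x - y))) integrable_on cbox a b"
        by (intro integrable_continuous continuous_intros cb1 cb3 continuous_on_subset[OF f]) auto
      have "integral (cbox a b) (\<lambda>y. f y *\<^sub>R (bump \<epsilon> (x - y), bump' \<epsilon> (x - y))) = (g x, G x)"
        using integral_linear[OF int bounded_linear_fst] integral_linear[OF int bounded_linear_snd]
        by (simp add: o_def g_def G_def prod_eq_iff)
      moreover have "(\<Sum>i\<in>I. m i *\<^sub>R (bump \<epsilon> (x - fst i), bump' \<epsilon> (x - fst i))) = (?h x, ?H x)"
        by (simp add: sum_prod)
      ultimately have "norm (g x - ?h x, G x - ?H x) \<le> \<tau>" using I(2)[OF x] by simp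
      then show ?thesis using norm_fst_le[of "g x - ?h x" "G x - ?H x"] norm_snd_le[of "G x - ?H x" "g x - ?h x"] by simp
    qed
    ultimately show "\<exists>h H. (h, H) \<in> C1_closure K (C1_span (ridge exp)) \<and>
        (\<forall>x\<in>K. \<bar>g x - h x\<bar> \<le> \<tau> \<and> norm (G x - H x) \<le> \<tau>)" by blast
  qed
  then have "(g, G) \<in> C1_closure K (C1_span (ridge exp))" by (rule C1_closure_closure)
  then have "(\<lambda>x. c * g x, \<lambda>x. c *\<^sub>R G x) \<in> C1_closure K (C1_span (ridge exp))"
    by (intro lin_closed_scale lin_closed_closure lin_closed_C1_span)
  then show "\<exists>h H. (h, H) \<in> C1_closure K (C1_span (ridge exp)) \<and>
        (\<forall>x\<in>K. \<bar>f x - h x\<bar> \<le> \<eta> \<and> norm (F x - H x) \<le> \<eta>)" using near by blast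
qed

section \<open>Networks and C1 calculus\<close>

text \<open>One hidden layer and no output bias: these networks are closed under sums, by placing
  hidden units side by side, and are already dense.\<close>

definition shallow_net :: "(real \<Rightarrow> real) \<Rightarrow> (real^'d \<Rightarrow> real^'d) \<Rightarrow> bool" where
  "shallow_net \<sigma> v \<longleftrightarrow> (\<exists>m (V :: 'd \<Rightarrow> nat \<Rightarrow> real) W b.
     v = (\<lambda>x. \<chi> j. \<Sum>i<m. V j i * \<sigma> (b i + (\<Sum>k\<in>UNIV. W i k * x $ k))))"

lemma shallow_net_imp_mlp: "shallow_net \<sigma> v \<Longrightarrow> mlp \<sigma> v"
proof -
  assume "shallow_net \<sigma> v"
  then obtain m and V :: "'a \<Rightarrow> nat \<Rightarrow> real" and W b where
    "v = (\<lambda>x. \<chi> j. \<Sum>i<m. V j i * \<sigma> (b i + (\<Sum>k\<in>UNIV. W i k * x $ k)))"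
    unfolding shallow_net_def by blast
  \<comment> \<open>The first hidden layer is built into \<open>mlp\<close>, hence the empty list of
    further layers.\<close>
  then show "mlp \<sigma> v"
    unfolding mlp_def
    by (intro exI[of _ W] exI[of _ b] exI[of _ "[]"] exI[of _ m] exI[of _ V] exI[of _ "\<lambda>_. 0"]) simp
qed

lemma shallow_net_add:
  fixes u v :: "real^'d \<Rightarrow> real^'d"
  assumes "shallow_net \<sigma> u" "shallow_net \<sigma> v"
  shows "shallow_net \<sigma> (\<lambda>x. u x + v x)"
proof -
  obtain m and V :: "'d \<Rightarrow> nat \<Rightarrow> real" and W b where u: "u = (\<lambda>x. \<chi> j. \<Sum>i<m. V j i * \<sigma> (b i + (\<Sum>k\<in>UNIV. W i k * x $ k)))"
    using assms(1) unfolding shallow_net_def by blast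
  obtain m' and V' :: "'d \<Rightarrow> nat \<Rightarrow> real" and W' b' where v: "v = (\<lambda>x. \<chi> j. \<Sum>i<m'. V' j i * \<sigma> (b' i + (\<Sum>k\<in>UNIV. W' i k * x $ k)))"
    using assms(2) unfolding shallow_net_def by blast
  have split: "(\<Sum>i<m + m'. (if i < m then f i else g (i - m))) = (\<Sum>i<m. f i) + (\<Sum>i<m'. g i)" for f g :: "nat \<Rightarrow> real"
  proof -
    have "(\<Sum>i<m + m'. (if i < m then f i else g (i - m))) = (\<Sum>i<m. (if i < m then f i else g (i - m))) +
        (\<Sum>i<m'. (if m + i < m then f (m + i) else g (m + i - m)))"
      by (induction m') simp_all
    then show ?thesis by simp
  qed
  have eq: "(\<Sum>i<m + m'. (if i < m then V j i else V' j (i - m)) * \<sigma> ((if i < m then b i else b' (i - m)) +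
      (\<Sum>k\<in>UNIV. (if i < m then W i else W' (i - m)) k * x $ k))) = u x $ j + v x $ j" for x j
    unfolding u v by (simp flip: split) (rule sum.cong; simp)
  show ?thesis
    unfolding shallow_net_def
    by (intro exI[of _ "m + m'"] exI[of _ "\<lambda>j i. if i < m then V j i else V' j (i - m)"]
        exI[of _ "\<lambda>i. if i < m then W i else W' (i - m)"] exI[of _ "\<lambda>i. if i < m then b i else b' (i - m)"])
      (simp only: eq, simp add: vec_eq_iff fun_eq_iff)
qed

lemma shallow_net_zero: "shallow_net \<sigma> (\<lambda>x. 0)"
  unfolding shallow_net_def by (intro exI[of _ 0]) (simp add: vec_eq_iff fun_eq_iff)

lemma shallow_net_unit: "shallow_net \<sigma> (\<lambda>x. \<sigma> (w \<bullet> x + b) *\<^sub>R a)"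
  unfolding shallow_net_def
  by (intro exI[of _ 1] exI[of _ "\<lambda>j i. a $ j"] exI[of _ "\<lambda>i k. w $ k"] exI[of _ "\<lambda>_. b"])
    (simp add: vec_eq_iff fun_eq_iff inner_vec_def add.commute mult.commute)

lemma shallow_net_sum:
  assumes "finite I" "\<And>i. i \<in> I \<Longrightarrow> shallow_net \<sigma> (f i)"
  shows "shallow_net \<sigma> (\<lambda>x. \<Sum>i\<in>I. f i x)"
  using assms by (induction I rule: finite_induct) (auto intro: shallow_net_zero shallow_net_add)

text \<open>The induction also establishes that the second component of a pair in the span really is
  the gradient of the first, which the type leaves open. The vector \<open>a\<close> lets
  vector-valued networks be assembled one output coordinate at a time.\<close>

lemma C1_span_ridge_shallow_net:
  assumes \<sigma>: "smooth_real_fun \<sigma>" and f: "(f, F) \<in> C1_span (ridge \<sigma>)"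
  shows "(\<forall>x. GDERIV f x :> F x) \<and> shallow_net \<sigma> (\<lambda>x. f x *\<^sub>R a)"
  using f
proof (induction f F arbitrary: a rule: C1_span.induct)
  case zero
  then show ?case by (simp add: GDERIV_const shallow_net_zero)
next
  case (step f F g G c)
  obtain w b where f: "f = (\<lambda>x. \<sigma> (w \<bullet> x + b))" "F = (\<lambda>x. deriv \<sigma> (w \<bullet> x + b) *\<^sub>R w)"
    using step.hyps(1) by (auto simp: ridge_def)
  have d: "(\<sigma> has_field_derivative deriv \<sigma> r) (at r)" for r
    using smooth_real_funD(1)[OF \<sigma>, of 0] by simp
  have "GDERIV f x :> F x" for x
    unfolding f by (rule GDERIV_DERIV_compose[OF _ d])
      (auto simp: gderiv_def inner_commute intro!: derivative_eq_intros)
  then have "GDERIV (\<lambda>x. c * f x + g x) x :> c *\<^sub>R F x + G x" for x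
    using GDERIV_add[OF GDERIV_mult[OF GDERIV_const[of c]]] step.IH by fastforce
  moreover have "shallow_net \<sigma> (\<lambda>x. f x *\<^sub>R (c *\<^sub>R a) + g x *\<^sub>R a)"
    unfolding f using step.IH by (intro shallow_net_add shallow_net_unit) blast
  ultimately show ?case by (simp add: algebra_simps)
qed

text \<open>Each output coordinate is approximated separately, first with exp and then with
  \<sigma>; the bounded support of \<open>v\<close> gives the mollification a box to integrate
  over.\<close>

lemma mlp_C1_dense:
  fixes v :: "real^'d \<Rightarrow> real^'d"
  assumes \<sigma>: "smooth_real_fun \<sigma>" "nonpoly \<sigma>" and K: "compact K"
    and v: "\<And>x. (v has_derivative v' x) (at x)" and v': "\<And>h. continuous_on UNIV (\<lambda>x. v' x h)"
    and supp: "\<And>x. x \<notin> cbox a b \<Longrightarrow> v x = 0" and e: "\<epsilon> > 0"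
  obtains w w' where "mlp \<sigma> w" "\<And>x. (w has_derivative w' x) (at x)"
    "\<And>x. x \<in> K \<Longrightarrow> norm (v x - w x) \<le> \<epsilon>"
    "\<And>x h. x \<in> K \<Longrightarrow> norm (v' x h - w' x h) \<le> \<epsilon> * norm h"
proof -
  \<comment> \<open>\<open>V j x\<close> is the gradient of the j-th coordinate, recovered from the
    derivative by evaluation on the basis.\<close>
  define V where "V = (\<lambda>j x. \<Sum>i\<in>(Basis :: (real^'d) set). (v' x i $ j) *\<^sub>R i)"
  \<comment> \<open>The Euclidean norm is at most the sum of the absolute coordinates, so each
    coordinate gets an equal share of the error.\<close>
  define \<delta> where "\<delta> = \<epsilon> / (real CARD('d))"
  have d: "\<delta> > 0" using e by (simp add: \<delta>_def)
  have lin: "linear (v' x)" for x using v has_derivative_linear by blast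
  have vh: "v' x h $ j = h \<bullet> V j x" for x h j
  proof -
    have "h \<bullet> V j x = (\<Sum>i\<in>Basis. (h \<bullet> i) * (v' x i $ j))"
      by (simp add: V_def inner_sum_right inner_commute mult.commute)
    also have "\<dots> = v' x (\<Sum>i\<in>Basis. (h \<bullet> i) *\<^sub>R i) $ j"
      by (simp add: linear_sum[OF lin] linear_cmul[OF lin] sum_component)
    finally show ?thesis by (simp add: euclidean_representation)
  qed
  have "\<exists>g G. (g, G) \<in> C1_span (ridge \<sigma>) \<and> (\<forall>x\<in>K. \<bar>v x $ j - g x\<bar> \<le> \<delta> \<and> norm (V j x - G x) \<le> \<delta>)" for j
  proof -
    have "((\<lambda>x. v x $ j), V j) \<in> C1_closure K (C1_span (ridge exp))"
    proof (rule C1_compact_support_in_exp_closure[OF K, where a = a and b = b])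
      show "GDERIV (\<lambda>x. v x $ j) x :> V j x" for x
        using bounded_linear.has_derivative[OF bounded_linear_vec_nth v, of j x]
        by (simp add: gderiv_def vh)
      show "continuous_on UNIV (V j)" unfolding V_def by (intro continuous_intros v')
    qed (use supp in auto)
    from exp_closure_subset[OF \<sigma> compact_imp_bounded[OF K] this] show ?thesis
      using C1_closureE[OF _ d] by metis
  qed
  then obtain g G where g: "\<And>j. (g j, G j) \<in> C1_span (ridge \<sigma>)"
    "\<And>j x. x \<in> K \<Longrightarrow> \<bar>v x $ j - g j x\<bar> \<le> \<delta>" "\<And>j x. x \<in> K \<Longrightarrow> norm (V j x - G j x) \<le> \<delta>"
    by metis
  define w where "w = (\<lambda>x. \<Sum>j\<in>UNIV. g j x *\<^sub>R (axis j 1 :: real^'d))"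
  define w' where "w' = (\<lambda>x h. \<Sum>j\<in>UNIV. (h \<bullet> G j x) *\<^sub>R (axis j 1 :: real^'d))"
  have wj: "w x $ j = g j x" "w' x h $ j = h \<bullet> G j x" for x h j
    by (simp_all add: w_def w'_def sum_component axis_def if_distrib[of "\<lambda>t. _ * t"] cong: if_cong)
  have nb: "norm z \<le> \<epsilon> * C" if "\<And>j. \<bar>z $ j\<bar> \<le> \<delta> * C" for z :: "real^'d" and C
  proof -
    have "norm z \<le> (\<Sum>j\<in>UNIV. \<bar>z $ j\<bar>)" by (rule norm_le_l1_cart)
    also have "\<dots> \<le> (\<Sum>j\<in>(UNIV::'d set). \<delta> * C)" using that by (intro sum_mono)
    finally show ?thesis by (simp add: \<delta>_def)
  qed
  show ?thesis
  proof (rule that[of w w'])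
    show "mlp \<sigma> w" unfolding w_def
      by (intro shallow_net_imp_mlp shallow_net_sum finite) (use C1_span_ridge_shallow_net[OF \<sigma>(1) g(1)] in blast)
    show "(w has_derivative w' x) (at x)" for x
      unfolding w_def w'_def
      using C1_span_ridge_shallow_net[OF \<sigma>(1) g(1)]
      by (intro has_derivative_sum has_derivative_scaleR_left) (simp add: gderiv_def)
    show "norm (v x - w x) \<le> \<epsilon>" if "x \<in> K" for x
      using nb[of "v x - w x" 1] g(2)[OF that] by (simp add: wj)
    show "norm (v' x h - w' x h) \<le> \<epsilon> * norm h" if "x \<in> K" for x h
    proof (rule nb)
      fix j
      have "\<bar>(v' x h - w' x h) $ j\<bar> = \<bar>h \<bullet> (V j x - G j x)\<bar>" by (simp add: wj vh inner_diff_right)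
      also have "\<dots> \<le> norm h * norm (V j x - G j x)" by (rule Cauchy_Schwarz_ineq2)
      also have "\<dots> \<le> norm h * \<delta>" using g(3)[OF that] by (intro mult_left_mono) auto
      finally show "\<bar>(v' x h - w' x h) $ j\<bar> \<le> \<delta> * norm h" by (simp add: mult.commute)
    qed
  qed
qed

text \<open>Continuity of the derivative is asked for each fixed direction. In finite dimension this
  is continuity in operator norm, and it fits the recursion in \<open>Ck_on\<close>.\<close>

definition C1on :: "'a::real_normed_vector set \<Rightarrow> ('a \<Rightarrow> 'b::real_normed_vector) \<Rightarrow> bool" where
  "C1on S f \<longleftrightarrow> (\<exists>f'. (\<forall>x\<in>S. (f has_derivative f' x) (at x)) \<and> (\<forall>h. continuous_on S (\<lambda>x. f' x h)))"

lemma C1onI: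
  "(\<And>x. x \<in> S \<Longrightarrow> (f has_derivative f' x) (at x)) \<Longrightarrow> (\<And>h. continuous_on S (\<lambda>x. f' x h)) \<Longrightarrow> C1on S f"
  unfolding C1on_def by (intro exI[of _ f']) simp

lemma C1onE:
  assumes "C1on S f"
  obtains f' where "\<And>x. x \<in> S \<Longrightarrow> (f has_derivative f' x) (at x)" "\<And>h. continuous_on S (\<lambda>x. f' x h)"
  using assms that unfolding C1on_def by auto

lemma C1on_frechet:
  assumes "C1on S f"
  shows "x \<in> S \<Longrightarrow> (f has_derivative frechet_derivative f (at x)) (at x)"
    "continuous_on S (\<lambda>x. frechet_derivative f (at x) h)"
proof -
  obtain f' where f': "\<And>x. x \<in> S \<Longrightarrow> (f has_derivative f' x) (at x)" "\<And>h. continuous_on S (\<lambda>x. f' x h)"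
    using C1onE[OF assms] by blast
  have eq: "frechet_derivative f (at x) = f' x" if "x \<in> S" for x
    using frechet_derivative_at[OF f'(1)[OF that]] by simp
  show "x \<in> S \<Longrightarrow> (f has_derivative frechet_derivative f (at x)) (at x)" using f'(1) eq by simp
  show "continuous_on S (\<lambda>x. frechet_derivative f (at x) h)"
    using f'(2)[of h] eq by (simp cong: continuous_on_cong)
qed

lemma C1on_imp_continuous_on: "C1on S f \<Longrightarrow> continuous_on S f"
  by (intro continuous_at_imp_continuous_on ballI has_derivative_continuous) (rule C1on_frechet(1))

lemma C1on_subset:
  assumes "C1on S f" "T \<subseteq> S"
  shows "C1on T f"
  using assms by (auto intro!: C1onI[OF C1on_frechet(1)[OF assms(1)]] continuous_on_subset[OF C1on_frechet(2)[OF assms(1)]])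

lemma C1on_cong:
  assumes "C1on S f" "open S" "\<And>x. x \<in> S \<Longrightarrow> f x = g x"
  shows "C1on S g"
proof -
  obtain f' where f': "\<And>x. x \<in> S \<Longrightarrow> (f has_derivative f' x) (at x)" "\<And>h. continuous_on S (\<lambda>x. f' x h)"
    using C1onE[OF assms(1)] by blast
  have "(g has_derivative f' x) (at x)" if "x \<in> S" for x
    using has_derivative_transform_within_open[OF f'(1)[OF that] assms(2) that] assms(3) by blast
  then show ?thesis using f'(2) by (rule C1onI)
qed

lemma C1on_const: "C1on S (\<lambda>x. c)"
  by (rule C1onI[where f' = "\<lambda>x h. 0"]) auto

lemma C1on_bounded_linear:
  assumes "bounded_linear f" "C1on S g"
  shows "C1on S (\<lambda>x. f (g x))"
proof -
  obtain g' where g': "\<And>x. x \<in> S \<Longrightarrow> (g has_derivative g' x) (at x)" "\<And>h. continuous_on S (\<lambda>x. g' x h)"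
    using C1onE[OF assms(2)] by blast
  show ?thesis
    by (rule C1onI[OF bounded_linear.has_derivative[OF assms(1) g'(1)] bounded_linear.continuous_on[OF assms(1) g'(2)]])
qed

lemma C1on_add:
  assumes "C1on S f" "C1on S g"
  shows "C1on S (\<lambda>x. f x + g x)"
proof -
  obtain f' where f': "\<And>x. x \<in> S \<Longrightarrow> (f has_derivative f' x) (at x)" "\<And>h. continuous_on S (\<lambda>x. f' x h)"
    using C1onE[OF assms(1)] by blast
  obtain g' where g': "\<And>x. x \<in> S \<Longrightarrow> (g has_derivative g' x) (at x)" "\<And>h. continuous_on S (\<lambda>x. g' x h)"
    using C1onE[OF assms(2)] by blast
  show ?thesis
    by (rule C1onI[OF has_derivative_add[OF f'(1) g'(1)] continuous_on_add[OF f'(2) g'(2)]])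
qed

lemma C1on_bilinear:
  assumes "bounded_bilinear p" and f: "C1on S f" and g: "C1on S g"
  shows "C1on S (\<lambda>x. p (f x) (g x))"
proof -
  interpret bounded_bilinear p by fact
  obtain f' where f': "\<And>x. x \<in> S \<Longrightarrow> (f has_derivative f' x) (at x)" "\<And>h. continuous_on S (\<lambda>x. f' x h)"
    using C1onE[OF f] by blast
  obtain g' where g': "\<And>x. x \<in> S \<Longrightarrow> (g has_derivative g' x) (at x)" "\<And>h. continuous_on S (\<lambda>x. g' x h)"
    using C1onE[OF g] by blast
  show ?thesis
  proof (rule C1onI[where f' = "\<lambda>x h. p (f x) (g' x h) + p (f' x h) (g x)"])
    show "((\<lambda>x. p (f x) (g x)) has_derivative (\<lambda>h. p (f x) (g' x h) + p (f' x h) (g x))) (at x)" if "x \<in> S" for x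
      using FDERIV[OF f'(1) g'(1)] that by blast
    show "continuous_on S (\<lambda>x. p (f x) (g' x h) + p (f' x h) (g x))" for h
      by (intro continuous_on_add continuous_on f' g' C1on_imp_continuous_on[OF f] C1on_imp_continuous_on[OF g])
  qed
qed

lemmas C1on_mult = C1on_bilinear[OF bounded_bilinear_mult]
lemmas C1on_scaleR = C1on_bilinear[OF bounded_bilinear_scaleR]
lemmas C1on_inner = C1on_bilinear[OF bounded_bilinear_inner]

lemma C1on_sum: "(\<And>i. i \<in> I \<Longrightarrow> C1on S (f i)) \<Longrightarrow> C1on S (\<lambda>x. \<Sum>i\<in>I. f i x)"
  by (induction I rule: infinite_finite_induct) (auto intro: C1on_const C1on_add)

lemma C1on_prod: 
  fixes f :: "'i \<Rightarrow> 'a::real_normed_vector \<Rightarrow> real"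
  shows "(\<And>i. i \<in> I \<Longrightarrow> C1on S (f i)) \<Longrightarrow> C1on S (\<lambda>x. \<Prod>i\<in>I. f i x)"
  by (induction I rule: infinite_finite_induct) (auto intro: C1on_const C1on_mult)

lemma C1on_compose:
  fixes g :: "'a::euclidean_space \<Rightarrow> 'b::euclidean_space"
  assumes f: "C1on T f" and g: "C1on S g" and sub: "g ` S \<subseteq> T"
  shows "C1on S (\<lambda>x. f (g x))"
proof -
  obtain f' where f': "\<And>x. x \<in> T \<Longrightarrow> (f has_derivative f' x) (at x)" "\<And>h. continuous_on T (\<lambda>x. f' x h)"
    using C1onE[OF f] by blast
  obtain g' where g': "\<And>x. x \<in> S \<Longrightarrow> (g has_derivative g' x) (at x)" "\<And>h. continuous_on S (\<lambda>x. g' x h)"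
    using C1onE[OF g] by blast
  show ?thesis
  proof (rule C1onI)
    show "((\<lambda>x. f (g x)) has_derivative (\<lambda>h. f' (g x) (g' x h))) (at x)" if "x \<in> S" for x
      using sub that by (intro has_derivative_compose[OF g'(1) f'(1)]) auto
    fix h
    \<comment> \<open>The direction \<open>g' x h\<close> moves with \<open>x\<close>, so continuity
      for fixed directions applies only after expanding it in the basis.\<close>
    have "f' (g x) (g' x h) = (\<Sum>i\<in>Basis. (g' x h \<bullet> i) *\<^sub>R f' (g x) i)" if "x \<in> S" for x
    proof -
      have lin: "linear (f' (g x))" using f'(1) sub that has_derivative_linear by blast
      have "f' (g x) (g' x h) = f' (g x) (\<Sum>i\<in>Basis. (g' x h \<bullet> i) *\<^sub>R i)" by (simp add: euclidean_representation)
      then show ?thesis by (simp add: linear_sum[OF lin] linear_cmul[OF lin])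
    qed
    moreover have "continuous_on S (\<lambda>x. \<Sum>i\<in>Basis. (g' x h \<bullet> i) *\<^sub>R f' (g x) i)"
      using sub by (intro continuous_intros g' continuous_on_compose2[OF f'(2)] C1on_imp_continuous_on[OF g])
    ultimately show "continuous_on S (\<lambda>x. f' (g x) (g' x h))" by (simp cong: continuous_on_cong)
  qed
qed

lemma C1on_real_compose:
  fixes g :: "'a::real_normed_vector \<Rightarrow> real"
  assumes g: "C1on S g" and sub: "g ` S \<subseteq> T"
    and f: "\<And>t. t \<in> T \<Longrightarrow> (f has_field_derivative f' t) (at t)" "continuous_on T f'"
  shows "C1on S (\<lambda>x. f (g x))"
proof -
  obtain g' where g': "\<And>x. x \<in> S \<Longrightarrow> (g has_derivative g' x) (at x)" "\<And>h. continuous_on S (\<lambda>x. g' x h)"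
    using C1onE[OF g] by blast
  show ?thesis
  proof (rule C1onI)
    show "((\<lambda>x. f (g x)) has_derivative (\<lambda>h. f' (g x) * g' x h)) (at x)" if "x \<in> S" for x
      using sub that f(1)[of "g x"]
      by (intro has_derivative_compose[OF g'(1), of x f "\<lambda>t. f' (g x) * t"]) (auto simp: has_field_derivative_def)
    show "continuous_on S (\<lambda>x. f' (g x) * g' x h)" for h
      using sub by (intro continuous_intros g' continuous_on_compose2[OF f(2)] C1on_imp_continuous_on[OF g])
  qed
qed

lemma C1on_inverse:
  fixes g :: "'a::real_normed_vector \<Rightarrow> real"
  assumes "C1on S g" "\<And>x. x \<in> S \<Longrightarrow> g x \<noteq> 0"
  shows "C1on S (\<lambda>x. inverse (g x))"
  by (rule C1on_real_compose[OF assms(1), where T = "- {0}" and f' = "\<lambda>t. - (inverse t * 1 * inverse t)"])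
    (use assms(2) in \<open>auto intro!: derivative_eq_intros continuous_intros\<close>)

lemma C1on_divide:
  fixes f g :: "'a::real_normed_vector \<Rightarrow> real"
  assumes "C1on S f" "C1on S g" "\<And>x. x \<in> S \<Longrightarrow> g x \<noteq> 0"
  shows "C1on S (\<lambda>x. f x / g x)"
  unfolding divide_inverse by (intro C1on_mult C1on_inverse assms)

lemma C1on_vec:
  fixes f :: "'a::real_normed_vector \<Rightarrow> real^'n"
  assumes "\<And>i. C1on S (\<lambda>x. f x $ i)"
  shows "C1on S f"
proof -
  have "f = (\<lambda>x. \<Sum>i\<in>UNIV. f x $ i *\<^sub>R axis i 1)"
    by (rule ext) (metis basis_expansion scalar_mult_eq_scaleR)
  moreover have "C1on S (\<lambda>x. \<Sum>i\<in>UNIV. f x $ i *\<^sub>R (axis i 1 :: real^'n))"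
    by (intro C1on_sum C1on_scaleR assms C1on_const)
  ultimately show ?thesis by simp
qed

section \<open>Determinants and Cramer's rule\<close>

lemma C1on_det:
  fixes A :: "'a::real_normed_vector \<Rightarrow> real^'n^'n"
  assumes "\<And>i j. C1on S (\<lambda>x. A x $ i $ j)"
  shows "C1on S (\<lambda>x. det (A x))"
  unfolding det_def by (intro C1on_sum C1on_mult C1on_const C1on_prod assms)

lemma continuous_on_det:
  fixes A :: "'a::topological_space \<Rightarrow> real^'n^'n"
  assumes "\<And>i j. continuous_on S (\<lambda>x. A x $ i $ j)"
  shows "continuous_on S (\<lambda>x. det (A x))"
  unfolding det_def by (intro continuous_intros assms)

text \<open>Every summand of the Leibniz formula has one factor per row, so the product rule
  differentiates one row at a time.\<close>

lemma has_derivative_det: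
  fixes A :: "'a::real_normed_vector \<Rightarrow> real^'n^'n"
  assumes "\<And>i j. ((\<lambda>x. A x $ i $ j) has_derivative A' i j) (at x)"
  shows "((\<lambda>x. det (A x)) has_derivative (\<lambda>h. \<Sum>k\<in>UNIV. det (\<chi> i j. if i = k then A' k j h else A x $ i $ j))) (at x)"
proof -
  have eq: "(\<Sum>p | p permutes UNIV. of_int (sign p) * (\<Sum>k\<in>UNIV. A' k (p k) h * (\<Prod>i\<in>UNIV - {k}. A x $ i $ p i))) =
      (\<Sum>k\<in>UNIV. det (\<chi> i j. if i = k then A' k j h else A x $ i $ j))" for h
  proof -
    have "(\<Prod>i\<in>UNIV. if i = k then A' k (p i) h else A x $ i $ p i) =
        A' k (p k) h * (\<Prod>i\<in>UNIV - {k}. A x $ i $ p i)" for k p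
      by (subst prod.remove[of _ k]) (auto intro!: prod.cong)
    then have "(\<Sum>k\<in>UNIV. det (\<chi> i j. if i = k then A' k j h else A x $ i $ j)) =
      (\<Sum>k\<in>UNIV. \<Sum>p | p permutes UNIV. of_int (sign p) * (A' k (p k) h * (\<Prod>i\<in>UNIV - {k}. A x $ i $ p i)))"
      unfolding det_def by simp
    also have "\<dots> = (\<Sum>p | p permutes UNIV. \<Sum>k\<in>UNIV. of_int (sign p) * (A' k (p k) h * (\<Prod>i\<in>UNIV - {k}. A x $ i $ p i)))"
      by (rule sum.swap)
    finally show ?thesis by (simp add: sum_distrib_left)
  qed
  have "((\<lambda>x. det (A x)) has_derivative (\<lambda>h. \<Sum>p | p permutes UNIV. of_int (sign p) *
      (\<Sum>k\<in>UNIV. A' k (p k) h * (\<Prod>i\<in>UNIV - {k}. A x $ i $ p i)))) (at x)"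
    unfolding det_def
    by (intro has_derivative_sum has_derivative_mult_right has_derivative_prod assms)
  then show ?thesis by (simp add: eq)
qed

text \<open>On the segment from the identity to \<open>A\<close> every matrix is positive definite,
  hence injective, so by the intermediate value theorem the determinant keeps the sign it has at the
  identity.\<close>

lemma det_pos_def_pos:
  fixes A :: "real^'n^'n"
  assumes "\<And>x. x \<noteq> 0 \<Longrightarrow> x \<bullet> (A *v x) > 0"
  shows "det A > 0"
proof (rule ccontr)
  assume "\<not> det A > 0"
  define B where "B = (\<lambda>t::real. (1 - t) *\<^sub>R (mat 1 :: real^'n^'n) + t *\<^sub>R A)"
  have cont: "continuous_on {0..1} (\<lambda>t. det (B t))"
    unfolding B_def by (intro continuous_on_det) (auto intro!: continuous_intros)
  have "\<exists>t\<ge>0. t \<le> 1 \<and> det (B t) = 0"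
    using IVT2'[of "\<lambda>t. det (B t)" 1 0 0, OF _ _ _ cont] \<open>\<not> det A > 0\<close> by (auto simp: B_def)
  then obtain t where t: "0 \<le> t" "t \<le> 1" "det (B t) = 0" by blast
  then obtain x where x: "x \<noteq> 0" "B t *v x = 0"
    using invertible_det_nz[of "B t"] matrix_left_invertible_ker invertible_left_inverse by metis
  have "x \<bullet> (B t *v x) = (1 - t) * (x \<bullet> x) + t * (x \<bullet> (A *v x))"
    by (simp add: B_def matrix_vector_mult_add_rdistrib scaleR_matrix_vector_assoc[symmetric] inner_add_right)
  moreover have "(1 - t) * (x \<bullet> x) + t * (x \<bullet> (A *v x)) > 0"
  proof (cases "t = 0")
    case False
    then show ?thesis using t assms[OF x(1)] by (intro add_nonneg_pos) auto
  qed (use x in auto)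
  ultimately show False using x(2) by simp
qed

text \<open>A rational expression in the entries, which makes C1 and continuous dependence on the
  matrix and the right-hand side immediate, without differentiating an inverse.\<close>

definition cramer_sol :: "real^'n^'n \<Rightarrow> real^'n \<Rightarrow> real^'n" where
  "cramer_sol A r = (\<chi> k. det (\<chi> i j. if j = k then r $ i else A $ i $ j) / det A)"

lemma cramer_sol:
  assumes "det A \<noteq> 0"
  shows "A *v cramer_sol A r = r" "A *v x = r \<Longrightarrow> x = cramer_sol A r"
  using cramer[OF assms] by (auto simp: cramer_sol_def)

lemma linear_cramer_sol:
  assumes "det A \<noteq> 0"
  shows "linear (cramer_sol A)"
proof (rule linearI)
  show "cramer_sol A (r + s) = cramer_sol A r + cramer_sol A s" for r s
    by (rule sym, rule cramer_sol(2)[OF assms]) (simp add: cramer_sol(1)[OF assms] matrix_vector_right_distrib)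
  show "cramer_sol A (c *\<^sub>R r) = c *\<^sub>R cramer_sol A r" for c r
    by (rule sym, rule cramer_sol(2)[OF assms]) (simp add: cramer_sol(1)[OF assms] matrix_vector_mult_scaleR)
qed

lemma C1on_cramer_sol:
  fixes A :: "'a::real_normed_vector \<Rightarrow> real^'n^'n"
  assumes "\<And>i j. C1on S (\<lambda>x. A x $ i $ j)" "\<And>i. C1on S (\<lambda>x. r x $ i)" "\<And>x. x \<in> S \<Longrightarrow> det (A x) \<noteq> 0"
  shows "C1on S (\<lambda>x. cramer_sol (A x) (r x))"
proof (rule C1on_vec)
  fix k
  have "C1on S (\<lambda>x. (\<chi> i j. if j = k then r x $ i else A x $ i $ j) $ i $ j)" for i j
    by (cases "j = k") (simp_all add: assms)
  then show "C1on S (\<lambda>x. cramer_sol (A x) (r x) $ k)"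
    unfolding cramer_sol_def by (simp add: C1on_divide C1on_det assms)
qed

lemma continuous_on_cramer_sol:
  fixes A :: "'a::topological_space \<Rightarrow> real^'n^'n"
  assumes "\<And>i j. continuous_on S (\<lambda>x. A x $ i $ j)" "\<And>i. continuous_on S (\<lambda>x. r x $ i)" "\<And>x. x \<in> S \<Longrightarrow> det (A x) \<noteq> 0"
  shows "continuous_on S (\<lambda>x. cramer_sol (A x) (r x))"
proof -
  have "continuous_on S (\<lambda>x. (\<chi> i j. if j = k then r x $ i else A x $ i $ j) $ i $ j)" for i j k
    by (cases "j = k") (simp_all add: assms)
  then have "continuous_on S (\<lambda>x. det (\<chi> i j. if j = k then r x $ i else A x $ i $ j))" for k
    by (rule continuous_on_det)
  moreover have "continuous_on S (\<lambda>x. det (A x))" by (intro continuous_on_det assms)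
  ultimately show ?thesis
    unfolding cramer_sol_def using assms(3) by (intro continuous_on_vec_lambda continuous_on_divide) auto
qed

text \<open>Transposition turns the replaced row into a replaced column, the numerator in Cramer's
  rule. This evaluates the terms in the derivative of a Gram determinant.\<close>

lemma det_replace_row_symmetric:
  fixes A :: "real^'n^'n"
  assumes "det A \<noteq> 0" "transpose A = A"
  shows "det (\<chi> i j. if i = k then r $ j else A $ i $ j) = det A * cramer_sol A r $ k"
proof -
  have "A $ i $ j = A $ j $ i" for i j using assms(2) by (metis transpose_def vec_lambda_beta)
  then have "transpose (\<chi> i j. if i = k then r $ j else A $ i $ j) = (\<chi> i j. if j = k then r $ i else A $ i $ j)"
    by (auto simp: transpose_def vec_eq_iff)
  then have "det (\<chi> i j. if i = k then r $ j else A $ i $ j) = det (\<chi> i j. if j = k then r $ i else A $ i $ j)"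
    by (rule subst) (rule det_transpose[symmetric])
  then show ?thesis using assms(1) by (simp add: cramer_sol_def)
qed

lemma cramer_sol_symmetric:
  fixes A :: "real^'n^'n"
  assumes "det A \<noteq> 0" "transpose A = A"
  shows "cramer_sol A r \<bullet> s = r \<bullet> cramer_sol A s"
proof -
  have "cramer_sol A r \<bullet> s = cramer_sol A r \<bullet> (A *v cramer_sol A s)" by (simp add: cramer_sol(1)[OF assms(1)])
  also have "\<dots> = (A *v cramer_sol A r) \<bullet> cramer_sol A s"
    using assms(2) by (metis dot_lmul_matrix transpose_matrix_vector)
  finally show ?thesis by (simp add: cramer_sol(1)[OF assms(1)])
qed

section \<open>Charts\<close>

text \<open>The mean value inequality for s |-> f(x + s h + t k) - f(x + s h) - s t A k, whose
  derivative is small by the first-order expansion of the directional derivative along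
  \<open>h\<close> at \<open>x\<close>.\<close>

lemma second_difference_estimate:
  fixes f :: "'a::real_normed_vector \<Rightarrow> 'b::real_normed_vector"
  assumes S: "open S" "x \<in> S" and f: "\<And>y. y \<in> S \<Longrightarrow> (f has_derivative f' y) (at y)"
    and A: "((\<lambda>y. f' y h) has_derivative A) (at x)" and e: "\<epsilon> > 0"
  shows "\<exists>\<delta>>0. \<forall>t. 0 < t \<and> t < \<delta> \<longrightarrow>
    norm (f (x + t *\<^sub>R h + t *\<^sub>R k) - f (x + t *\<^sub>R h) - f (x + t *\<^sub>R k) + f x - (t * t) *\<^sub>R A k) \<le> \<epsilon> * (t * t)"
proof -
  define C where "C = norm h + norm k + 1"
  have C: "C > 0" by (simp add: C_def add_nonneg_pos)
  \<comment> \<open>Two first-order expansions enter, each at distance at most \<open>t * C\<close>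
    from \<open>x\<close>, hence the 2.\<close>
  define \<eta> where "\<eta> = \<epsilon> / (2 * C)"
  have eta: "\<eta> > 0" using e C by (simp add: \<eta>_def)
  obtain r where r: "r > 0" "ball x r \<subseteq> S" using S open_contains_ball by blast
  obtain d where d: "d > 0" "\<And>y. norm (y - x) < d \<Longrightarrow> norm (f' y h - f' x h - A (y - x)) \<le> \<eta> * norm (y - x)"
    using A eta unfolding has_derivative_at_alt by blast
  have linA: "linear A" using A has_derivative_linear by blast
  define \<delta> where "\<delta> = min r d / C"
  show ?thesis
  proof (intro exI[of _ \<delta>] conjI allI impI)
    show "\<delta> > 0" using r d C by (simp add: \<delta>_def)
    fix t assume t: "0 < t \<and> t < \<delta>"
    then have tC: "t * C < min r d" using C by (simp add: \<delta>_def pos_less_divide_eq)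
    have nb: "norm (s *\<^sub>R h + u *\<^sub>R k) \<le> t * C" if "0 \<le> s" "s \<le> t" "0 \<le> u" "u \<le> t" for s u
    proof -
      have "norm (s *\<^sub>R h + u *\<^sub>R k) \<le> s * norm h + u * norm k"
        using norm_triangle_ineq[of "s *\<^sub>R h" "u *\<^sub>R k"] that by simp
      also have "\<dots> \<le> t * norm h + t * norm k" using that by (intro add_mono mult_right_mono) auto
      also have "\<dots> \<le> t * C" using t by (simp add: C_def algebra_simps)
      finally show ?thesis .
    qed
    define g where "g = (\<lambda>s. f (x + s *\<^sub>R h + t *\<^sub>R k) - f (x + s *\<^sub>R h) - (s * t) *\<^sub>R A k)"
    have "norm (g t - g 0) \<le> (\<epsilon> * t) * norm (t - 0)"
    proof (rule differentiable_bound[where S = "{0..t}" and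
          f' = "\<lambda>s u. f' (x + s *\<^sub>R h + t *\<^sub>R k) (u *\<^sub>R h) - f' (x + s *\<^sub>R h) (u *\<^sub>R h) - (u * t) *\<^sub>R A k"])
      fix s assume s: "s \<in> {0..t}"
      let ?y = "x + s *\<^sub>R h + t *\<^sub>R k" and ?z = "x + s *\<^sub>R h"
      have ny: "norm (?y - x) \<le> t * C" using nb[of s t] s by (simp add: add.assoc)
      have nz: "norm (?z - x) \<le> t * C" using nb[of s 0] s by simp
      have yS: "?y \<in> S" "?z \<in> S" using ny nz tC r(2) by (auto simp: subset_iff dist_norm norm_minus_commute)
      have D1: "((\<lambda>s. x + s *\<^sub>R h + t *\<^sub>R k) has_derivative (\<lambda>u. u *\<^sub>R h)) (at s within {0..t})"
        "((\<lambda>s. x + s *\<^sub>R h) has_derivative (\<lambda>u. u *\<^sub>R h)) (at s within {0..t})"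
        "((\<lambda>s. (s * t) *\<^sub>R A k) has_derivative (\<lambda>u. (u * t) *\<^sub>R A k)) (at s within {0..t})"
        by (auto intro!: derivative_eq_intros)
      show "(g has_derivative (\<lambda>u. f' ?y (u *\<^sub>R h) - f' ?z (u *\<^sub>R h) - (u * t) *\<^sub>R A k)) (at s within {0..t})"
        unfolding g_def
        by (intro has_derivative_diff D1(3) has_derivative_compose[OF D1(1) f[OF yS(1)]]
            has_derivative_compose[OF D1(2) f[OF yS(2)]])
      have lin: "linear (f' ?y)" "linear (f' ?z)" using f yS has_derivative_linear by blast+
      have "norm (f' ?y h - f' ?z h - t *\<^sub>R A k) \<le> \<epsilon> * t"
      proof -
        have "A (?y - x) - A (?z - x) = t *\<^sub>R A k"
          by (simp add: linear_cmul[OF linA] linear_add[OF linA])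
        then have "f' ?y h - f' ?z h - t *\<^sub>R A k =
            (f' ?y h - f' x h - A (?y - x)) - (f' ?z h - f' x h - A (?z - x))" by (simp add: algebra_simps)
        also have "norm \<dots> \<le> \<eta> * norm (?y - x) + \<eta> * norm (?z - x)"
          using d(2)[of ?y] d(2)[of ?z] ny nz tC
            norm_triangle_ineq4[of "f' ?y h - f' x h - A (?y - x)" "f' ?z h - f' x h - A (?z - x)"] by linarith
        also have "\<dots> \<le> \<eta> * (t * C) + \<eta> * (t * C)" using ny nz eta by (intro add_mono mult_left_mono) auto
        also have "\<dots> = \<epsilon> * t" using C by (simp add: \<eta>_def field_simps)
        finally show ?thesis .
      qed
      then show "onorm (\<lambda>u. f' ?y (u *\<^sub>R h) - f' ?z (u *\<^sub>R h) - (u * t) *\<^sub>R A k) \<le> \<epsilon> * t"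
      proof (intro onorm_bound)
        fix u :: real
        assume *: "norm (f' ?y h - f' ?z h - t *\<^sub>R A k) \<le> \<epsilon> * t"
        have "f' ?y (u *\<^sub>R h) - f' ?z (u *\<^sub>R h) - (u * t) *\<^sub>R A k = u *\<^sub>R (f' ?y h - f' ?z h - t *\<^sub>R A k)"
          by (simp only: linear_cmul[OF lin(1)] linear_cmul[OF lin(2)] scaleR_diff_right scaleR_scaleR)
        then show "norm (f' ?y (u *\<^sub>R h) - f' ?z (u *\<^sub>R h) - (u * t) *\<^sub>R A k) \<le> (\<epsilon> * t) * norm u"
          using mult_left_mono[OF *, of "\<bar>u\<bar>"] by (simp add: mult.commute)
      qed (use e t in auto)
    qed (use t in auto)
    moreover have "g t - g 0 = f (x + t *\<^sub>R h + t *\<^sub>R k) - f (x + t *\<^sub>R h) - f (x + t *\<^sub>R k) + f x - (t * t) *\<^sub>R A k"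
      by (simp add: g_def algebra_simps)
    ultimately show "norm (f (x + t *\<^sub>R h + t *\<^sub>R k) - f (x + t *\<^sub>R h) - f (x + t *\<^sub>R k) + f x - (t * t) *\<^sub>R A k) \<le> \<epsilon> * (t * t)"
      using t by (simp add: mult.assoc)
  qed
qed

text \<open>The second difference is symmetric in \<open>h\<close> and \<open>k\<close>, and divided
  by \<open>t * t\<close> it tends both to \<open>A k\<close> and to \<open>B h\<close>.\<close>

lemma second_derivative_symmetric:
  fixes f :: "'a::real_normed_vector \<Rightarrow> 'b::real_normed_vector"
  assumes S: "open S" "x \<in> S" and f: "\<And>y. y \<in> S \<Longrightarrow> (f has_derivative f' y) (at y)"
    and A: "((\<lambda>y. f' y h) has_derivative A) (at x)" and B: "((\<lambda>y. f' y k) has_derivative B) (at x)"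
  shows "A k = B h"
proof (rule ccontr)
  assume "A k \<noteq> B h"
  \<comment> \<open>A third of the distance, so two errors of size \<open>\<epsilon>\<close> cannot
    bridge it.\<close>
  define \<epsilon> where "\<epsilon> = norm (A k - B h) / 3"
  have e: "\<epsilon> > 0" using \<open>A k \<noteq> B h\<close> by (simp add: \<epsilon>_def)
  obtain d1 where d1: "d1 > 0" "\<And>t. 0 < t \<Longrightarrow> t < d1 \<Longrightarrow>
      norm (f (x + t *\<^sub>R h + t *\<^sub>R k) - f (x + t *\<^sub>R h) - f (x + t *\<^sub>R k) + f x - (t * t) *\<^sub>R A k) \<le> \<epsilon> * (t * t)"
    using second_difference_estimate[OF S f A e] by blast
  obtain d2 where d2: "d2 > 0" "\<And>t. 0 < t \<Longrightarrow> t < d2 \<Longrightarrow>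
      norm (f (x + t *\<^sub>R k + t *\<^sub>R h) - f (x + t *\<^sub>R k) - f (x + t *\<^sub>R h) + f x - (t * t) *\<^sub>R B h) \<le> \<epsilon> * (t * t)"
    using second_difference_estimate[OF S f B e] by blast
  define t where "t = min d1 d2 / 2"
  have t: "0 < t" "t < d1" "t < d2" using d1(1) d2(1) by (auto simp: t_def)
  let ?a = "f (x + t *\<^sub>R h + t *\<^sub>R k) - f (x + t *\<^sub>R h) - f (x + t *\<^sub>R k) + f x"
  have "f (x + t *\<^sub>R k + t *\<^sub>R h) - f (x + t *\<^sub>R k) - f (x + t *\<^sub>R h) + f x = ?a"
    by (simp add: algebra_simps)
  then have n2: "norm (?a - (t * t) *\<^sub>R B h) \<le> \<epsilon> * (t * t)" using d2(2)[OF t(1,3)] by (simp only:)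
  have "(t * t) * norm (A k - B h) = norm ((?a - (t * t) *\<^sub>R B h) - (?a - (t * t) *\<^sub>R A k))"
    using t by (simp flip: scaleR_diff_right)
  also have "\<dots> \<le> \<epsilon> * (t * t) + \<epsilon> * (t * t)"
    using n2 d1(2)[OF t(1,2)] norm_triangle_ineq4[of "?a - (t * t) *\<^sub>R B h" "?a - (t * t) *\<^sub>R A k"] by linarith
  finally have "(t * t) * norm (A k - B h) \<le> (t * t) * (2 * \<epsilon>)" by (simp add: algebra_simps)
  then have "norm (A k - B h) \<le> 2 * \<epsilon>" using t(1) by simp
  then show False using e by (simp add: \<epsilon>_def)
qed

lemma C1on_Lipschitz:
  fixes f :: "'a::euclidean_space \<Rightarrow> 'b::real_normed_vector"
  assumes f: "C1on S f" and sub: "cball x r \<subseteq> S"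
  obtains C where "C \<ge> 0" "\<And>y z. y \<in> cball x r \<Longrightarrow> z \<in> cball x r \<Longrightarrow> norm (f y - f z) \<le> C * norm (y - z)"
proof -
  obtain f' where f': "\<And>x. x \<in> S \<Longrightarrow> (f has_derivative f' x) (at x)" "\<And>h. continuous_on S (\<lambda>x. f' x h)"
    using C1onE[OF f] by blast
  have "\<exists>C. \<forall>y\<in>cball x r. norm (f' y i) \<le> C" for i
    using compact_imp_bounded[OF compact_continuous_image[OF continuous_on_subset[OF f'(2)[of i] sub] compact_cball]]
    unfolding bounded_iff by auto
  then obtain C where C: "\<And>i y. y \<in> cball x r \<Longrightarrow> norm (f' y i) \<le> C i" by metis
  define B where "B = (\<Sum>i\<in>Basis. \<bar>C i\<bar>)"
  have B0: "B \<ge> 0" by (simp add: B_def sum_nonneg)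
  have on: "onorm (f' y) \<le> B" if y: "y \<in> cball x r" for y
  proof (rule onorm_bound[OF B0])
    fix h
    have lin: "linear (f' y)" using f'(1) sub y has_derivative_linear by blast
    have "f' y h = f' y (\<Sum>i\<in>Basis. (h \<bullet> i) *\<^sub>R i)" by (simp add: euclidean_representation)
    also have "\<dots> = (\<Sum>i\<in>Basis. (h \<bullet> i) *\<^sub>R f' y i)" by (simp add: linear_sum[OF lin] linear_cmul[OF lin])
    also have "norm \<dots> \<le> (\<Sum>i\<in>Basis. norm h * \<bar>C i\<bar>)"
    proof (rule sum_norm_le)
      fix i :: 'a assume "i \<in> Basis"
      then have "\<bar>h \<bullet> i\<bar> * norm (f' y i) \<le> norm h * \<bar>C i\<bar>"
        using C[OF y, of i] by (intro mult_mono Basis_le_norm) auto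
      then show "norm ((h \<bullet> i) *\<^sub>R f' y i) \<le> norm h * \<bar>C i\<bar>" by simp
    qed
    finally show "norm (f' y h) \<le> B * norm h" by (simp add: B_def mult.commute flip: sum_distrib_left)
  qed
  have "norm (f y - f z) \<le> B * norm (y - z)" if "y \<in> cball x r" "z \<in> cball x r" for y z
    by (rule differentiable_bound[OF convex_cball _ on that]) (use f'(1) sub has_derivative_at_withinI in blast)
  then show ?thesis using that B0 by blast
qed

lemma has_derivative_quadratic:
  fixes f :: "'a::real_normed_vector \<Rightarrow> 'b::real_normed_vector"
  assumes "bounded_linear f'" "\<rho> > 0" "C \<ge> 0"
    "\<And>y. norm (y - x) < \<rho> \<Longrightarrow> norm (f y - f x - f' (y - x)) \<le> C * (norm (y - x))\<^sup>2"
  shows "(f has_derivative f') (at x)"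
  unfolding has_derivative_at_alt
proof (intro conjI allI impI assms(1))
  fix e :: real assume e: "e > 0"
  show "\<exists>d>0. \<forall>y. norm (y - x) < d \<longrightarrow> norm (f y - f x - f' (y - x)) \<le> e * norm (y - x)"
  proof (intro exI[of _ "min \<rho> (e / (C + 1))"] conjI allI impI)
    show "min \<rho> (e / (C + 1)) > 0" using assms e by (simp add: add_nonneg_pos)
    fix y assume y: "norm (y - x) < min \<rho> (e / (C + 1))"
    have "C * norm (y - x) \<le> (C + 1) * norm (y - x)" by (simp add: mult_right_mono)
    also have "\<dots> \<le> e" using y assms(3) by (simp add: pos_less_divide_eq add_nonneg_pos mult.commute less_imp_le)
    finally have "C * norm (y - x) * norm (y - x) \<le> e * norm (y - x)" by (intro mult_right_mono) auto
    then show "norm (f y - f x - f' (y - x)) \<le> e * norm (y - x)"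
      using assms(4)[of y] y by (simp add: power2_eq_square mult.assoc)
  qed
qed

lemma Ck_on_subset: "Ck_on k S f \<Longrightarrow> T \<subseteq> S \<Longrightarrow> Ck_on k T f"
proof (induction k arbitrary: f)
  case 0
  then show ?case by (auto intro: continuous_on_subset)
next
  case (Suc k)
  then show ?case by auto
qed

text \<open>The inverse \<kappa> lives on an open set \<open>W\<close> of the ambient space rather
  than on M alone. It is then C1 in the ordinary sense, functions of the coordinates extend to
  ambient fields by composition with \<kappa>, and transition maps are differentiable by the chain
  rule.\<close>

locale chart =
  fixes M :: "(real^'d) set" and \<phi> :: "real^'n \<Rightarrow> real^'d" and \<kappa> :: "real^'d \<Rightarrow> real^'n"
    and V :: "(real^'n) set" and W :: "(real^'d) set"
  assumes openV: "open V" and openW: "open W" and image: "\<phi> ` V = M \<inter> W" and \<kappa>_image: "\<kappa> ` W \<subseteq> V"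
    and \<kappa>_\<phi>: "s \<in> V \<Longrightarrow> \<kappa> (\<phi> s) = s" and smooth: "smooth_on V \<phi>" and C1_\<kappa>: "C1on W \<kappa>"
    and inj_deriv: "s \<in> V \<Longrightarrow> inj (frechet_derivative \<phi> (at s))"
begin

abbreviation D where "D s \<equiv> frechet_derivative \<phi> (at s)"

definition b where "b k s = D s (axis k 1)"

text \<open>The first fundamental form of the chart, which makes \<open>J\<close> the Riemannian
  volume density.\<close>

definition G :: "real^'n \<Rightarrow> real^'n^'n" where "G s = (\<chi> i j. b i s \<bullet> b j s)"

definition J where "J s = sqrt (det (G s))"

text \<open>The normal equations: their solution gives the coefficients, in the frame
  \<open>b\<close>, of the orthogonal projection of \<open>v\<close> onto the tangent space.\<close>

definition coords :: "real^'n \<Rightarrow> real^'d \<Rightarrow> real^'n" where "coords s v = cramer_sol (G s) (\<chi> i. b i s \<bullet> v)"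

definition P where "P s v = D s (coords s v)"

lemma C1_D: "C1on V (\<lambda>s. D s h)"
proof -
  have "Ck_on (Suc (Suc 0)) V \<phi>" using smooth by (auto simp: smooth_on_def)
  then show ?thesis
    by (intro C1onI[where f' = "\<lambda>x. frechet_derivative (\<lambda>s. D s h) (at x)"])
      (auto simp: frechet_derivative_works)
qed

lemma deriv_\<phi>: "s \<in> V \<Longrightarrow> (\<phi> has_derivative D s) (at s)"
  using smooth by (auto simp: smooth_on_def frechet_derivative_works dest: spec[of _ "Suc 0"])

lemma C1_\<phi>: "C1on V \<phi>"
  by (rule C1onI[OF deriv_\<phi> C1on_imp_continuous_on[OF C1_D]])

lemma linear_D: "s \<in> V \<Longrightarrow> linear (D s)"
  using deriv_\<phi> has_derivative_linear by blast

lemma D_eq: "s \<in> V \<Longrightarrow> D s x = (\<Sum>k\<in>UNIV. x $ k *\<^sub>R b k s)"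
  unfolding b_def by (subst basis_expansion[symmetric, of x])
    (simp add: linear_sum[OF linear_D] linear_cmul[OF linear_D] scalar_mult_eq_scaleR)

lemma C1_b: "C1on V (b k)"
  unfolding b_def[abs_def] by (rule C1_D)

lemma G_mult: "s \<in> V \<Longrightarrow> G s *v x = (\<chi> i. b i s \<bullet> D s x)"
  by (simp add: G_def matrix_vector_mult_def D_eq inner_sum_right vec_eq_iff mult.commute)

lemma transpose_G: "transpose (G s) = G s"
  by (simp add: G_def transpose_def vec_eq_iff inner_commute)

lemma det_G_pos: "s \<in> V \<Longrightarrow> det (G s) > 0"
proof (rule det_pos_def_pos)
  fix x :: "real^'n" assume s: "s \<in> V" and x: "x \<noteq> 0"
  have "x \<bullet> (G s *v x) = D s x \<bullet> D s x"
  proof -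
    have "D s x \<bullet> D s x = (\<Sum>k\<in>UNIV. x $ k *\<^sub>R b k s) \<bullet> D s x" by (simp only: D_eq[OF s])
    also have "\<dots> = (\<Sum>k\<in>UNIV. x $ k * (b k s \<bullet> D s x))" by (simp add: inner_sum_left)
    finally show ?thesis by (simp add: G_mult[OF s] inner_vec_def[of x])
  qed
  moreover have "D s x \<noteq> 0"
    using inj_deriv[OF s] x linear_0[OF linear_D[OF s]] by (metis injD)
  ultimately show "x \<bullet> (G s *v x) > 0" by simp
qed

lemma det_G_nz: "s \<in> V \<Longrightarrow> det (G s) \<noteq> 0"
  using det_G_pos by fastforce

lemma J_pos: "s \<in> V \<Longrightarrow> J s > 0"
  by (simp add: J_def det_G_pos)

lemma C1_G: "C1on V (\<lambda>s. G s $ i $ j)"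
  by (simp add: G_def C1on_inner C1_b)

lemma C1_J: "C1on V J"
  unfolding J_def[abs_def]
proof (rule C1on_real_compose[OF C1on_det[OF C1_G], where T = "{0<..}"])
  show "(sqrt has_real_derivative inverse (sqrt t) / 2) (at t)" if "t \<in> {0<..}" for t
    using that by (auto intro: DERIV_real_sqrt)
  show "continuous_on {0<..} (\<lambda>t. inverse (sqrt t) / 2)"
    by (intro continuous_intros) auto
qed (use det_G_pos in auto)

lemma coords_D: "s \<in> V \<Longrightarrow> coords s (D s x) = x"
  unfolding coords_def using cramer_sol(2)[OF det_G_nz] G_mult by metis

lemma linear_coords: "s \<in> V \<Longrightarrow> linear (coords s)"
proof -
  assume s: "s \<in> V"
  have "linear (\<lambda>v. \<chi> i. b i s \<bullet> v)"
    by (rule linearI) (simp_all add: vec_eq_iff inner_add_right)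
  from linear_compose[OF this linear_cramer_sol[OF det_G_nz[OF s]]] show ?thesis
    by (simp add: o_def coords_def[abs_def])
qed

lemma linear_P: "s \<in> V \<Longrightarrow> linear (P s)"
  using linear_compose[OF linear_coords linear_D] by (simp add: o_def P_def[abs_def])

lemma P_normal: "s \<in> V \<Longrightarrow> D s h \<bullet> (v - P s v) = 0"
proof -
  assume s: "s \<in> V"
  have "G s *v coords s v = (\<chi> i. b i s \<bullet> v)" unfolding coords_def by (rule cramer_sol(1)[OF det_G_nz[OF s]])
  then have "b i s \<bullet> P s v = b i s \<bullet> v" for i
    by (simp add: G_mult[OF s] P_def vec_eq_iff)
  then show ?thesis by (simp add: D_eq[OF s] inner_sum_left inner_diff_right)
qed

lemma P_D: "s \<in> V \<Longrightarrow> P s (D s h) = D s h"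
  by (simp add: P_def coords_D)

lemma P_eq_0: "s \<in> V \<Longrightarrow> (\<And>h. v \<bullet> D s h = 0) \<Longrightarrow> P s v = 0"
proof -
  assume s: "s \<in> V" and v: "\<And>h. v \<bullet> D s h = 0"
  have "(\<chi> i. b i s \<bullet> v) = 0" using v by (simp add: b_def vec_eq_iff inner_commute)
  then have "coords s v = 0" using linear_0[OF linear_cramer_sol[OF det_G_nz[OF s]]] by (simp add: coords_def)
  then show ?thesis using linear_0[OF linear_D[OF s]] by (simp add: P_def)
qed

lemma norm_P_le: "s \<in> V \<Longrightarrow> norm (P s v) \<le> norm v"
proof -
  assume s: "s \<in> V"
  have "P s v \<bullet> (v - P s v) = 0" using P_normal[OF s, of "coords s v" v] by (simp add: P_def)
  then have "P s v \<bullet> P s v = P s v \<bullet> v" by (simp add: inner_diff_right)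
  also have "\<dots> \<le> norm (P s v) * norm v" by (rule norm_cauchy_schwarz)
  finally have "norm (P s v) * norm (P s v) \<le> norm (P s v) * norm v"
    by (simp add: dot_square_norm power2_eq_square)
  then show ?thesis by (cases "P s v = 0") auto
qed

lemma C1_coords: "C1on V v \<Longrightarrow> C1on V (\<lambda>s. coords s (v s))"
  unfolding coords_def by (intro C1on_cramer_sol C1_G det_G_nz) (simp_all add: C1on_inner C1_b)

lemma C1_P: "C1on V v \<Longrightarrow> C1on V (\<lambda>s. P s (v s))"
proof -
  assume v: "C1on V v"
  have "C1on V (\<lambda>s. \<Sum>k\<in>UNIV. coords s (v s) $ k *\<^sub>R b k s)"
    by (intro C1on_sum C1on_scaleR C1_b C1on_bounded_linear[OF bounded_linear_vec_nth] C1_coords v)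
  then show ?thesis by (rule C1on_cong[OF _ openV]) (simp add: P_def D_eq)
qed

lemma \<phi>_in: "s \<in> V \<Longrightarrow> \<phi> s \<in> M" "s \<in> V \<Longrightarrow> \<phi> s \<in> W"
  using image by auto

lemma \<kappa>_in: "x \<in> W \<Longrightarrow> \<kappa> x \<in> V"
  using \<kappa>_image by auto

lemma \<phi>_\<kappa>: "x \<in> M \<Longrightarrow> x \<in> W \<Longrightarrow> \<phi> (\<kappa> x) = x"
  using image \<kappa>_\<phi> by (metis IntI imageE)

lemma local_param_chart: "local_param M V \<phi>"
  unfolding local_param_def
proof (intro conjI openV smooth ballI inj_deriv)
  have "homeomorphism V (\<phi> ` V) \<phi> \<kappa>"
  proof (rule homeomorphismI)
    show "continuous_on (\<phi> ` V) \<kappa>"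
      using C1on_imp_continuous_on[OF C1_\<kappa>] by (rule continuous_on_subset) (use image in auto)
  qed (use C1on_imp_continuous_on[OF C1_\<phi>] \<kappa>_\<phi> in auto)
  then show "\<exists>\<psi>. homeomorphism V (\<phi> ` V) \<phi> \<psi>" by blast
  show "\<exists>W. open W \<and> \<phi> ` V = M \<inter> W" using openW image by blast
qed

text \<open>Near \<open>u\<close> one has
  \<open>\<psi> = \<phi> \<circ> \<kappa> \<circ> \<psi>\<close>, and \<kappa> is differentiable on
  an open set of the ambient space, so the factorisation of the derivative is the chain
  rule.\<close>

lemma transition:
  fixes \<psi> :: "real^'m \<Rightarrow> real^'d"
  assumes \<psi>: "local_param M U \<psi>" and u: "u \<in> U" and W: "\<psi> u \<in> W"
  shows "\<exists>A. ((\<lambda>w. \<kappa> (\<psi> w)) has_derivative A) (at u) \<and>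
     frechet_derivative \<psi> (at u) = D (\<kappa> (\<psi> u)) \<circ> A"
proof -
  have "Ck_on (Suc 0) U \<psi>" and U: "open U" using \<psi> by (auto simp: local_param_def smooth_on_def)
  then have d\<psi>: "(\<psi> has_derivative frechet_derivative \<psi> (at u)) (at u)" and c\<psi>: "continuous_on U \<psi>"
    using u by (auto simp: frechet_derivative_works intro!: continuous_at_imp_continuous_on differentiable_imp_continuous_within)
  have \<psi>M: "\<psi> w \<in> M" if "w \<in> U" for w using \<psi> that by (auto simp: local_param_def)
  let ?A = "\<lambda>h. frechet_derivative \<kappa> (at (\<psi> u)) (frechet_derivative \<psi> (at u) h)"
  have A: "((\<lambda>w. \<kappa> (\<psi> w)) has_derivative ?A) (at u)"
    by (rule has_derivative_compose[OF d\<psi> C1on_frechet(1)[OF C1_\<kappa> W]])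
  have "((\<lambda>w. \<phi> (\<kappa> (\<psi> w))) has_derivative (\<lambda>h. D (\<kappa> (\<psi> u)) (?A h))) (at u)"
    by (rule has_derivative_compose[OF A deriv_\<phi>[OF \<kappa>_in[OF W]]])
  moreover have "open (U \<inter> \<psi> -` W)" using c\<psi> U openW by (simp add: continuous_on_open_vimage Int_commute)
  ultimately have "(\<psi> has_derivative (\<lambda>h. D (\<kappa> (\<psi> u)) (?A h))) (at u)"
    by (rule has_derivative_transform_within_open) (use u W \<psi>M \<phi>_\<kappa> in auto)
  then have "frechet_derivative \<psi> (at u) = (\<lambda>h. D (\<kappa> (\<psi> u)) (?A h))"
    using d\<psi> has_derivative_unique by blast
  then show ?thesis using A by (intro exI[of _ ?A]) (simp add: o_def)
qed

text \<open>Every parametrisation through the point has a derivative that factors through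
  \<open>D s\<close>, so the union over parametrisations in \<open>tangent_space\<close> collapses
  to one range.\<close>

lemma tangent_space_eq:
  assumes "s \<in> V"
  shows "tangent_space TYPE('n) M (\<phi> s) = range (D s)"
proof
  show "range (D s) \<subseteq> tangent_space TYPE('n) M (\<phi> s)"
    unfolding tangent_space_def using local_param_chart assms by blast
  show "tangent_space TYPE('n) M (\<phi> s) \<subseteq> range (D s)"
  proof
    fix w assume "w \<in> tangent_space TYPE('n) M (\<phi> s)"
    then obtain U :: "(real^'n) set" and \<psi> u where \<psi>: "local_param M U \<psi>" "u \<in> U" "\<psi> u = \<phi> s"
      "w \<in> range (frechet_derivative \<psi> (at u))" unfolding tangent_space_def by blast
    then show "w \<in> range (D s)"
      using transition[OF \<psi>(1,2)] \<phi>_in(2)[OF assms] \<kappa>_\<phi>[OF assms] by auto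
  qed
qed

lemma tangent_proj_eq:
  assumes s: "s \<in> V"
  shows "tangent_proj TYPE('n) M (\<phi> s) v = P s v"
  unfolding tangent_proj_def tangent_space_eq[OF s]
proof (rule the_equality)
  show "P s v \<in> range (D s) \<and> (\<forall>t\<in>range (D s). (v - P s v) \<bullet> t = 0)"
    using P_normal[OF s] by (auto simp: P_def inner_commute)
  fix w assume w: "w \<in> range (D s) \<and> (\<forall>t\<in>range (D s). (v - w) \<bullet> t = 0)"
  then obtain h where h: "w = D s h" by blast
  have "P s (v - w) = 0" using w by (intro P_eq_0[OF s]) auto
  then show "w = P s v" using P_D[OF s] linear_diff[OF linear_P[OF s]] h by simp
qed

text \<open>M leaves its tangent planes only to second order: in the chart the derivative of \<phi>
  is Lipschitz, so the linearisation error is quadratic, and the Lipschitz map \<kappa> expresses it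
  in ambient distance. The last estimate says that the tangential projection varies in a Lipschitz
  way; one radius and one constant serve both.\<close>

lemma quadratic_normal_bound:
  assumes "x \<in> M" "x \<in> W"
  obtains \<rho> C where "\<rho> > 0" "C \<ge> 0" "ball x \<rho> \<subseteq> W"
    "\<And>p q n. p \<in> M \<inter> ball x \<rho> \<Longrightarrow> q \<in> M \<inter> ball x \<rho> \<Longrightarrow> (\<And>h. n \<bullet> D (\<kappa> p) h = 0) \<Longrightarrow>
       \<bar>n \<bullet> (q - p)\<bar> \<le> C * norm n * (norm (q - p))\<^sup>2"
    "\<And>p v. p \<in> M \<inter> ball x \<rho> \<Longrightarrow> norm (P (\<kappa> p) v - P (\<kappa> x) v) \<le> C * norm (p - x) * norm v"
proof -
  define s0 where "s0 = \<kappa> x"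
  have s0: "s0 \<in> V" unfolding s0_def using assms \<kappa>_in by blast
  obtain r where r: "r > 0" "cball s0 r \<subseteq> V" using openV s0 open_contains_cball by blast
  obtain r' where r': "r' > 0" "cball x r' \<subseteq> W" using openW assms open_contains_cball by blast
  obtain K where K: "K \<ge> 0" "\<And>y z. y \<in> cball x r' \<Longrightarrow> z \<in> cball x r' \<Longrightarrow> norm (\<kappa> y - \<kappa> z) \<le> K * norm (y - z)"
    using C1on_Lipschitz[OF C1_\<kappa> r'(2)] by blast
  have "\<exists>C\<ge>0. \<forall>y\<in>cball s0 r. \<forall>z\<in>cball s0 r. norm (b k y - b k z) \<le> C * norm (y - z)" for k
    using C1on_Lipschitz[OF C1_b r(2)] by metis
  then obtain B where B: "\<And>k. B k \<ge> 0" "\<And>k y z. y \<in> cball s0 r \<Longrightarrow> z \<in> cball s0 r \<Longrightarrow> norm (b k y - b k z) \<le> B k * norm (y - z)"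
    by metis
  have "\<exists>C\<ge>0. \<forall>y\<in>cball s0 r. \<forall>z\<in>cball s0 r. norm (P y e - P z e) \<le> C * norm (y - z)" for e
    using C1on_Lipschitz[OF C1_P[OF C1on_const] r(2)] by metis
  then obtain E where E: "\<And>e. E e \<ge> 0" "\<And>e y z. y \<in> cball s0 r \<Longrightarrow> z \<in> cball s0 r \<Longrightarrow> norm (P y e - P z e) \<le> E e * norm (y - z)"
    by metis
  \<comment> \<open>Small enough that \<kappa> maps the ball into \<open>cball s0 r\<close>, where
    the bounds on \<open>b\<close> and \<open>P\<close> hold; the added 1 avoids a zero
    denominator.\<close>
  define \<rho> where "\<rho> = min r' (r / (K + 1))"
  define B' where "B' = (\<Sum>k\<in>UNIV. B k)"
  define E' where "E' = (\<Sum>e\<in>Basis. E e)"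
  have BE0: "B' \<ge> 0" "E' \<ge> 0" using B(1) E(1) by (auto simp: B'_def E'_def intro: sum_nonneg)
  have \<rho>: "\<rho> > 0" using r r' K by (simp add: \<rho>_def add_nonneg_pos)
  have \<kappa>b: "\<kappa> p \<in> cball s0 r" if p: "p \<in> ball x \<rho>" for p
  proof -
    have "norm (\<kappa> p - \<kappa> x) \<le> K * norm (p - x)"
      using p r'(1) by (intro K(2)) (auto simp: \<rho>_def)
    also have "\<dots> \<le> (K + 1) * (r / (K + 1))"
      using p K(1) by (intro mult_mono) (auto simp: \<rho>_def dist_norm norm_minus_commute)
    finally show ?thesis using K(1) by (simp add: s0_def dist_norm norm_minus_commute)
  qed
  show ?thesis
  proof (rule that[of \<rho> "B' * K\<^sup>2 + E' * K"])
    show "0 \<le> B' * K\<^sup>2 + E' * K" using BE0 K by simp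
    show sub: "ball x \<rho> \<subseteq> W" using r' by (auto simp: \<rho>_def)
    fix p v assume p: "p \<in> M \<inter> ball x \<rho>"
    have lp: "linear (P (\<kappa> p))" "linear (P (\<kappa> x))" using p sub assms \<kappa>_in by (auto intro!: linear_P)
    have "P (\<kappa> p) v - P (\<kappa> x) v = (\<Sum>e\<in>Basis. (v \<bullet> e) *\<^sub>R (P (\<kappa> p) e - P (\<kappa> x) e))"
    proof -
      have "P (\<kappa> y) v = (\<Sum>e\<in>Basis. (v \<bullet> e) *\<^sub>R P (\<kappa> y) e)" if "linear (P (\<kappa> y))" for y
        by (subst euclidean_representation[symmetric, of v]) (simp add: linear_sum[OF that] linear_cmul[OF that])
      then show ?thesis using lp by (simp add: scaleR_diff_right sum_subtractf)
    qed
    also have "norm \<dots> \<le> (\<Sum>e\<in>(Basis :: (real^'d) set). E e * (K * norm (p - x) * norm v))"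
    proof (rule sum_norm_le)
      fix e :: "real^'d" assume e: "e \<in> Basis"
      have "norm (P (\<kappa> p) e - P (\<kappa> x) e) \<le> E e * norm (\<kappa> p - \<kappa> x)"
        using p \<rho> by (intro E(2) \<kappa>b) auto
      also have "\<dots> \<le> E e * (K * norm (p - x))"
        using p r'(1) by (intro mult_left_mono K(2) E(1)) (auto simp: \<rho>_def)
      finally have "\<bar>v \<bullet> e\<bar> * norm (P (\<kappa> p) e - P (\<kappa> x) e) \<le> norm v * (E e * (K * norm (p - x)))"
        using e by (intro mult_mono Basis_le_norm) auto
      then show "norm ((v \<bullet> e) *\<^sub>R (P (\<kappa> p) e - P (\<kappa> x) e)) \<le> E e * (K * norm (p - x) * norm v)"
        by (simp add: mult_ac)
    qed
    also have "\<dots> = E' * K * (norm (p - x) * norm v)"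
      unfolding E'_def sum_distrib_right by (rule sum.cong) (simp_all add: mult_ac)
    also have "\<dots> \<le> (B' * K\<^sup>2 + E' * K) * (norm (p - x) * norm v)"
      using BE0 K by (intro mult_right_mono) auto
    finally show "norm (P (\<kappa> p) v - P (\<kappa> x) v) \<le> (B' * K\<^sup>2 + E' * K) * norm (p - x) * norm v"
      by (simp add: mult.assoc)
  next
    fix p q n assume p: "p \<in> M \<inter> ball x \<rho>" and q: "q \<in> M \<inter> ball x \<rho>" and n: "\<And>h. n \<bullet> D (\<kappa> p) h = 0"
    have sub: "ball x \<rho> \<subseteq> W" using r' by (auto simp: \<rho>_def)
    let ?s = "\<kappa> p" and ?t = "\<kappa> q"
    have st: "?s \<in> cball s0 r" "?t \<in> cball s0 r" using \<kappa>b p q by auto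
    have eq: "\<phi> ?s = p" "\<phi> ?t = q" using p q sub \<phi>_\<kappa> by auto
    have "norm (\<phi> ?t - \<phi> ?s - D ?s (?t - ?s)) \<le> norm (?t - ?s) * (B' * norm (?t - ?s))"
    proof (rule differentiable_bound_linearization[where S = "closed_segment ?s ?t"])
      have cs: "closed_segment ?s ?t \<subseteq> cball s0 r" using st by (intro closed_segment_subset) auto
      show "?s + t *\<^sub>R (?t - ?s) \<in> closed_segment ?s ?t" if "t \<in> {0..1}" for t
        using that by (auto simp: in_segment algebra_simps intro!: exI[of _ t])
      fix y assume y: "y \<in> closed_segment ?s ?t"
      then have yV: "y \<in> V" "y \<in> cball s0 r" using cs r(2) by auto
      show "(\<phi> has_derivative D y) (at y within closed_segment ?s ?t)"
        using deriv_\<phi>[OF yV(1)] by (rule has_derivative_at_withinI)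
      have sV: "?s \<in> V" using st r by auto
      have ny: "norm (y - ?s) \<le> norm (?t - ?s)" using segment_bound(1)[OF y] by simp
      show "onorm (D y - D ?s) \<le> B' * norm (?t - ?s)"
      proof (rule onorm_bound)
        fix h
        have "(D y - D ?s) h = (\<Sum>k\<in>UNIV. h $ k *\<^sub>R (b k y - b k ?s))"
          by (simp add: D_eq[OF yV(1)] D_eq[OF sV] scaleR_diff_right sum_subtractf)
        also have "norm \<dots> \<le> (\<Sum>k\<in>UNIV. B k * (norm (?t - ?s) * norm h))"
        proof (rule sum_norm_le)
          fix k
          have "norm (b k y - b k ?s) \<le> B k * norm (y - ?s)" using B(2) yV st by blast
          also have "\<dots> \<le> B k * norm (?t - ?s)" using ny B(1) by (intro mult_left_mono) auto
          finally have "\<bar>h $ k\<bar> * norm (b k y - b k ?s) \<le> norm h * (B k * norm (?t - ?s))"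
            by (intro mult_mono component_le_norm_cart) auto
          then show "norm (h $ k *\<^sub>R (b k y - b k ?s)) \<le> B k * (norm (?t - ?s) * norm h)" by (simp add: mult_ac)
        qed
        finally show "norm ((D y - D ?s) h) \<le> B' * norm (?t - ?s) * norm h"
          by (simp add: B'_def sum_distrib_right mult.assoc)
      qed (use BE0 in auto)
    qed auto
    also have "\<dots> = B' * (norm (?t - ?s))\<^sup>2" by (simp add: power2_eq_square)
    also have "\<dots> \<le> B' * (K * norm (q - p))\<^sup>2"
      using p q BE0 by (intro mult_left_mono power_mono K(2)) (auto simp: \<rho>_def)
    also have "\<dots> \<le> (B' * K\<^sup>2 + E' * K) * (norm (q - p))\<^sup>2"
      using BE0 K by (simp add: power_mult_distrib distrib_right)
    finally have *: "norm (q - p - D ?s (?t - ?s)) \<le> (B' * K\<^sup>2 + E' * K) * (norm (q - p))\<^sup>2" by (simp add: eq)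
    \<comment> \<open>The linear term is tangential at \<open>p\<close>, so \<open>n\<close> sees
      only the quadratic remainder.\<close>
    have "\<bar>n \<bullet> (q - p)\<bar> = \<bar>n \<bullet> (q - p - D ?s (?t - ?s))\<bar>" using n by (simp add: inner_diff_right)
    also have "\<dots> \<le> norm n * norm (q - p - D ?s (?t - ?s))" by (rule Cauchy_Schwarz_ineq2)
    also have "\<dots> \<le> norm n * ((B' * K\<^sup>2 + E' * K) * (norm (q - p))\<^sup>2)" using * by (intro mult_left_mono) auto
    finally show "\<bar>n \<bullet> (q - p)\<bar> \<le> (B' * K\<^sup>2 + E' * K) * norm n * (norm (q - p))\<^sup>2" by (simp add: mult_ac)
  qed (rule \<rho>)
qed

end

section \<open>The closest-point projection and the divergence\<close>

definition proj_field :: "'n::finite itself \<Rightarrow> (real^'d) set \<Rightarrow> (real^'d \<Rightarrow> real^'d) \<Rightarrow> real^'d \<Rightarrow> real^'d" where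
  "proj_field n M v = (\<lambda>y. tangent_proj n M (closest_point M y) (v (closest_point M y)))"

context chart
begin

text \<open>Compactness gives a minimiser p, and the first-order condition makes y - p normal. For a
  second minimiser q the equal distances give |q - p|^2 = 2 (y - p) . (q - p), which quadratic
  contact bounds by 2 C |y - p| |q - p|^2. Close to M this forces q = p, so the definite description
  in \<open>closest_point\<close> denotes the minimiser.\<close>

lemma closest_point_near:
  assumes M: "compact M" and x: "x \<in> M" "x \<in> W"
  obtains \<rho> where "\<rho> > 0"
    "\<And>y. y \<in> ball x \<rho> \<Longrightarrow> closest_point M y \<in> M \<inter> W \<and> norm (closest_point M y - x) \<le> 2 * norm (y - x) \<and>
       (\<forall>h. (y - closest_point M y) \<bullet> D (\<kappa> (closest_point M y)) h = 0)"
proof -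
  obtain \<rho>0 C where Q: "\<rho>0 > 0" "C \<ge> 0" "ball x \<rho>0 \<subseteq> W"
    "\<And>p q n. p \<in> M \<inter> ball x \<rho>0 \<Longrightarrow> q \<in> M \<inter> ball x \<rho>0 \<Longrightarrow> (\<And>h. n \<bullet> D (\<kappa> p) h = 0) \<Longrightarrow>
       \<bar>n \<bullet> (q - p)\<bar> \<le> C * norm n * (norm (q - p))\<^sup>2"
    using quadratic_normal_bound[OF x] by metis
  \<comment> \<open>The first bound keeps minimisers, which lie within
    \<open>2 * norm (y - x)\<close> of \<open>x\<close>, where quadratic contact is available; the
    second makes \<open>2 * C * norm (y - p)\<close> smaller than 1.\<close>
  define \<rho> where "\<rho> = min (\<rho>0 / 2) (1 / (2 * (C + 1)))"
  have \<rho>: "\<rho> > 0" using Q by (simp add: \<rho>_def)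
  have "closest_point M y \<in> M \<inter> W \<and> norm (closest_point M y - x) \<le> 2 * norm (y - x) \<and>
       (\<forall>h. (y - closest_point M y) \<bullet> D (\<kappa> (closest_point M y)) h = 0)" if y: "y \<in> ball x \<rho>" for y
  proof -
    define mini where "mini = (\<lambda>p. p \<in> M \<and> (\<forall>z\<in>M. dist y p \<le> dist y z))"
    have yx: "norm (y - x) < \<rho>" using y by (simp add: dist_norm norm_minus_commute)
    have near: "norm (p - x) \<le> 2 * norm (y - x)" "norm (y - p) \<le> norm (y - x)" if "mini p" for p
    proof -
      show *: "norm (y - p) \<le> norm (y - x)" using that x by (auto simp: mini_def dist_norm)
      have "p - x = (y - x) - (y - p)" by simp
      then show "norm (p - x) \<le> 2 * norm (y - x)" using * norm_triangle_ineq4[of "y - x" "y - p"] by simp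
    qed
    have pin: "p \<in> M \<inter> ball x \<rho>0" "p \<in> M \<inter> W" if "mini p" for p
      using that near(1)[OF that] yx Q(3) by (auto simp: \<rho>_def mini_def dist_norm norm_minus_commute)
    have normal: "(y - p) \<bullet> D (\<kappa> p) h = 0" if p: "mini p" for p h
    proof -
      have s: "\<kappa> p \<in> V" "\<phi> (\<kappa> p) = p" using pin[OF p] \<kappa>_in \<phi>_\<kappa> by auto
      let ?g = "\<lambda>s. (y - \<phi> s) \<bullet> (y - \<phi> s)"
      have "(?g has_derivative (\<lambda>h. (y - \<phi> (\<kappa> p)) \<bullet> (0 - D (\<kappa> p) h) + (0 - D (\<kappa> p) h) \<bullet> (y - \<phi> (\<kappa> p)))) (at (\<kappa> p))"
        by (intro has_derivative_inner has_derivative_diff has_derivative_const deriv_\<phi> s)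
      moreover have "?g (\<kappa> p) \<le> ?g s'" if "s' \<in> V" for s'
      proof -
        have "norm (y - p) \<le> norm (y - \<phi> s')" using p \<phi>_in(1)[OF that] by (auto simp: mini_def dist_norm)
        then show ?thesis by (simp add: s(2) dot_square_norm power_mono)
      qed
      ultimately have "(\<lambda>h. (y - \<phi> (\<kappa> p)) \<bullet> (0 - D (\<kappa> p) h) + (0 - D (\<kappa> p) h) \<bullet> (y - \<phi> (\<kappa> p))) = (\<lambda>h. 0)"
        by (intro differential_zero_maxmin[OF s(1) openV]) auto
      from fun_cong[OF this, of h] show ?thesis by (simp add: s(2) inner_commute)
    qed
    have unique: "p = q" if p: "mini p" and q: "mini q" for p q
    proof (rule ccontr)
      assume "p \<noteq> q"
      let ?n = "y - p"
      have eq: "norm (y - q) = norm (y - p)" using p q by (auto simp: mini_def dist_norm intro: antisym)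
      have "(norm (y - q))\<^sup>2 = (norm ?n)\<^sup>2 - 2 * (?n \<bullet> (q - p)) + (norm (q - p))\<^sup>2"
        by (simp add: power2_norm_eq_inner algebra_simps inner_commute)
      then have "(norm (q - p))\<^sup>2 = 2 * (?n \<bullet> (q - p))" by (simp add: eq)
      also have "\<dots> \<le> 2 * (C * norm ?n * (norm (q - p))\<^sup>2)"
        using Q(4)[OF pin(1)[OF p] pin(1)[OF q] normal[OF p]] by linarith
      also have "\<dots> = (2 * C * norm ?n) * (norm (q - p))\<^sup>2" by simp
      finally have "1 * (norm (q - p))\<^sup>2 \<le> (2 * C * norm ?n) * (norm (q - p))\<^sup>2" by simp
      then have ge: "1 \<le> 2 * C * norm ?n" using \<open>p \<noteq> q\<close> by (simp only: mult_le_cancel_right) simp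
      have "2 * C * norm ?n \<le> 2 * (C + 1) * norm (y - x)"
        using Q(2) near(2)[OF p] by (intro mult_mono) auto
      also have "\<dots> < 1" using yx Q(2) by (simp add: \<rho>_def pos_less_divide_eq mult.commute)
      finally show False using ge by simp
    qed
    have "M \<noteq> {}" using x by blast
    then obtain p where "p \<in> M" "\<And>z. z \<in> M \<Longrightarrow> dist y p \<le> dist y z"
      using distance_attains_inf[OF compact_imp_closed[OF M]] by metis
    then have p: "mini p" by (simp add: mini_def)
    have "closest_point M y = p"
      unfolding closest_point_def
    proof (rule the_equality)
      show "p \<in> M \<and> (\<forall>z\<in>M. dist y p \<le> dist y z)" using p by (simp add: mini_def)
      show "q = p" if "q \<in> M \<and> (\<forall>z\<in>M. dist y q \<le> dist y z)" for q
        using unique[OF _ p] that by (simp add: mini_def)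
    qed
    then show ?thesis using p pin near normal by auto
  qed
  then show ?thesis using that \<rho> by blast
qed

lemma closest_point_on:
  assumes "x \<in> M" shows "closest_point M x = x"
  unfolding closest_point_def by (rule the_equality) (use assms in \<open>auto dest: bspec[of _ _ x]\<close>)

text \<open>Let p be the closest point of y, n the normal part of p - x, and P the projection at x.
  The remainder p - x - P(y - x) equals n - P(y - p). Here n is quadratic by contact, and the
  projection at p kills y - p, so P(y - p) is a difference of two projections applied to y - p, a
  product of two small quantities.\<close>

lemma closest_point_has_derivative:
  assumes M: "compact M" and x: "x \<in> M" "x \<in> W"
  shows "(closest_point M has_derivative P (\<kappa> x)) (at x)"
proof -
  obtain \<rho>0 C where Q: "\<rho>0 > 0" "C \<ge> 0" "ball x \<rho>0 \<subseteq> W"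
    "\<And>p q n. p \<in> M \<inter> ball x \<rho>0 \<Longrightarrow> q \<in> M \<inter> ball x \<rho>0 \<Longrightarrow> (\<And>h. n \<bullet> D (\<kappa> p) h = 0) \<Longrightarrow>
       \<bar>n \<bullet> (q - p)\<bar> \<le> C * norm n * (norm (q - p))\<^sup>2"
    "\<And>p v. p \<in> M \<inter> ball x \<rho>0 \<Longrightarrow> norm (P (\<kappa> p) v - P (\<kappa> x) v) \<le> C * norm (p - x) * norm v"
    using quadratic_normal_bound[OF x] by metis
  obtain \<rho>1 where R: "\<rho>1 > 0"
    "\<And>y. y \<in> ball x \<rho>1 \<Longrightarrow> closest_point M y \<in> M \<inter> W \<and> norm (closest_point M y - x) \<le> 2 * norm (y - x) \<and>
       (\<forall>h. (y - closest_point M y) \<bullet> D (\<kappa> (closest_point M y)) h = 0)"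
    using closest_point_near[OF M x] by metis
  have s0: "\<kappa> x \<in> V" using x \<kappa>_in by blast
  have lin: "linear (P (\<kappa> x))" using s0 by (rule linear_P)
  show ?thesis
  \<comment> \<open>10 = 2^2 + 2 * 3, from |p - x| \<le> 2 |y - x| and |y - p| \<le> 3 |y -
    x|.\<close>
  proof (rule has_derivative_quadratic[where \<rho> = "min (\<rho>0 / 2) \<rho>1" and C = "10 * C"])
    show "bounded_linear (P (\<kappa> x))" using lin by (simp add: linear_conv_bounded_linear)
    show "min (\<rho>0 / 2) \<rho>1 > 0" "10 * C \<ge> 0" using Q R by auto
    fix y assume y: "norm (y - x) < min (\<rho>0 / 2) \<rho>1"
    define p where "p = closest_point M y"
    have p: "p \<in> M \<inter> W" "norm (p - x) \<le> 2 * norm (y - x)" "\<And>h. (y - p) \<bullet> D (\<kappa> p) h = 0"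
      using R(2)[of y] y by (auto simp: p_def dist_norm norm_minus_commute)
    have pb: "p \<in> M \<inter> ball x \<rho>0" "x \<in> M \<inter> ball x \<rho>0" using p y Q(1) x by (auto simp: dist_norm norm_minus_commute)
    define n where "n = (p - x) - P (\<kappa> x) (p - x)"
    have nn: "n \<bullet> D (\<kappa> x) h = 0" for h using P_normal[OF s0, of h "p - x"] by (simp add: n_def inner_commute)
    have "n \<bullet> n = n \<bullet> (p - x)"
      using nn[of "coords (\<kappa> x) (p - x)"] by (simp add: n_def[of] inner_diff_right P_def)
    also have "\<dots> \<le> C * norm n * (norm (p - x))\<^sup>2"
      using Q(4)[OF pb(2) pb(1) nn] by linarith
    finally have "norm n * norm n \<le> norm n * (C * (norm (p - x))\<^sup>2)" by (simp add: dot_square_norm power2_eq_square mult_ac)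
    then have n1: "norm n \<le> C * (norm (p - x))\<^sup>2"
      using Q(2) by (cases "n = 0") auto
    have "P (\<kappa> p) (y - p) = 0" using p \<kappa>_in by (intro P_eq_0) auto
    then have n2: "norm (P (\<kappa> x) (y - p)) \<le> C * norm (p - x) * norm (y - p)"
      using Q(5)[OF pb(1), of "y - p"] by (simp add: norm_minus_commute)
    have yp: "norm (y - p) \<le> 3 * norm (y - x)"
      using norm_triangle_ineq4[of "y - x" "p - x"] p(2) by simp
    have "p - x - P (\<kappa> x) (y - x) = n - P (\<kappa> x) (y - p)"
      using linear_add[OF lin, of "y - p" "p - x"] by (simp add: n_def)
    then have "norm (p - x - P (\<kappa> x) (y - x)) \<le> C * (norm (p - x))\<^sup>2 + C * norm (p - x) * norm (y - p)"
      using n1 n2 norm_triangle_ineq4[of n "P (\<kappa> x) (y - p)"] by simp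
    also have "\<dots> \<le> C * (2 * norm (y - x))\<^sup>2 + C * (2 * norm (y - x)) * (3 * norm (y - x))"
      using p(2) yp Q(2) by (intro add_mono mult_mono power_mono) auto
    also have "\<dots> = 10 * C * (norm (y - x))\<^sup>2" by (simp add: power2_eq_square)
    finally show "norm (closest_point M y - closest_point M x - P (\<kappa> x) (y - x)) \<le> 10 * C * (norm (y - x))\<^sup>2"
      by (simp add: p_def closest_point_on[OF x(1)])
  qed
qed

section \<open>Divergence of a projected field\<close>

definition T where "T e z = frechet_derivative (\<lambda>z. P (\<kappa> z) e) (at z)"

text \<open>At a point of M the e-component is the tangential divergence of the projected constant
  field \<open>e\<close>, so this is the unnormalised mean curvature vector. It collects the part of
  the divergence that is of order zero in \<open>v\<close>.\<close>

definition curv where "curv z = (\<Sum>e\<in>Basis. (\<Sum>i\<in>Basis. T e z (P (\<kappa> z) i) \<bullet> i) *\<^sub>R e)"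

lemma C1_P\<kappa>: "C1on W (\<lambda>z. P (\<kappa> z) e)"
  by (rule C1on_compose[OF C1_P[OF C1on_const] C1_\<kappa> \<kappa>_image])

lemma T_deriv: "z \<in> W \<Longrightarrow> ((\<lambda>z. P (\<kappa> z) e) has_derivative T e z) (at z)"
  unfolding T_def by (rule C1on_frechet(1)[OF C1_P\<kappa>])

lemma continuous_on_curv: "continuous_on W curv"
proof -
  have eq: "curv z = (\<Sum>e\<in>Basis. (\<Sum>i\<in>Basis. (\<Sum>j\<in>Basis. (P (\<kappa> z) i \<bullet> j) *\<^sub>R T e z j) \<bullet> i) *\<^sub>R e)" if "z \<in> W" for z
  proof -
    have Tw: "T e z w = (\<Sum>j\<in>Basis. (w \<bullet> j) *\<^sub>R T e z j)" for e w
    proof -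
      have lin: "linear (T e z)" using T_deriv[OF that] has_derivative_linear by blast
      show ?thesis by (subst euclidean_representation[symmetric, of w]) (simp add: linear_sum[OF lin] linear_cmul[OF lin])
    qed
    show ?thesis by (simp add: curv_def Tw[of _ "P (\<kappa> z) _"])
  qed
  have "continuous_on W (\<lambda>z. T e z j)" for e j
    unfolding T_def by (rule C1on_frechet(2)[OF C1_P\<kappa>])
  then have "continuous_on W (\<lambda>z. \<Sum>e\<in>Basis. (\<Sum>i\<in>Basis. (\<Sum>j\<in>Basis. (P (\<kappa> z) i \<bullet> j) *\<^sub>R T e z j) \<bullet> i) *\<^sub>R e)"
    by (intro continuous_intros C1on_imp_continuous_on[OF C1_P\<kappa>])
  then show ?thesis by (simp add: eq cong: continuous_on_cong)
qed

lemma P_expand: "s \<in> V \<Longrightarrow> P s v = (\<Sum>e\<in>Basis. (v \<bullet> e) *\<^sub>R P s e)"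
  by (subst euclidean_representation[symmetric, of v]) (simp add: linear_sum[OF linear_P] linear_cmul[OF linear_P])

text \<open>The projected vector is expanded over the ambient basis, so only the functions
  \<open>P (\<kappa> z) e\<close> with fixed \<open>e\<close> are differentiated. Composition with
  the closest-point map then inserts \<open>P (\<kappa> x)\<close>, the derivative of that map at
  \<open>x\<close>.\<close>

lemma proj_field_has_derivative:
  assumes M: "compact M" and x: "x \<in> M" "x \<in> W" and v: "(v has_derivative v') (at x)"
  shows "(proj_field TYPE('n) M v has_derivative
      (\<lambda>h. P (\<kappa> x) (v' (P (\<kappa> x) h)) + (\<Sum>e\<in>Basis. (v x \<bullet> e) *\<^sub>R T e x (P (\<kappa> x) h)))) (at x)"
proof -
  have s0: "\<kappa> x \<in> V" using x \<kappa>_in by blast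
  let ?Q = "\<lambda>z. \<Sum>e\<in>Basis. (v z \<bullet> e) *\<^sub>R P (\<kappa> z) e"
  have "(?Q has_derivative (\<lambda>h. \<Sum>e\<in>Basis. (v x \<bullet> e) *\<^sub>R T e x h + (v' h \<bullet> e) *\<^sub>R P (\<kappa> x) e)) (at x)"
    by (intro has_derivative_sum has_derivative_scaleR T_deriv x has_derivative_inner_left v)
  then have Q: "(?Q has_derivative (\<lambda>h. P (\<kappa> x) (v' h) + (\<Sum>e\<in>Basis. (v x \<bullet> e) *\<^sub>R T e x h))) (at x)"
    by (simp add: sum.distrib P_expand[OF s0, of "v' _"] add.commute)
  obtain \<rho> where \<rho>: "\<rho> > 0" "\<And>y. y \<in> ball x \<rho> \<Longrightarrow> closest_point M y \<in> M \<inter> W"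
    using closest_point_near[OF M x] by metis
  have "((\<lambda>y. ?Q (closest_point M y)) has_derivative
      (\<lambda>h. P (\<kappa> x) (v' (P (\<kappa> x) h)) + (\<Sum>e\<in>Basis. (v x \<bullet> e) *\<^sub>R T e x (P (\<kappa> x) h)))) (at x)"
    by (rule has_derivative_compose[OF closest_point_has_derivative[OF M x]])
      (use Q in \<open>simp add: closest_point_on[OF x(1)]\<close>)
  then show ?thesis
  proof (rule has_derivative_transform_within_open)
    show "open (ball x \<rho>)" "x \<in> ball x \<rho>" using \<rho> by auto
    fix y assume "y \<in> ball x \<rho>"
    then have c: "closest_point M y \<in> M" "closest_point M y \<in> W" using \<rho> by auto
    then show "?Q (closest_point M y) = proj_field TYPE('n) M v y"
      using tangent_proj_eq[OF \<kappa>_in[OF c(2)], of "v (closest_point M y)"]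
        P_expand[OF \<kappa>_in[OF c(2)], of "v (closest_point M y)"]
      by (simp add: proj_field_def \<phi>_\<kappa>[OF c])
  qed
qed

lemma div_E_eqI: "(u has_derivative u') (at x) \<Longrightarrow> div_E u x = (\<Sum>i\<in>Basis. u' i \<bullet> i)"
  unfolding div_E_def using frechet_derivative_at by metis

lemma div_proj_field:
  assumes M: "compact M" and x: "x \<in> M" "x \<in> W" and v: "(v has_derivative v') (at x)"
  shows "div_E (proj_field TYPE('n) M v) x = curv x \<bullet> v x + (\<Sum>i\<in>Basis. P (\<kappa> x) (v' (P (\<kappa> x) i)) \<bullet> i)"
proof -
  have "(\<Sum>i\<in>Basis. (\<Sum>e\<in>Basis. (v x \<bullet> e) *\<^sub>R T e x (P (\<kappa> x) i)) \<bullet> i) =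
      (\<Sum>i\<in>Basis. \<Sum>e\<in>Basis. (v x \<bullet> e) * (T e x (P (\<kappa> x) i) \<bullet> i))"
    by (simp add: inner_sum_left)
  also have "\<dots> = (\<Sum>e\<in>Basis. \<Sum>i\<in>Basis. (v x \<bullet> e) * (T e x (P (\<kappa> x) i) \<bullet> i))" by (rule sum.swap)
  also have "\<dots> = curv x \<bullet> v x"
    unfolding curv_def inner_sum_left by (simp add: sum_distrib_left inner_commute mult.commute)
  finally show ?thesis
    by (simp add: div_E_eqI[OF proj_field_has_derivative[OF assms]] inner_add_left sum.distrib)
qed

text \<open>The divergence is linear in the value and derivative of \<open>v\<close>, with
  coefficients bounded near \<open>x0\<close>: \<open>curv\<close> is continuous and orthogonal
  projections do not increase norms, so each basis vector adds at most \<open>B\<close> to the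
  trace.\<close>

lemma div_stability_local:
  assumes M: "compact M" and x0: "x0 \<in> M" "x0 \<in> W"
  shows "\<exists>\<rho>>0. \<exists>C\<ge>0. \<forall>x\<in>M \<inter> ball x0 \<rho>. \<forall>v v' w w' B. (v has_derivative v') (at x) \<longrightarrow> (w has_derivative w') (at x) \<longrightarrow>
     norm (v x - w x) \<le> B \<longrightarrow> (\<forall>h. norm (v' h - w' h) \<le> B * norm h) \<longrightarrow>
     proj_field TYPE('n) M v differentiable (at x) \<and>
     \<bar>div_E (proj_field TYPE('n) M v) x - div_E (proj_field TYPE('n) M w) x\<bar> \<le> C * B"
proof -
  have "isCont curv x0" using continuous_on_curv openW x0 by (simp add: continuous_on_eq_continuous_at)
  then obtain \<rho>1 where r1: "\<rho>1 > 0" "\<And>x. dist x x0 < \<rho>1 \<Longrightarrow> dist (curv x) (curv x0) < 1"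
    unfolding continuous_at_eps_delta by (metis zero_less_one)
  obtain \<rho>2 where r2: "\<rho>2 > 0" "ball x0 \<rho>2 \<subseteq> W" using openW x0 open_contains_ball by blast
  define C where "C = norm (curv x0) + 1 + real (card (Basis :: (real^'d) set))"
  show ?thesis
  proof (rule exI[of _ "min \<rho>1 \<rho>2"], rule conjI, use r1 r2 in simp, rule exI[of _ C],
      intro conjI ballI allI impI)
    show "C \<ge> 0" by (simp add: C_def)
    fix x and v v' w w' :: "real^'d \<Rightarrow> real^'d" and B :: real
    assume x: "x \<in> M \<inter> ball x0 (min \<rho>1 \<rho>2)" and v: "(v has_derivative v') (at x)"
      and w: "(w has_derivative w') (at x)" and n: "norm (v x - w x) \<le> B" "\<forall>h. norm (v' h - w' h) \<le> B * norm h"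
    have xM: "x \<in> M" "x \<in> W" using x r2 by auto
    have s: "\<kappa> x \<in> V" using xM \<kappa>_in by blast
    have B0: "B \<ge> 0" using n(1) norm_ge_zero order_trans by blast
    show "proj_field TYPE('n) M v differentiable (at x)"
      using proj_field_has_derivative[OF M xM v] by (auto simp: differentiable_def)
    have cn: "norm (curv x) \<le> norm (curv x0) + 1"
      using r1(2)[of x] x norm_triangle_ineq2[of "curv x" "curv x0"] by (auto simp: dist_norm norm_minus_commute)
    have "div_E (proj_field TYPE('n) M v) x - div_E (proj_field TYPE('n) M w) x =
        curv x \<bullet> (v x - w x) + (\<Sum>i\<in>Basis. P (\<kappa> x) (v' (P (\<kappa> x) i) - w' (P (\<kappa> x) i)) \<bullet> i)"
      unfolding div_proj_field[OF M xM v] div_proj_field[OF M xM w]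
      by (simp add: linear_diff[OF linear_P[OF s]] inner_diff_left inner_diff_right sum_subtractf)
    also have "\<bar>\<dots>\<bar> \<le> norm (curv x) * norm (v x - w x) + (\<Sum>i\<in>(Basis::(real^'d) set). B)"
    proof -
      have "\<bar>P (\<kappa> x) (v' (P (\<kappa> x) i) - w' (P (\<kappa> x) i)) \<bullet> i\<bar> \<le> B" if i: "i \<in> Basis" for i
      proof -
        have "\<bar>P (\<kappa> x) (v' (P (\<kappa> x) i) - w' (P (\<kappa> x) i)) \<bullet> i\<bar> \<le> norm (P (\<kappa> x) (v' (P (\<kappa> x) i) - w' (P (\<kappa> x) i)))"
          using i by (rule Basis_le_norm)
        also have "\<dots> \<le> norm (v' (P (\<kappa> x) i) - w' (P (\<kappa> x) i))" by (rule norm_P_le[OF s])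
        also have "\<dots> \<le> B * norm (P (\<kappa> x) i)" using n(2) by blast
        also have "\<dots> \<le> B * norm i" using B0 norm_P_le[OF s] by (intro mult_left_mono)
        finally show ?thesis using i by simp
      qed
      then have "\<bar>\<Sum>i\<in>Basis. P (\<kappa> x) (v' (P (\<kappa> x) i) - w' (P (\<kappa> x) i)) \<bullet> i\<bar> \<le> (\<Sum>i\<in>(Basis::(real^'d) set). B)"
        by (intro order_trans[OF sum_abs] sum_mono)
      moreover have "\<bar>curv x \<bullet> (v x - w x)\<bar> \<le> norm (curv x) * norm (v x - w x)" by (rule Cauchy_Schwarz_ineq2)
      ultimately show ?thesis by linarith
    qed
    also have "\<dots> \<le> (norm (curv x0) + 1) * B + (\<Sum>i\<in>(Basis::(real^'d) set). B)"
      using cn n(1) B0 by (intro add_mono mult_mono) auto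
    also have "\<dots> = C * B" by (simp add: C_def algebra_simps)
    finally show "\<bar>div_E (proj_field TYPE('n) M v) x - div_E (proj_field TYPE('n) M w) x\<bar> \<le> C * B" .
  qed
qed

text \<open>Jacobi's formula for the root of the Gram determinant gives half the trace of G^-1 dG.
  The two halves of dG contribute equally since G is symmetric, and equality of mixed second
  derivatives turns the h-derivative of the frame into the derivative of \<open>D t h\<close> along
  the frame.\<close>

lemma J_log_derivative:
  assumes s: "s \<in> V"
  shows "frechet_derivative J (at s) h = J s * (\<Sum>k\<in>UNIV. coords s (frechet_derivative (\<lambda>t. D t h) (at s) (axis k 1)) $ k)"
proof -
  define B where "B = (\<lambda>k h. frechet_derivative (b k) (at s) h)"
  have dB: "(b k has_derivative B k) (at s)" for k unfolding B_def by (rule C1on_frechet(1)[OF C1_b s])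
  have B_sym: "B k h = frechet_derivative (\<lambda>t. D t h) (at s) (axis k 1)" for k
    using second_derivative_symmetric[OF openV s deriv_\<phi> dB[unfolded b_def[abs_def]] C1on_frechet(1)[OF C1_D s]] .
  have dG: "((\<lambda>t. G t $ i $ j) has_derivative (\<lambda>h. b i s \<bullet> B j h + B i h \<bullet> b j s)) (at s)" for i j
    unfolding G_def by (simp add: has_derivative_inner dB)
  define S where "S = cramer_sol (G s)"
  have nz: "det (G s) \<noteq> 0" by (rule det_G_nz[OF s])
  have linS: "linear S" unfolding S_def by (rule linear_cramer_sol[OF nz])
  have symS: "S u \<bullet> w = u \<bullet> S w" for u w unfolding S_def by (rule cramer_sol_symmetric[OF nz transpose_G])
  let ?d = "\<lambda>h. \<Sum>k\<in>UNIV. det (\<chi> i j. if i = k then b k s \<bullet> B j h + B k h \<bullet> b j s else G s $ i $ j)"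
  have ddet: "((\<lambda>t. det (G t)) has_derivative ?d) (at s)"
    by (rule has_derivative_det[OF dG])
  have d_eq: "?d h = det (G s) * (2 * (\<Sum>k\<in>UNIV. coords s (B k h) $ k))"
  proof -
    have row: "det (\<chi> i j. if i = k then b k s \<bullet> B j h + B k h \<bullet> b j s else G s $ i $ j) =
        det (G s) * S (\<chi> j. b k s \<bullet> B j h + B k h \<bullet> b j s) $ k" for k
      using det_replace_row_symmetric[OF nz transpose_G, of k "\<chi> j. b k s \<bullet> B j h + B k h \<bullet> b j s"]
      by (simp add: S_def cong: if_cong)
    have split: "S (\<chi> j. b k s \<bullet> B j h + B k h \<bullet> b j s) $ k = S (\<chi> j. b k s \<bullet> B j h) $ k + coords s (B k h) $ k" for k
    proof -
      have "(\<chi> j. b k s \<bullet> B j h + B k h \<bullet> b j s) = (\<chi> j. b k s \<bullet> B j h) + (\<chi> j. b j s \<bullet> B k h)"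
        by (simp add: vec_eq_iff inner_commute)
      then show ?thesis using linear_add[OF linS] by (simp add: coords_def S_def)
    qed
    have comp: "S u $ k = (\<Sum>j\<in>UNIV. u $ j * S (axis k 1) $ j)" for u k
    proof -
      have "S u $ k = S u \<bullet> axis k 1" by (simp add: inner_axis)
      also have "\<dots> = u \<bullet> S (axis k 1)" by (rule symS)
      finally show ?thesis by (simp add: inner_vec_def)
    qed
    have Rsym: "S (axis k 1) $ j = S (axis j 1) $ k" for j k
    proof -
      have "S (axis k 1) $ j = S (axis k 1) \<bullet> axis j 1" by (simp add: inner_axis)
      also have "\<dots> = axis k 1 \<bullet> S (axis j 1)" by (rule symS)
      finally show ?thesis by (simp add: inner_axis')
    qed
    \<comment> \<open>Exchanging the summation indices and using the symmetry of the inverse Gram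
      matrix brings the first half of dG to the form of the second.\<close>
    have "(\<Sum>k\<in>UNIV. S (\<chi> j. b k s \<bullet> B j h) $ k) = (\<Sum>k\<in>UNIV. \<Sum>j\<in>UNIV. (b k s \<bullet> B j h) * S (axis k 1) $ j)"
      by (simp add: comp[of "\<chi> j. _ j"])
    also have "\<dots> = (\<Sum>j\<in>UNIV. \<Sum>k\<in>UNIV. (b k s \<bullet> B j h) * S (axis k 1) $ j)" by (rule sum.swap)
    also have "\<dots> = (\<Sum>j\<in>UNIV. S (\<chi> k. b k s \<bullet> B j h) $ j)"
      by (simp add: comp[of "\<chi> j. _ j"] Rsym[of _ _])
    also have "\<dots> = (\<Sum>j\<in>UNIV. coords s (B j h) $ j)" by (simp add: coords_def S_def)
    finally show ?thesis by (simp add: row split sum.distrib flip: sum_distrib_left)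
  qed
  have "(J has_derivative (\<lambda>h. inverse (sqrt (det (G s))) / 2 * ?d h)) (at s)"
    unfolding J_def[abs_def]
  proof (rule has_derivative_compose[OF ddet])
    show "(sqrt has_derivative (\<lambda>t. inverse (sqrt (det (G s))) / 2 * t)) (at (det (G s)))"
      using DERIV_real_sqrt[OF det_G_pos[OF s]] by (simp only: has_field_derivative_def)
  qed
  then have "(\<lambda>h. inverse (sqrt (det (G s))) / 2 * ?d h) = frechet_derivative J (at s)"
    by (rule frechet_derivative_at)
  then have "frechet_derivative J (at s) h = inverse (sqrt (det (G s))) / 2 * ?d h"
    by (rule fun_cong[OF sym])
  also have "\<dots> = (inverse (sqrt (det (G s))) * det (G s)) * (\<Sum>k\<in>UNIV. coords s (B k h) $ k)"
    unfolding d_eq by simp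
  also have "inverse (sqrt (det (G s))) * det (G s) = J s"
    using det_G_pos[OF s] by (simp add: J_def field_simps)
  finally show ?thesis by (simp add: B_sym)
qed

text \<open>As \<open>v\<close> is tangential along M near the point, the projection drops out and
  the field is \<open>v\<close> composed with the closest-point map. Its trace contains that of the
  derivative of \<open>D t h\<close>, which \<open>J_log_derivative\<close> identifies as the
  logarithmic derivative of \<open>J\<close>; the weight 1/J is there to cancel it.\<close>

lemma div_proj_field_tangential:
  assumes M: "compact M" and s: "s \<in> V" and v: "(v has_derivative v') (at (\<phi> s))"
    and B: "open B" "s \<in> B" "B \<subseteq> V" and eq: "\<And>t. t \<in> B \<Longrightarrow> v (\<phi> t) = (q t / J t) *\<^sub>R D t h"
    and q: "(q has_derivative q') (at s)"
  shows "div_E (proj_field TYPE('n) M v) (\<phi> s) = q' h / J s"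
proof -
  define x where "x = \<phi> s"
  have x: "x \<in> M" "x \<in> W" "\<kappa> x = s" using \<phi>_in[OF s] \<kappa>_\<phi>[OF s] by (auto simp: x_def)
  define E where "E = frechet_derivative (\<lambda>t. D t h) (at s)"
  define J' where "J' = frechet_derivative J (at s)"
  have dJ: "(J has_derivative J') (at s)" unfolding J'_def by (rule C1on_frechet(1)[OF C1_J s])
  have dE: "((\<lambda>t. D t h) has_derivative E) (at s)" unfolding E_def by (rule C1on_frechet(1)[OF C1_D s])
  have J0: "J s \<noteq> 0" using J_pos[OF s] by simp
  define a' where "a' = (\<lambda>k. - q s * (inverse (J s) * J' k * inverse (J s)) + q' k / J s)"
  have da: "((\<lambda>t. q t / J t) has_derivative a') (at s)" unfolding a'_def by (rule has_derivative_divide[OF q dJ J0])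
  define Y where "Y = (\<lambda>k. (q s / J s) *\<^sub>R E k + a' k *\<^sub>R D s h)"
  have dY: "((\<lambda>t. (q t / J t) *\<^sub>R D t h) has_derivative Y) (at s)" unfolding Y_def by (rule has_derivative_scaleR[OF da dE])
  have "((\<lambda>t. v (\<phi> t)) has_derivative (\<lambda>k. v' (D s k))) (at s)"
    by (rule has_derivative_compose[OF deriv_\<phi>[OF s] v])
  moreover have "((\<lambda>t. v (\<phi> t)) has_derivative Y) (at s)"
    by (rule has_derivative_transform_within_open[OF dY B(1,2)]) (simp add: eq)
  ultimately have vD: "v' (D s k) = Y k" for k using has_derivative_unique by metis
  have linY: "linear Y" using dY has_derivative_linear by blast
  obtain \<rho> where \<rho>: "\<rho> > 0" "\<And>y. y \<in> ball x \<rho> \<Longrightarrow> closest_point M y \<in> M \<inter> W"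
    using closest_point_near[OF M x(1,2)] by metis
  have cd: "(closest_point M has_derivative P s) (at x)"
    using closest_point_has_derivative[OF M x(1,2)] x(3) by simp
  have vc: "(v has_derivative v') (at (closest_point M x))" using v unfolding closest_point_on[OF x(1)] by (simp add: x_def)
  have cc: "isCont (closest_point M) x" using cd by (rule has_derivative_continuous)
  have "isCont \<kappa> x" using C1on_imp_continuous_on[OF C1_\<kappa>] openW x(2) by (simp add: continuous_on_eq_continuous_at)
  then have "isCont (\<lambda>y. \<kappa> (closest_point M y)) x"
    using isCont_o2[OF cc, of \<kappa>] by (simp add: closest_point_on[OF x(1)])
  \<comment> \<open>Continuity at \<open>x\<close> keeps the coordinates of closest points in
    \<open>B\<close>, where the formula for \<open>v\<close> is available.\<close>
  then have "\<forall>\<^sub>F y in at x. \<kappa> (closest_point M y) \<in> B"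
    using B(1,2) x(3) unfolding isCont_def by (metis closest_point_on topological_tendstoD x(1))
  then obtain \<rho>2 where r2: "\<rho>2 > 0" "\<And>y. y \<noteq> x \<Longrightarrow> dist y x < \<rho>2 \<Longrightarrow> \<kappa> (closest_point M y) \<in> B"
    unfolding eventually_at by auto
  have "((\<lambda>y. v (closest_point M y)) has_derivative (\<lambda>k. v' (P s k))) (at x)"
    by (rule has_derivative_compose[OF cd vc])
  then have "(proj_field TYPE('n) M v has_derivative (\<lambda>k. v' (P s k))) (at x)"
  proof (rule has_derivative_transform_within_open)
    show "open (ball x (min \<rho> \<rho>2))" "x \<in> ball x (min \<rho> \<rho>2)" using \<rho> r2 by auto
    fix y assume y: "y \<in> ball x (min \<rho> \<rho>2)"
    then have c: "closest_point M y \<in> M" "closest_point M y \<in> W" using \<rho> by auto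
    have tB: "\<kappa> (closest_point M y) \<in> B"
      using r2(2)[of y] y B(2) x(3) closest_point_on[OF x(1)] by (cases "y = x") (auto simp: dist_commute)
    let ?t = "\<kappa> (closest_point M y)"
    have t: "?t \<in> V" using c \<kappa>_in by blast
    have "v (\<phi> ?t) = D ?t ((q ?t / J ?t) *\<^sub>R h)" by (simp add: eq[OF tB] linear_cmul[OF linear_D[OF t]])
    then have "P ?t (v (\<phi> ?t)) = v (\<phi> ?t)" by (simp only: P_D[OF t])
    then show "v (closest_point M y) = proj_field TYPE('n) M v y"
      using tangent_proj_eq[OF t, of "v (closest_point M y)"] by (simp add: proj_field_def \<phi>_\<kappa>[OF c])
  qed
  then have "div_E (proj_field TYPE('n) M v) x = (\<Sum>i\<in>Basis. v' (P s i) \<bullet> i)" by (rule div_E_eqI)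
  \<comment> \<open>The trace of \<open>Y \<circ> coords s\<close> on the ambient space is turned
    into the trace of \<open>coords s \<circ> Y\<close> on the coordinate space.\<close>
  also have "\<dots> = (\<Sum>i\<in>Basis. \<Sum>k\<in>UNIV. coords s i $ k * (Y (axis k 1) \<bullet> i))"
  proof (rule sum.cong)
    fix i :: "real^'d"
    have "v' (P s i) = Y (\<Sum>k\<in>UNIV. coords s i $ k *\<^sub>R axis k 1)"
      using basis_expansion[of "coords s i"] by (simp add: P_def vD scalar_mult_eq_scaleR)
    then show "v' (P s i) \<bullet> i = (\<Sum>k\<in>UNIV. coords s i $ k * (Y (axis k 1) \<bullet> i))"
      by (simp add: linear_sum[OF linY] linear_cmul[OF linY] inner_sum_left)
  qed simp
  also have "\<dots> = (\<Sum>k\<in>UNIV. \<Sum>i\<in>Basis. coords s i $ k * (Y (axis k 1) \<bullet> i))" by (rule sum.swap)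
  also have "\<dots> = (\<Sum>k\<in>UNIV. coords s (Y (axis k 1)) $ k)"
  proof (rule sum.cong)
    fix k
    have lc: "linear (coords s)" by (rule linear_coords[OF s])
    have "coords s (Y (axis k 1)) = (\<Sum>i\<in>Basis. (Y (axis k 1) \<bullet> i) *\<^sub>R coords s i)"
      by (subst euclidean_representation[symmetric, of "Y (axis k 1)"]) (simp add: linear_sum[OF lc] linear_cmul[OF lc])
    then show "(\<Sum>i\<in>Basis. coords s i $ k * (Y (axis k 1) \<bullet> i)) = coords s (Y (axis k 1)) $ k"
      by (simp add: sum_component mult.commute)
  qed simp
  also have "\<dots> = (\<Sum>k\<in>UNIV. (q s / J s) * coords s (E (axis k 1)) $ k + a' (axis k 1) * h $ k)"
    by (simp add: Y_def linear_add[OF linear_coords[OF s]] linear_cmul[OF linear_coords[OF s]] coords_D[OF s])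
  also have "\<dots> = (q s / J s) * (\<Sum>k\<in>UNIV. coords s (E (axis k 1)) $ k) + a' h"
  proof -
    have la: "linear a'" using da has_derivative_linear by blast
    have "a' h = a' (\<Sum>k\<in>UNIV. h $ k *\<^sub>R axis k 1)" using basis_expansion[of h] by (simp add: scalar_mult_eq_scaleR)
    then show ?thesis by (simp add: linear_sum[OF la] linear_cmul[OF la] sum.distrib sum_distrib_left mult.commute)
  qed
  also have "(\<Sum>k\<in>UNIV. coords s (E (axis k 1)) $ k) = J' h / J s"
    using J_log_derivative[OF s, of h] J0 by (simp add: J'_def E_def)
  also have "(q s / J s) * (J' h / J s) + a' h = q' h / J s"
    using J0 by (simp add: a'_def divide_inverse)
  finally show ?thesis by (simp add: x_def)
qed

end

section \<open>Compact submanifolds\<close>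

text \<open>Take a linear left inverse L of the derivative at \<open>u0\<close>. The map L after
  \<phi> has derivative the identity there, so the inverse function theorem gives a local inverse g.
  The chart inverse is g after L, defined on an open set of the ambient space because L is linear on
  all of it.\<close>

lemma chart_exists:
  fixes M :: "(real^'d) set" and \<phi> :: "real^'n \<Rightarrow> real^'d"
  assumes \<phi>: "local_param M U \<phi>" and u0: "u0 \<in> U"
  obtains \<kappa> V W where "chart M \<phi> \<kappa> V W" "\<phi> u0 \<in> W"
proof -
  let ?D = "\<lambda>u. frechet_derivative \<phi> (at u)"
  have U: "open U" and sm: "smooth_on U \<phi>" and inj: "\<And>u. u \<in> U \<Longrightarrow> inj (?D u)"
    using \<phi> by (auto simp: local_param_def)
  have "Ck_on (Suc (Suc 0)) U \<phi>" using sm by (auto simp: smooth_on_def)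
  then have d\<phi>: "(\<phi> has_derivative ?D u) (at u)" and cD: "continuous_on U (\<lambda>u. ?D u h)" if "u \<in> U" for u h
    using that by (auto simp: frechet_derivative_works intro!: continuous_at_imp_continuous_on differentiable_imp_continuous_within)
  have linD: "linear (?D u)" if "u \<in> U" for u using d\<phi>[OF that] has_derivative_linear by blast
  obtain L where L: "linear L" "L \<circ> ?D u0 = id"
    using linear_injective_left_inverse[OF linD[OF u0] inj[OF u0]] by blast
  have bL: "bounded_linear L" using L(1) by (simp add: linear_conv_bounded_linear)
  define F where "F = (\<lambda>u. L (\<phi> u))"
  define F' where "F' = (\<lambda>u. Blinfun (\<lambda>h. L (?D u h)))"
  have blin: "bounded_linear (\<lambda>h. L (?D u h))" if "u \<in> U" for u
    using linear_compose[OF linD[OF that] L(1)] by (simp add: o_def linear_conv_bounded_linear)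
  have F'_apply: "blinfun_apply (F' u) = (\<lambda>h. L (?D u h))" if "u \<in> U" for u
    unfolding F'_def using blin[OF that] by (rule bounded_linear_Blinfun_apply)
  have dF: "(F has_derivative blinfun_apply (F' u)) (at u)" if "u \<in> U" for u
    unfolding F_def F'_apply[OF that] by (rule bounded_linear.has_derivative[OF bL d\<phi>[OF that]])
  have cLD: "continuous_on U (\<lambda>u. L (?D u h))" for h
    using bounded_linear.continuous_on[OF bL cD[OF u0]] .
  have cF': "continuous_on U F'"
    by (rule continuous_on_blinfun_componentwise) (use cLD F'_apply in \<open>simp cong: continuous_on_cong\<close>)
  have invF: "id_blinfun o\<^sub>L F' u0 = id_blinfun"
    using fun_cong[OF L(2)] by (intro blinfun_eqI) (simp add: F'_apply[OF u0])
  obtain U' V' g g' where ift: "open U'" "U' \<subseteq> U" "u0 \<in> U'" "open V'" "F u0 \<in> V'" "homeomorphism U' V' F g"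
    "\<And>y. y \<in> V' \<Longrightarrow> (g has_derivative (g' y)) (at y)"
    "\<And>y. y \<in> V' \<Longrightarrow> g' y = inv (blinfun_apply (F' (g y)))"
    "\<And>y. y \<in> V' \<Longrightarrow> bij (blinfun_apply (F' (g y)))"
    using inverse_function_theorem[OF U dF cF' u0 invF] by metis
  have gU: "g y \<in> U'" if "y \<in> V'" for y using ift(6) that by (auto simp: homeomorphism_def)
  have FV: "F u \<in> V'" if "u \<in> U'" for u using ift(6) that by (auto simp: homeomorphism_def)
  have gF: "g (F u) = u" if "u \<in> U'" for u using ift(6) that by (auto simp: homeomorphism_def)
  have cg: "continuous_on V' g" using ift(6) by (auto simp: homeomorphism_def)
  have C1g: "C1on V' g"
  proof (rule C1onI[OF ift(7)])
    fix h :: "real^'n"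
    \<comment> \<open>Cramer's rule exhibits the derivative of \<open>g\<close> as a continuous
      function of the matrix of the derivative of \<open>F\<close>.\<close>
    define A where "A = (\<lambda>y. matrix (\<lambda>h. L (?D (g y) h)))"
    have lin: "linear (\<lambda>h. L (?D (g y) h))" if "y \<in> V'" for y
      using blin[of "g y"] gU[OF that] ift(2) by (auto simp: linear_conv_bounded_linear)
    have nz: "det (A y) \<noteq> 0" if "y \<in> V'" for y
      using ift(9)[OF that] F'_apply[of "g y"] gU[OF that] ift(2) det_nz_iff_inj[OF lin[OF that]]
      by (auto simp: A_def bij_def)
    have eq: "g' y h = cramer_sol (A y) h" if "y \<in> V'" for y
    proof (rule cramer_sol(2)[OF nz[OF that]])
      have *: "blinfun_apply (F' (g y)) = (\<lambda>h. L (?D (g y) h))" using F'_apply[of "g y"] gU[OF that] ift(2) by auto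
      have "blinfun_apply (F' (g y)) (g' y h) = h"
        unfolding ift(8)[OF that] using ift(9)[OF that] by (simp add: bij_is_surj surj_f_inv_f)
      then show "A y *v g' y h = h" unfolding A_def using matrix_vector_mul(2)[OF lin[OF that]] * by metis
    qed
    have "continuous_on V' (\<lambda>y. A y $ i $ j)" for i j
    proof -
      have "continuous_on V' (\<lambda>y. L (?D (g y) (axis j 1)))"
        by (rule continuous_on_compose2[OF cLD cg]) (use gU ift(2) in auto)
      then show ?thesis unfolding A_def matrix_def by (auto intro!: continuous_intros)
    qed
    then have "continuous_on V' (\<lambda>y. cramer_sol (A y) h)"
      by (intro continuous_on_cramer_sol nz) auto
    then show "continuous_on V' (\<lambda>y. g' y h)" using eq by (simp cong: continuous_on_cong)
  qed
  obtain \<psi> where hom: "homeomorphism U (\<phi> ` U) \<phi> \<psi>" using \<phi> by (auto simp: local_param_def)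
  obtain W0 where W0: "open W0" "\<phi> ` U = M \<inter> W0" using \<phi> by (auto simp: local_param_def)
  \<comment> \<open>Since \<phi> is a homeomorphism onto its image, the image of \<open>U'\<close>
    is relatively open, so an ambient open set cuts it out of M and excludes other sheets of M
    nearby.\<close>
  have "openin (top_of_set (\<phi> ` U)) (\<phi> ` U')"
    using homeomorphism_imp_open_map[OF hom] ift(1,2) by (metis openin_open_eq U open_openin openin_subset_trans openin_open_Int Int_absorb1 inf_commute)
  then obtain W1 where W1: "open W1" "\<phi> ` U' = \<phi> ` U \<inter> W1" by (auto simp: openin_open)
  define W where "W = W0 \<inter> W1 \<inter> L -` V'"
  have oW: "open W" unfolding W_def
    using W0 W1 ift(4) continuous_open_vimage[OF ift(4), of L] bounded_linear.continuous[OF bL] linear_continuous_at[OF bL]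
    by (intro open_Int) auto
  have "chart M \<phi> (g \<circ> L) U' W"
  proof
    show "\<phi> ` U' = M \<inter> W"
    proof -
      have "L (\<phi> u) \<in> V'" if "u \<in> U'" for u using FV[OF that] by (simp add: F_def)
      then have "\<phi> ` U' \<subseteq> L -` V'" by auto
      moreover have "\<phi> ` U' = M \<inter> W0 \<inter> W1" using W1(2) W0(2) by simp
      ultimately show ?thesis unfolding W_def by blast
    qed
    show "(g \<circ> L) ` W \<subseteq> U'" using gU by (auto simp: W_def)
    show "(g \<circ> L) (\<phi> s) = s" if "s \<in> U'" for s using gF[OF that] by (simp add: F_def)
    show "smooth_on U' \<phi>" using sm Ck_on_subset[OF _ ift(2)] by (auto simp: smooth_on_def)
    have "C1on W (\<lambda>x. g (L x))"
      by (rule C1on_compose[OF C1g]) (auto simp: W_def intro!: C1on_bounded_linear[OF bL] C1onI[where f' = "\<lambda>_ h. h"])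
    then show "C1on W (g \<circ> L)" by (simp add: o_def)
  qed (use ift(1,2) oW inj in auto)
  moreover have "\<phi> u0 \<in> W"
  proof -
    have "\<phi> u0 \<in> \<phi> ` U'" using ift(3) by blast
    then show ?thesis using W1(2) W0(2) FV[OF ift(3)] by (auto simp: W_def F_def)
  qed
  ultimately show ?thesis using that by blast
qed

lemma submanifold_chart:
  fixes M :: "(real^'d) set"
  assumes "submanifold TYPE('n::finite) M" "p \<in> M"
  obtains \<phi> :: "real^'n \<Rightarrow> real^'d" and \<kappa> V W where "chart M \<phi> \<kappa> V W" "p \<in> W"
proof -
  obtain U and \<phi> :: "real^'n \<Rightarrow> real^'d" where "local_param M U \<phi>" "p \<in> \<phi> ` U"
    using assms unfolding submanifold_def by blast
  then show ?thesis using chart_exists that by (metis imageE)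
qed

section \<open>Uniform limits of divergences on a compact submanifold\<close>

locale compact_submanifold =
  fixes M :: "(real^'d) set" and n_itself :: "'n::finite itself"
  assumes M_compact: "compact M" and M_sub: "submanifold TYPE('n) M"
begin

definition div_M where "div_M v x = div_E (proj_field TYPE('n) M v) x"

lemma chart_at:
  assumes "p \<in> M"
  obtains \<phi> :: "real^'n \<Rightarrow> real^'d" and \<kappa> V W where "chart M \<phi> \<kappa> V W" "p \<in> W"
  using submanifold_chart[OF M_sub assms] .

text \<open>Local constants are nonnegative, so their sum over a finite subcover dominates each of
  them.\<close>

lemma div_stability:
  "\<exists>C\<ge>0. \<forall>x\<in>M. \<forall>v v' w w' B. (v has_derivative v') (at x) \<longrightarrow> (w has_derivative w') (at x) \<longrightarrow>
     norm (v x - w x) \<le> B \<longrightarrow> (\<forall>h. norm (v' h - w' h) \<le> B * norm h) \<longrightarrow>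
     proj_field TYPE('n) M v differentiable (at x) \<and> \<bar>div_M v x - div_M w x\<bar> \<le> C * B"
proof -
  define good where "good = (\<lambda>C x. \<forall>v v' w w' B. (v has_derivative v') (at x) \<longrightarrow> (w has_derivative w') (at x) \<longrightarrow>
     norm (v x - w x) \<le> B \<longrightarrow> (\<forall>h. norm (v' h - w' h) \<le> B * norm h) \<longrightarrow>
     proj_field TYPE('n) M v differentiable (at x) \<and> \<bar>div_M v x - div_M w x\<bar> \<le> C * B)"
  have "\<exists>\<rho>>0. \<exists>C\<ge>0. \<forall>x\<in>M \<inter> ball p \<rho>. good C x" if p: "p \<in> M" for p
  proof -
    obtain \<phi> :: "real^'n \<Rightarrow> real^'d" and \<kappa> V W where ch: "chart M \<phi> \<kappa> V W" "p \<in> W" using chart_at[OF p] by metis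
    from chart.div_stability_local[OF ch(1) M_compact p ch(2)] show ?thesis unfolding good_def div_M_def .
  qed
  then obtain \<rho> C where rC: "\<And>p. p \<in> M \<Longrightarrow> \<rho> p > 0" "\<And>p. p \<in> M \<Longrightarrow> C p \<ge> 0" "\<And>p x. p \<in> M \<Longrightarrow> x \<in> M \<inter> ball p (\<rho> p) \<Longrightarrow> good (C p) x"
    by metis
  obtain T where T: "T \<subseteq> M" "finite T" "M \<subseteq> (\<Union>p\<in>T. ball p (\<rho> p))"
    using compactE_image[OF M_compact, of M "\<lambda>p. ball p (\<rho> p)"] rC(1) by (force intro: centre_in_ball[THEN iffD2])
  have mono: "good C' x" if "good C x" "C \<le> C'" for C C' x
    unfolding good_def
  proof (intro allI impI)
    fix v v' w w' :: "real^'d \<Rightarrow> real^'d" and B :: real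
    assume *: "(v has_derivative v') (at x)" "(w has_derivative w') (at x)" "norm (v x - w x) \<le> B" "\<forall>h. norm (v' h - w' h) \<le> B * norm h"
    then have "B \<ge> 0" using norm_ge_zero order_trans by blast
    then have "C * B \<le> C' * B" by (rule mult_right_mono[OF that(2)])
    then show "proj_field TYPE('n) M v differentiable (at x) \<and> \<bar>div_M v x - div_M w x\<bar> \<le> C' * B"
      using that(1) * unfolding good_def by (meson order_trans)
  qed
  have "good (\<Sum>p\<in>T. C p) x" if x: "x \<in> M" for x
  proof -
    obtain p where p: "p \<in> T" "x \<in> ball p (\<rho> p)" using T(3) x by blast
    have "C p \<le> (\<Sum>p\<in>T. C p)" using p T rC(2) by (intro member_le_sum) auto
    then show ?thesis using mono rC(3) p x T(1) by blast
  qed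
  moreover have "(\<Sum>p\<in>T. C p) \<ge> 0" using rC(2) T(1) by (intro sum_nonneg) auto
  ultimately show ?thesis unfolding good_def by blast
qed

lemma div_M_linear:
  assumes x: "x \<in> M" and v: "(v has_derivative v') (at x)" and w: "(w has_derivative w') (at x)"
  shows "div_M (\<lambda>z. a *\<^sub>R v z + w z) x = a * div_M v x + div_M w x"
proof -
  obtain \<phi> :: "real^'n \<Rightarrow> real^'d" and \<kappa> V W where ch: "chart M \<phi> \<kappa> V W" "x \<in> W" using chart_at[OF x] by metis
  interpret chart M \<phi> \<kappa> V W by fact
  have s: "\<kappa> x \<in> V" using ch(2) \<kappa>_in by blast
  have d: "((\<lambda>z. a *\<^sub>R v z + w z) has_derivative (\<lambda>h. a *\<^sub>R v' h + w' h)) (at x)"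
    by (intro has_derivative_add has_derivative_scaleR_right v w)
  show ?thesis
    unfolding div_M_def div_proj_field[OF M_compact x ch(2) d] div_proj_field[OF M_compact x ch(2) v] div_proj_field[OF M_compact x ch(2) w]
    by (simp add: linear_add[OF linear_P[OF s]] linear_cmul[OF linear_P[OF s]] inner_add_left inner_add_right sum.distrib sum_distrib_left algebra_simps)
qed

lemma div_M_zero:
  assumes x: "x \<in> M" and v: "(v has_derivative (\<lambda>_. 0)) (at x)" "v x = 0"
  shows "div_M v x = 0"
proof -
  obtain \<phi> :: "real^'n \<Rightarrow> real^'d" and \<kappa> V W where ch: "chart M \<phi> \<kappa> V W" "x \<in> W" using chart_at[OF x] by metis
  interpret chart M \<phi> \<kappa> V W by fact
  show ?thesis
    unfolding div_M_def div_proj_field[OF M_compact x ch(2) v(1)]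
    using linear_0[OF linear_P[OF \<kappa>_in[OF ch(2)]]] v(2) by simp
qed

text \<open>Tangency is not demanded, since \<open>proj_field\<close> projects; the bounded support
  is what \<open>mlp_C1_dense\<close> asks for.\<close>

definition field :: "(real^'d \<Rightarrow> real^'d) \<Rightarrow> bool" where
  "field v \<longleftrightarrow> C1on UNIV v \<and> (\<exists>a b. \<forall>x. x \<notin> cbox a b \<longrightarrow> v x = 0)"

text \<open>The uniform closure on M of the divergences of projected fields. Its elements are
  functions on the whole space of which only the restriction to M matters.\<close>

definition div_limits :: "(real^'d \<Rightarrow> real) set" where
  "div_limits = {f. \<forall>\<epsilon>>0. \<exists>v. field v \<and> (\<forall>x\<in>M. \<bar>f x - div_M v x\<bar> \<le> \<epsilon>)}"

lemma divsE:
  assumes "f \<in> div_limits" "\<epsilon> > 0"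
  obtains v where "field v" "\<And>x. x \<in> M \<Longrightarrow> \<bar>f x - div_M v x\<bar> \<le> \<epsilon>"
proof -
  have "\<exists>v. field v \<and> (\<forall>x\<in>M. \<bar>f x - div_M v x\<bar> \<le> \<epsilon>)" using assms by (simp add: div_limits_def)
  then show ?thesis using that by blast
qed

lemma field_linear:
  assumes "field v" "field w"
  shows "field (\<lambda>z. a *\<^sub>R v z + w z)"
proof -
  obtain l u l' u' where b: "\<And>x. x \<notin> cbox l u \<Longrightarrow> v x = 0" "\<And>x. x \<notin> cbox l' u' \<Longrightarrow> w x = 0"
    using assms unfolding field_def by blast
  have "bounded (cbox l u \<union> cbox l' u')" by simp
  then obtain c where c: "cbox l u \<union> cbox l' u' \<subseteq> cbox (-c) c" using bounded_subset_cbox_symmetric by blast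
  have "a *\<^sub>R v x + w x = 0" if "x \<notin> cbox (-c) c" for x
  proof -
    have "x \<notin> cbox l u" "x \<notin> cbox l' u'" using c that by blast+
    then show ?thesis using b by simp
  qed
  then have "\<forall>x. x \<notin> cbox (-c) c \<longrightarrow> a *\<^sub>R v x + w x = 0" by blast
  moreover have "C1on UNIV (\<lambda>z. a *\<^sub>R v z + w z)"
    using assms by (auto simp: field_def intro!: C1on_add C1on_scaleR C1on_const)
  ultimately show ?thesis unfolding field_def by blast
qed

lemma field_deriv: "field v \<Longrightarrow> (v has_derivative frechet_derivative v (at x)) (at x)"
  unfolding field_def using C1on_frechet(1) by blast

lemma div_limits_linear:
  assumes "f \<in> div_limits" "g \<in> div_limits"
  shows "(\<lambda>x. a * f x + g x) \<in> div_limits"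
  unfolding div_limits_def
proof (intro CollectI allI impI)
  fix \<epsilon> :: real assume e: "\<epsilon> > 0"
  define \<delta> where "\<delta> = \<epsilon> / (\<bar>a\<bar> + 1)"
  have "\<bar>a\<bar> + 1 > 0" by (simp add: add_nonneg_pos)
  then have d: "\<delta> > 0" "(\<bar>a\<bar> + 1) * \<delta> = \<epsilon>" using e by (auto simp: \<delta>_def)
  obtain v where v: "field v" "\<And>x. x \<in> M \<Longrightarrow> \<bar>f x - div_M v x\<bar> \<le> \<delta>" using assms(1) d(1) unfolding div_limits_def by blast
  obtain w where w: "field w" "\<And>x. x \<in> M \<Longrightarrow> \<bar>g x - div_M w x\<bar> \<le> \<delta>" using assms(2) d(1) unfolding div_limits_def by blast
  have "\<bar>(a * f x + g x) - div_M (\<lambda>z. a *\<^sub>R v z + w z) x\<bar> \<le> \<epsilon>" if x: "x \<in> M" for x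
  proof -
    have "(a * f x + g x) - div_M (\<lambda>z. a *\<^sub>R v z + w z) x = a * (f x - div_M v x) + (g x - div_M w x)"
      unfolding div_M_linear[OF x field_deriv[OF v(1)] field_deriv[OF w(1)]] by (simp add: algebra_simps)
    also have "\<bar>\<dots>\<bar> \<le> \<bar>a\<bar> * \<bar>f x - div_M v x\<bar> + \<bar>g x - div_M w x\<bar>" by (metis abs_mult abs_triangle_ineq)
    also have "\<dots> \<le> \<bar>a\<bar> * \<delta> + \<delta>" using v(2)[OF x] w(2)[OF x] by (intro add_mono mult_left_mono) auto
    finally show ?thesis using d(2) by (simp add: algebra_simps)
  qed
  then show "\<exists>v. field v \<and> (\<forall>x\<in>M. \<bar>(a * f x + g x) - div_M v x\<bar> \<le> \<epsilon>)"
    using field_linear[OF v(1) w(1)] by blast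
qed

lemma div_limits_zero: "(\<lambda>x. 0) \<in> div_limits"
proof -
  have "field (\<lambda>x. 0)" by (auto simp: field_def intro: C1on_const)
  moreover have "div_M (\<lambda>x. 0) x = 0" if "x \<in> M" for x using div_M_zero[OF that] by simp
  ultimately show ?thesis unfolding div_limits_def by force
qed

lemma div_limits_sum:
  assumes "finite I" "\<And>i. i \<in> I \<Longrightarrow> f i \<in> div_limits"
  shows "(\<lambda>x. \<Sum>i\<in>I. a i * f i x) \<in> div_limits"
  using assms
proof (induction I rule: finite_induct)
  case (insert i I)
  then show ?case using div_limits_linear[of "f i" "\<lambda>x. \<Sum>i\<in>I. a i * f i x" "a i"] by simp
qed (simp add: div_limits_zero)

lemma div_limits_closed:
  assumes "\<And>\<epsilon>. \<epsilon> > 0 \<Longrightarrow> \<exists>g\<in>div_limits. \<forall>x\<in>M. \<bar>f x - g x\<bar> \<le> \<epsilon>"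
  shows "f \<in> div_limits"
  unfolding div_limits_def
proof (intro CollectI allI impI)
  fix \<epsilon> :: real assume e: "\<epsilon> > 0"
  obtain g where g: "g \<in> div_limits" "\<And>x. x \<in> M \<Longrightarrow> \<bar>f x - g x\<bar> \<le> \<epsilon> / 2" using assms[of "\<epsilon> / 2"] e by auto
  obtain v where v: "field v" "\<And>x. x \<in> M \<Longrightarrow> \<bar>g x - div_M v x\<bar> \<le> \<epsilon> / 2"
    using divsE[OF g(1), of "\<epsilon> / 2"] e by auto
  have "\<bar>f x - div_M v x\<bar> \<le> \<epsilon>" if "x \<in> M" for x using g(2)[OF that] v(2)[OF that] by linarith
  then show "\<exists>v. field v \<and> (\<forall>x\<in>M. \<bar>f x - div_M v x\<bar> \<le> \<epsilon>)" using v(1) by blast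
qed

text \<open>The divergence is stable under C1 perturbation with one constant for all of M, so a
  network C1-close to the field suffices. Two errors of a third each leave room for the strict
  inequality.\<close>

lemma div_limits_mlp:
  assumes f: "f \<in> div_limits" and \<sigma>: "smooth_real_fun \<sigma>" "nonpoly \<sigma>" and e: "\<epsilon> > 0"
  shows "\<exists>v. mlp \<sigma> v \<and> (\<forall>x\<in>M. proj_field TYPE('n) M v differentiable (at x) \<and> \<bar>f x - div_M v x\<bar> < \<epsilon>)"
proof -
  obtain C where C: "C \<ge> 0" "\<And>x v v' w w' B. x \<in> M \<Longrightarrow> (v has_derivative v') (at x) \<Longrightarrow> (w has_derivative w') (at x) \<Longrightarrow>
     norm (v x - w x) \<le> B \<Longrightarrow> (\<forall>h. norm (v' h - w' h) \<le> B * norm h) \<Longrightarrow>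
     proj_field TYPE('n) M v differentiable (at x) \<and> \<bar>div_M v x - div_M w x\<bar> \<le> C * B"
    using div_stability by blast
  obtain v where v: "field v" "\<And>x. x \<in> M \<Longrightarrow> \<bar>f x - div_M v x\<bar> \<le> \<epsilon> / 3"
    using divsE[OF f, of "\<epsilon> / 3"] e by auto
  obtain a b where ab: "\<And>x. x \<notin> cbox a b \<Longrightarrow> v x = 0" and C1v: "C1on UNIV v" using v(1) unfolding field_def by blast
  define \<delta> where "\<delta> = \<epsilon> / (3 * (C + 1))"
  have d: "\<delta> > 0" using e C(1) by (simp add: \<delta>_def)
  have "C * \<delta> \<le> (C + 1) * \<delta>" using d by simp
  also have "\<dots> = \<epsilon> / 3" using C(1) by (simp add: \<delta>_def field_simps)
  finally have Cd: "C * \<delta> \<le> \<epsilon> / 3" .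
  obtain w w' where w: "mlp \<sigma> w" "\<And>x. (w has_derivative w' x) (at x)"
    "\<And>x. x \<in> M \<Longrightarrow> norm (v x - w x) \<le> \<delta>"
    "\<And>x h. x \<in> M \<Longrightarrow> norm (frechet_derivative v (at x) h - w' x h) \<le> \<delta> * norm h"
    using mlp_C1_dense[OF \<sigma> M_compact C1on_frechet(1)[OF C1v UNIV_I] C1on_frechet(2)[OF C1v] ab d] by metis
  have "proj_field TYPE('n) M w differentiable (at x) \<and> \<bar>f x - div_M w x\<bar> < \<epsilon>" if x: "x \<in> M" for x
  proof -
    have "norm (w x - v x) \<le> \<delta>" using w(3)[OF x] by (simp add: norm_minus_commute)
    moreover have "\<forall>h. norm (w' x h - frechet_derivative v (at x) h) \<le> \<delta> * norm h"
      using w(4)[OF x] by (simp add: norm_minus_commute)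
    ultimately have "proj_field TYPE('n) M w differentiable (at x) \<and> \<bar>div_M w x - div_M v x\<bar> \<le> C * \<delta>"
      by (rule C(2)[OF x w(2) field_deriv[OF v(1)]])
    moreover have "\<bar>f x - div_M w x\<bar> < \<epsilon>" if "\<bar>div_M w x - div_M v x\<bar> \<le> C * \<delta>"
      using that v(2)[OF x] Cd e by linarith
    ultimately show ?thesis by blast
  qed
  then show ?thesis using w(1) by blast
qed

end

section \<open>Divergences supported in a chart\<close>

text \<open>The inner squared positive part is at least 9 on the ball of radius \<open>R\<close>,
  where 4 - 1 = 3, and 0 beyond \<open>2 * R\<close>. After division by 9 the outer one flattens
  these values, so the result is exactly 1 and 0 there and C1 in between.\<close>

definition cutoff :: "'a::euclidean_space \<Rightarrow> real \<Rightarrow> 'a \<Rightarrow> real" where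
  "cutoff p R x = 1 - (max 0 (1 - (max 0 (4 - (x - p) \<bullet> (x - p) / R\<^sup>2))\<^sup>2 / 9))\<^sup>2"

lemma cutoff_C1: "C1on UNIV (cutoff p R)"
proof -
  have *: "C1on UNIV (\<lambda>x. (max 0 (f x))\<^sup>2)" if "C1on UNIV f" for f :: "'a \<Rightarrow> real"
    by (rule C1on_real_compose[OF that _ DERIV_pos_part_square, where T = UNIV]) (auto intro!: continuous_intros)
  have id: "C1on UNIV (\<lambda>x::'a. x)" by (rule C1onI[where f' = "\<lambda>_ h. h"]) auto
  have sub: "C1on UNIV (\<lambda>x. c - f x / d)" if "C1on UNIV f" for f :: "'a \<Rightarrow> real" and c d
    using C1on_add[OF C1on_const[of UNIV c] C1on_mult[OF that C1on_const[of UNIV "- inverse d"]]]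
    by (simp add: divide_inverse)
  have "C1on UNIV (\<lambda>x::'a. x - p)"
    using C1on_add[OF id C1on_const[of UNIV "-p"]] by simp
  then have "C1on UNIV (\<lambda>x. (x - p) \<bullet> (x - p))" by (intro C1on_inner)
  from sub[OF *[OF sub[OF *[OF sub[OF this, of 4 "R\<^sup>2"]], of 1 9]], of 1 1]
  show ?thesis by (simp only: cutoff_def[abs_def] div_by_1)
qed

lemma cutoff_1:
  assumes "x \<in> cball p R" "R > 0" shows "cutoff p R x = 1"
proof -
  have "(x - p) \<bullet> (x - p) \<le> R\<^sup>2"
    using assms by (simp add: dist_norm norm_minus_commute dot_square_norm power_mono)
  then have "(x - p) \<bullet> (x - p) / R\<^sup>2 \<le> 1" using assms by (simp add: divide_le_eq)
  then have "4 - (x - p) \<bullet> (x - p) / R\<^sup>2 \<ge> 3" by simp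
  then have "(max 0 (4 - (x - p) \<bullet> (x - p) / R\<^sup>2))\<^sup>2 \<ge> 3\<^sup>2" by (intro power_mono) auto
  then show ?thesis by (simp add: cutoff_def)
qed

lemma cutoff_0:
  assumes "x \<notin> ball p (2 * R)" "R > 0" shows "cutoff p R x = 0"
proof -
  have "(2 * R)\<^sup>2 \<le> (x - p) \<bullet> (x - p)"
    using assms unfolding dot_square_norm by (intro power_mono) (auto simp: dist_norm norm_minus_commute)
  then have "(x - p) \<bullet> (x - p) / R\<^sup>2 \<ge> 4" using assms by (simp add: le_divide_eq power_mult_distrib)
  then show ?thesis by (simp add: cutoff_def)
qed

lemma C1on_Un:
  assumes "C1on S f" "C1on T f" "open S" "open T"
  shows "C1on (S \<union> T) f"
  using assms
  by (intro C1onI[where f' = "\<lambda>x. frechet_derivative f (at x)"])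
    (auto intro: C1on_frechet continuous_on_open_Un)

text \<open>A primitive along \<open>h\<close>: the derivative in direction \<open>h\<close> is the
  bump at the start of the segment minus the bump at its end.\<close>

definition bump_path :: "real \<Rightarrow> 'a::euclidean_space \<Rightarrow> 'a \<Rightarrow> 'a \<Rightarrow> real" where
  "bump_path \<epsilon> c h s = integral (cbox 0 1) (\<lambda>t. bump \<epsilon> (s - (c + t *\<^sub>R h)))"

lemma bump_path_GDERIV:
  "GDERIV (bump_path \<epsilon> c h) s :> integral (cbox 0 1) (\<lambda>t. bump' \<epsilon> (s - (c + t *\<^sub>R h)))"
  unfolding bump_path_def[abs_def]
proof (rule GDERIV_integral)
  show "GDERIV (\<lambda>s. bump \<epsilon> (s - (c + t *\<^sub>R h))) s :> bump' \<epsilon> (s - (c + t *\<^sub>R h))" for s and t :: real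
    by (rule GDERIV_diff_arg[OF bump_C1(1)])
  show "continuous_on (UNIV \<times> cbox 0 1) (\<lambda>(s, t). bump' \<epsilon> (s - (c + t *\<^sub>R h)))"
    unfolding split_beta by (rule continuous_on_compose2[OF bump_C1(2)[of UNIV]]) (auto intro!: continuous_intros)
  show "continuous_on (cbox 0 1) (\<lambda>t. bump \<epsilon> (s - (c + t *\<^sub>R h)))" for s
    by (rule continuous_on_compose2[OF bump_C1(3)[of UNIV]]) (auto intro!: continuous_intros)
qed

lemma C1on_GDERIV:
  assumes "\<And>x. x \<in> S \<Longrightarrow> GDERIV f x :> F x" "continuous_on S F"
  shows "C1on S f"
  by (rule C1onI[where f' = "\<lambda>x h. h \<bullet> F x"])
    (use assms in \<open>auto simp: gderiv_def intro!: continuous_intros\<close>)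

lemma bump_path_C1: "C1on UNIV (bump_path \<epsilon> c h)"
proof (rule C1on_GDERIV[OF bump_path_GDERIV])
  show "continuous_on UNIV (\<lambda>s. integral (cbox 0 1) (\<lambda>t::real. bump' \<epsilon> (s - (c + t *\<^sub>R h))))"
  proof (rule integral_continuous_on_param)
    show "continuous_on (UNIV \<times> cbox 0 1) (\<lambda>(s, t::real). bump' \<epsilon> (s - (c + t *\<^sub>R h)))"
      unfolding split_beta by (rule continuous_on_compose2[OF bump_C1(2)[of UNIV]]) (auto intro!: continuous_intros)
  qed
qed

lemma bump_path_derivative:
  "frechet_derivative (bump_path \<epsilon> c h) (at s) h = bump \<epsilon> (s - c) - bump \<epsilon> (s - (c + h))"
proof -
  let ?F = "\<lambda>t::real. bump' \<epsilon> (s - (c + t *\<^sub>R h))"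
  have cont: "continuous_on (cbox 0 1) ?F"
    by (rule continuous_on_compose2[OF bump_C1(2)[of UNIV]]) (auto intro!: continuous_intros)
  have "frechet_derivative (bump_path \<epsilon> c h) (at s) = (\<lambda>k. k \<bullet> integral (cbox 0 1) ?F)"
    using frechet_derivative_at[OF bump_path_GDERIV[unfolded gderiv_def]] by (rule sym)
  then have "frechet_derivative (bump_path \<epsilon> c h) (at s) h = integral (cbox 0 1) (\<lambda>t. h \<bullet> ?F t)"
    using integral_linear[OF integrable_continuous[OF cont] bounded_linear_inner_right[of h]] by (simp add: o_def)
  \<comment> \<open>The fundamental theorem in \<open>t\<close>; moving the centre along
    \<open>h\<close> moves the argument of the bump backwards, hence the minus signs.\<close>
  moreover have "((\<lambda>t. h \<bullet> ?F t) has_integral (- bump \<epsilon> (s - (c + 1 *\<^sub>R h)) - - bump \<epsilon> (s - (c + 0 *\<^sub>R h)))) {0..1}"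
  proof (rule fundamental_theorem_of_calculus)
    fix t :: real
    have "((\<lambda>t. s - (c + t *\<^sub>R h)) has_derivative (\<lambda>u. - (u *\<^sub>R h))) (at t within {0..1})"
      by (auto intro!: derivative_eq_intros)
    from has_derivative_compose[OF this bump_C1(1)[unfolded gderiv_def]]
    have "((\<lambda>t. bump \<epsilon> (s - (c + t *\<^sub>R h))) has_derivative (\<lambda>u. - (u *\<^sub>R h) \<bullet> ?F t)) (at t within {0..1})" .
    from has_derivative_minus[OF this]
    show "((\<lambda>t. - bump \<epsilon> (s - (c + t *\<^sub>R h))) has_vector_derivative h \<bullet> ?F t) (at t within {0..1})"
      by (simp add: has_vector_derivative_def)
  qed simp
  ultimately show ?thesis by (simp add: integral_unique)
qed

lemma bump_path_outside:
  assumes "\<epsilon> > 0" "\<And>t. 0 \<le> t \<Longrightarrow> t \<le> 1 \<Longrightarrow> s - (c + t *\<^sub>R h) \<notin> cube \<epsilon>"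
  shows "bump_path \<epsilon> c h s = 0"
proof -
  have "bump_path \<epsilon> c h s = integral (cbox 0 1) (\<lambda>t::real. 0)"
    unfolding bump_path_def using assms bump_outside by (intro integral_cong) auto
  then show ?thesis by simp
qed

lemma norm_cube: "x \<in> cube \<epsilon> \<Longrightarrow> \<epsilon> > 0 \<Longrightarrow> norm (x :: 'a::euclidean_space) \<le> \<epsilon> * norm (One :: 'a)"
proof -
  assume x: "x \<in> cube \<epsilon>" and e: "\<epsilon> > 0"
  have "norm x \<le> norm (\<epsilon> *\<^sub>R One :: 'a)"
    using x e by (intro norm_le_componentwise) (force simp: mem_box)
  then show ?thesis using e by simp
qed

text \<open>The coordinate field extends to the ambient space by composition with \<kappa> and
  multiplication by a cutoff that is 1 on the image of \<open>B\<close>, so the formula for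
  tangential fields applies there. Elsewhere on M the field vanishes near the point,
  \<open>q\<close> being zero off the closed set \<open>K\<close> inside \<open>B\<close>.\<close>

lemma (in compact_submanifold) chart_field_divergence:
  fixes \<phi> :: "real^'n \<Rightarrow> real^'d"
  assumes ch: "chart M \<phi> \<kappa> V W" and R: "R > 0" "cball p (2 * R) \<subseteq> W"
    and B: "open B" "B \<subseteq> V" "\<phi> ` B \<subseteq> ball p R" and K: "closed K" "K \<subseteq> B"
    and q: "C1on UNIV q" "\<And>s. s \<notin> K \<Longrightarrow> q s = 0"
  shows "\<exists>v. field v \<and> (\<forall>x\<in>M. div_M v x =
     (if x \<in> \<phi> ` B then frechet_derivative q (at (\<kappa> x)) h / chart.J \<phi> (\<kappa> x) else 0))"
proof -
  interpret chart M \<phi> \<kappa> V W by fact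
  define v where "v = (\<lambda>x. if x \<in> W then (cutoff p R x * q (\<kappa> x) / J (\<kappa> x)) *\<^sub>R D (\<kappa> x) h else 0)"
  have "C1on W v"
  proof (rule C1on_cong[OF _ openW])
    have Jn: "J (\<kappa> x) \<noteq> 0" if "x \<in> W" for x using J_pos[OF \<kappa>_in[OF that]] by simp
    show "C1on W (\<lambda>x. (cutoff p R x * q (\<kappa> x) / J (\<kappa> x)) *\<^sub>R D (\<kappa> x) h)"
      by (intro C1on_scaleR C1on_divide C1on_mult C1on_subset[OF cutoff_C1 subset_UNIV] Jn
          C1on_compose[OF q(1) C1_\<kappa> subset_UNIV] C1on_compose[OF C1_J C1_\<kappa> \<kappa>_image] C1on_compose[OF C1_D C1_\<kappa> \<kappa>_image])
    show "(cutoff p R x * q (\<kappa> x) / J (\<kappa> x)) *\<^sub>R D (\<kappa> x) h = v x" if "x \<in> W" for x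
      using that by (simp add: v_def)
  qed
  moreover have out: "v x = 0" if "x \<notin> ball p (2 * R)" for x
    using cutoff_0[OF that R(1)] by (simp add: v_def)
  moreover have "C1on (- cball p (2 * R)) v"
    by (rule C1on_cong[OF C1on_const[of _ 0]]) (use out in auto)
  ultimately have "C1on (W \<union> - cball p (2 * R)) v"
    by (intro C1on_Un openW) (auto simp: open_Compl)
  moreover have "W \<union> - cball p (2 * R) = UNIV" using R by auto
  ultimately have C1v: "C1on UNIV v" by simp
  obtain c where c: "ball p (2 * R) \<subseteq> cbox (-c) c" using bounded_subset_cbox_symmetric[OF bounded_ball] by blast
  have "\<forall>x. x \<notin> cbox (-c) c \<longrightarrow> v x = 0" using c out by blast
  then have fv: "field v" unfolding field_def using C1v by blast
  have "div_M v x = (if x \<in> \<phi> ` B then frechet_derivative q (at (\<kappa> x)) h / J (\<kappa> x) else 0)" if x: "x \<in> M" for x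
  proof (cases "x \<in> \<phi> ` B")
    case True
    then obtain s where s: "s \<in> B" "x = \<phi> s" by blast
    have sV: "s \<in> V" using s B by blast
    have eq: "v (\<phi> t) = (q t / J t) *\<^sub>R D t h" if "t \<in> B" for t
    proof -
      have "t \<in> V" using that B by blast
      moreover have "\<phi> t \<in> cball p R" using that B(3) by (auto simp: subset_iff less_imp_le)
      then have "cutoff p R (\<phi> t) = 1" using R(1) by (rule cutoff_1)
      ultimately show ?thesis using \<phi>_in(2)[of t] \<kappa>_\<phi>[of t] by (simp add: v_def)
    qed
    have "div_E (proj_field TYPE('n) M v) (\<phi> s) = frechet_derivative q (at s) h / J s"
      by (rule div_proj_field_tangential[OF M_compact sV field_deriv[OF fv] B(1) s(1) B(2) eq C1on_frechet(1)[OF q(1) UNIV_I]])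
    then show ?thesis using True s \<kappa>_\<phi>[OF sV] by (simp add: div_M_def)
  next
    case False
    \<comment> \<open>Either \<kappa> is defined at \<open>x\<close> and avoids the closed set
      \<open>K\<close> nearby, or \<open>x\<close> lies outside the support of the cutoff.\<close>
    have "\<exists>O'. open O' \<and> x \<in> O' \<and> (\<forall>y\<in>O'. v y = 0)"
    proof (cases "x \<in> W")
      case True
      have "\<kappa> x \<notin> K" using K(2) False \<phi>_\<kappa>[OF x True] by (metis image_eqI subsetD)
      moreover have "open (W \<inter> \<kappa> -` (- K))"
        using C1on_imp_continuous_on[OF C1_\<kappa>] openW K(1) by (simp add: continuous_on_open_vimage Int_commute open_Compl)
      moreover have "v y = 0" if "y \<in> W \<inter> \<kappa> -` (- K)" for y using q(2)[of "\<kappa> y"] that by (simp add: v_def)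
      ultimately show ?thesis using True by (intro exI[of _ "W \<inter> \<kappa> -` (- K)"]) auto
    next
      case False
      then show ?thesis using R out by (intro exI[of _ "- cball p (2 * R)"]) (auto simp: open_Compl)
    qed
    then obtain O' where O': "open O'" "x \<in> O'" "\<And>y. y \<in> O' \<Longrightarrow> v y = 0" by blast
    have "(v has_derivative (\<lambda>_. 0)) (at x)"
      by (rule has_derivative_transform_within_open[OF has_derivative_const O'(1,2)]) (simp add: O'(3))
    then have "div_M v x = 0" using div_M_zero[OF x] O' by blast
    then show ?thesis using False by simp
  qed
  then show ?thesis using fv by blast
qed

text \<open>In coordinates \<open>g\<close> times \<open>J\<close> is mollified, and the convolution
  is replaced by a finite sum of bumps. The weights sum to 0, so the same bump at \<open>s0\<close>
  may be subtracted from each of them; every difference is the derivative of a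
  \<open>bump_path\<close> along its segment, and dividing by \<open>J\<close> yields
  divergences.\<close>

lemma (in compact_submanifold) patch_exists:
  assumes p: "p \<in> M"
  obtains \<phi> :: "real^'n \<Rightarrow> real^'d" and \<kappa> V W a b N where "chart M \<phi> \<kappa> V W" "cbox a b \<subseteq> V" "box a b \<noteq> {}" "open N" "p \<in> N"
    "N \<subseteq> W" "M \<inter> N \<subseteq> \<phi> ` cbox a b"
    "\<And>g. continuous_on M g \<Longrightarrow> (\<And>x. x \<in> M \<Longrightarrow> x \<notin> N \<Longrightarrow> g x = 0) \<Longrightarrow>
       integral (cbox a b) (\<lambda>s. g (\<phi> s) * chart.J \<phi> s) = 0 \<Longrightarrow> g \<in> div_limits"
proof -
  obtain \<phi> :: "real^'n \<Rightarrow> real^'d" and \<kappa> V W where ch: "chart M \<phi> \<kappa> V W" "p \<in> W" using chart_at[OF p] by metis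
  interpret chart M \<phi> \<kappa> V W by fact
  obtain R where R: "R > 0" "cball p (2 * R) \<subseteq> W"
  proof -
    obtain R where "R > 0" "cball p R \<subseteq> W" using openW ch(2) open_contains_cball by blast
    then show ?thesis using that[of "R / 2"] by simp
  qed
  define s0 where "s0 = \<kappa> p"
  have s0: "s0 \<in> V" "\<phi> s0 = p" using \<kappa>_in \<phi>_\<kappa> ch(2) p by (auto simp: s0_def)
  have "open (V \<inter> \<phi> -` ball p R)"
    using C1on_imp_continuous_on[OF C1_\<phi>] openV by (simp add: continuous_on_open_vimage Int_commute)
  moreover have "s0 \<in> V \<inter> \<phi> -` ball p R" using s0 R by simp
  ultimately obtain r where r: "r > 0" "ball s0 r \<subseteq> V \<inter> \<phi> -` ball p R" using open_contains_ball by blast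
  define B where "B = ball s0 r"
  have B: "open B" "B \<subseteq> V" "\<phi> ` B \<subseteq> ball p R" using r by (auto simp: B_def)
  \<comment> \<open>Nested sizes: the box lies within r/2 of \<open>s0\<close>, bumps of radius r/4
    centred there stay in the ball \<open>K\<close> of radius 3r/4, and \<open>K\<close> lies in the
    ball \<open>B\<close> of radius r.\<close>
  define \<rho> where "\<rho> = r / 2 / norm (One :: real^'n)"
  have One0: "norm (One :: real^'n) > 0" by simp
  have \<rho>: "\<rho> > 0" "\<rho> * norm (One :: real^'n) = r / 2" using r One0 by (auto simp: \<rho>_def)
  define a where "a = s0 - \<rho> *\<^sub>R One"
  define b where "b = s0 + \<rho> *\<^sub>R One"
  have Q: "norm (s - s0) \<le> r / 2" if "s \<in> cbox a b" for s
  proof -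
    have "s - s0 \<in> cube \<rho>" using that by (auto simp: a_def b_def mem_box algebra_simps)
    then show ?thesis using norm_cube[of "s - s0" \<rho>] \<rho> by simp
  qed
  have QB: "cbox a b \<subseteq> B" using Q r(1) by (force simp: B_def dist_norm norm_minus_commute)
  have s0Q: "s0 \<in> box a b" using \<rho>(1) by (auto simp: a_def b_def mem_box algebra_simps)
  define N where "N = W \<inter> \<kappa> -` box a b"
  have oN: "open N" unfolding N_def
    using C1on_imp_continuous_on[OF C1_\<kappa>] openW by (simp add: continuous_on_open_vimage Int_commute open_box)
  have pN: "p \<in> N" using ch(2) s0Q by (simp add: N_def s0_def)
  have MN: "M \<inter> N \<subseteq> \<phi> ` cbox a b"
  proof
    fix x assume x: "x \<in> M \<inter> N"
    then have "x = \<phi> (\<kappa> x)" "\<kappa> x \<in> cbox a b" using \<phi>_\<kappa>[of x] box_subset_cbox by (auto simp: N_def)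
    then show "x \<in> \<phi> ` cbox a b" by blast
  qed
  have main: "g \<in> div_limits" if g: "continuous_on M g" "\<And>x. x \<in> M \<Longrightarrow> x \<notin> N \<Longrightarrow> g x = 0"
    and int0: "integral (cbox a b) (\<lambda>s. g (\<phi> s) * J s) = 0" for g
  proof -
    have QV: "cbox a b \<subseteq> V" using QB B by blast
    define G where "G = (\<lambda>s. if s \<in> cbox a b then g (\<phi> s) * J s else 0)"
    have gV: "g (\<phi> s) = 0" if "s \<in> V" "s \<notin> cbox a b" for s
      using g(2)[OF \<phi>_in(1)[OF that(1)]] \<kappa>_\<phi>[OF that(1)] that(2) box_subset_cbox by (auto simp: N_def)
    have cgV: "continuous_on V (\<lambda>s. g (\<phi> s) * J s)"
      by (intro continuous_on_mult continuous_on_compose2[OF g(1) C1on_imp_continuous_on[OF C1_\<phi>]]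
          C1on_imp_continuous_on[OF C1_J]) (auto simp: \<phi>_in)
    \<comment> \<open>On \<open>V\<close> the function vanishes off the box by itself, because
      \<open>g\<close> vanishes off \<open>N\<close>; so extension by zero is continuous
      everywhere.\<close>
    have "continuous_on V G"
      by (rule continuous_on_eq[OF cgV]) (simp add: G_def gV)
    moreover have "continuous_on (- cbox a b) G"
      by (rule continuous_on_eq[OF continuous_on_const[of _ 0]]) (simp add: G_def)
    ultimately have "continuous_on (V \<union> - cbox a b) G"
      by (intro continuous_on_open_Un openV) (auto simp: open_Compl closed_cbox)
    moreover have "V \<union> - cbox a b = UNIV" using QV by auto
    ultimately have cG: "continuous_on UNIV G" by simp
    have suppG: "G s = 0" if "s \<notin> cbox a b" for s using that by (simp add: G_def)
    have intG: "integral (cbox a b) G = 0"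
      using int0 by (simp add: G_def cong: integral_cong)
    define K where "K = cball s0 (3 * r / 4)"
    have KB: "K \<subseteq> B" "K \<subseteq> V" using r(1) B by (auto simp: K_def B_def)
    \<comment> \<open>A positive lower bound for \<open>J\<close> on the compact \<open>K\<close>
      transfers errors from \<open>G\<close> to \<open>g\<close>, the quotient of \<open>G\<close>
      by \<open>J\<close>.\<close>
    have "\<exists>j0>0. \<forall>s\<in>K. j0 \<le> J s"
    proof -
      have "compact (J ` K)"
        unfolding K_def by (intro compact_continuous_image continuous_on_subset[OF C1on_imp_continuous_on[OF C1_J]])
          (use KB in \<open>auto simp: K_def\<close>)
      moreover have "J ` K \<noteq> {}" using r(1) by (auto simp: K_def)
      ultimately obtain j0 where "j0 \<in> J ` K" "\<forall>j\<in>J ` K. j0 \<le> j" using compact_attains_inf by metis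
      then show ?thesis using J_pos KB by (intro exI[of _ j0]) auto
    qed
    then obtain j0 where j0: "j0 > 0" "\<And>s. s \<in> K \<Longrightarrow> j0 \<le> J s" by blast
    show "g \<in> div_limits"
    proof (rule div_limits_closed)
      fix \<eta> :: real assume eta: "\<eta> > 0"
      obtain \<delta> where \<delta>: "\<delta> > 0" "\<And>\<epsilon> x. 0 < \<epsilon> \<Longrightarrow> \<epsilon> \<le> \<delta> \<Longrightarrow>
        norm ((1 / bump_mass TYPE(real^'n) \<epsilon>) *\<^sub>R integral (cbox a b) (\<lambda>y. bump \<epsilon> (x - y) *\<^sub>R G y) - G x) \<le> \<eta> * j0 / 2"
        using mollify[where \<eta> = "\<eta> * j0 / 2", OF cG suppG] mult_pos_pos[OF eta j0(1)] by auto
      define \<epsilon> where "\<epsilon> = min \<delta> (\<rho> / 2)"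
      have e: "\<epsilon> > 0" "\<epsilon> \<le> \<delta>" "\<epsilon> * norm (One :: real^'n) \<le> r / 4"
      proof -
        show "\<epsilon> > 0" "\<epsilon> \<le> \<delta>" using \<delta>(1) \<rho>(1) by (auto simp: \<epsilon>_def)
        have "\<epsilon> * norm (One :: real^'n) \<le> \<rho> / 2 * norm (One :: real^'n)" by (intro mult_right_mono) (auto simp: \<epsilon>_def)
        then show "\<epsilon> * norm (One :: real^'n) \<le> r / 4" using \<rho>(2) by simp
      qed
      define m0 where "m0 = bump_mass TYPE(real^'n) \<epsilon>"
      have m0: "m0 > 0" unfolding m0_def by (rule bump_mass_pos[OF e(1)])
      obtain I :: "((real^'n) \<times> (real^'n) set) set" and m where I: "finite I" "\<And>i. i \<in> I \<Longrightarrow> fst i \<in> cbox a b"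
        "sum m I = integral (cbox a b) G"
        "\<And>x. x \<in> K \<Longrightarrow> norm (integral (cbox a b) (\<lambda>y. G y *\<^sub>R bump \<epsilon> (x - y)) - (\<Sum>i\<in>I. m i *\<^sub>R bump \<epsilon> (x - fst i))) \<le> \<eta> * j0 * m0 / 2"
      proof (rule riemann_sum_uniform[where F = "\<lambda>y x. bump \<epsilon> (x - y)" and f = G and a = a and b = b and B = K and \<epsilon> = "\<eta> * j0 * m0 / 2"])
        show "compact K" by (simp add: K_def)
        show "continuous_on (cbox a b \<times> K) (\<lambda>(y, x). bump \<epsilon> (x - y))"
          unfolding split_beta by (rule continuous_on_compose2[OF bump_C1(3)[of UNIV]]) (auto intro!: continuous_intros)
        show "continuous_on (cbox a b) G" by (rule continuous_on_subset[OF cG subset_UNIV])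
      qed (use eta j0 m0 in auto)
      have approx: "\<bar>(1 / m0) * (\<Sum>i\<in>I. m i * bump \<epsilon> (s - fst i)) - G s\<bar> \<le> \<eta> * j0" if s: "s \<in> K" for s
      proof -
        let ?i = "integral (cbox a b) (\<lambda>y. bump \<epsilon> (s - y) * G y)" and ?S = "\<Sum>i\<in>I. m i * bump \<epsilon> (s - fst i)"
        have 1: "\<bar>?i - ?S\<bar> \<le> \<eta> * j0 * m0 / 2" using I(4)[OF s] by (simp add: mult.commute)
        have 2: "\<bar>(1 / m0) * ?i - G s\<bar> \<le> \<eta> * j0 / 2" using \<delta>(2)[OF e(1,2), of s] by (simp add: m0_def)
        have "(1 / m0) * ?S - G s = ((1 / m0) * ?i - G s) - (?i - ?S) / m0" by (simp add: diff_divide_distrib)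
        also have "\<bar>\<dots>\<bar> \<le> \<bar>(1 / m0) * ?i - G s\<bar> + \<bar>(?i - ?S) / m0\<bar>" by (rule abs_triangle_ineq4)
        also have "\<bar>(?i - ?S) / m0\<bar> = \<bar>?i - ?S\<bar> / m0" using m0 by (simp add: abs_divide)
        also have "\<bar>(1 / m0) * ?i - G s\<bar> + \<bar>?i - ?S\<bar> / m0 \<le> \<eta> * j0 / 2 + (\<eta> * j0 * m0 / 2) / m0"
          using 1 2 m0 by (intro add_mono divide_right_mono) auto
        also have "\<dots> = \<eta> * j0" using m0 by simp
        finally show ?thesis .
      qed
      have far: "bump \<epsilon> (s - y) = 0" if "y \<in> cbox a b" "s \<notin> K" for y s
      proof (rule bump_outside[OF e(1)], rule notI)
        assume "s - y \<in> cube \<epsilon>"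
        then have "norm (s - y) \<le> r / 4" using norm_cube[of "s - y" \<epsilon>] e by simp
        then have "norm (s - s0) \<le> 3 * r / 4"
          using Q[OF that(1)] norm_triangle_ineq[of "s - y" "y - s0"] by simp
        then show False using that(2) by (simp add: K_def dist_norm norm_minus_commute)
      qed
      define D1 where "D1 = (\<lambda>(i :: (real^'n) \<times> (real^'n) set) x. if x \<in> \<phi> ` B then (bump \<epsilon> (\<kappa> x - fst i) - bump \<epsilon> (\<kappa> x - s0)) / J (\<kappa> x) else 0)"
      have D1: "D1 i \<in> div_limits" if i: "i \<in> I" for i
      proof -
        let ?q = "bump_path \<epsilon> (fst i) (s0 - fst i)"
        have "?q s = 0" if "s \<notin> K" for s
        proof (rule bump_path_outside[OF e(1)], rule notI)
          fix t :: real assume t: "0 \<le> t" "t \<le> 1" and c: "s - (fst i + t *\<^sub>R (s0 - fst i)) \<in> cube \<epsilon>"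
          define y where "y = fst i + t *\<^sub>R (s0 - fst i)"
          have "norm (s - y) \<le> r / 4" using norm_cube[OF c] e by (simp add: y_def)
          moreover have "norm (y - s0) \<le> r / 2"
          proof -
            have "y - s0 = (1 - t) *\<^sub>R (fst i - s0)" by (simp add: y_def algebra_simps)
            moreover have "(1 - t) * norm (fst i - s0) \<le> 1 * (r / 2)" using t Q[OF I(2)[OF i]] by (intro mult_mono) auto
            ultimately show ?thesis using t by simp
          qed
          ultimately have "norm (s - s0) \<le> 3 * r / 4" using norm_triangle_ineq[of "s - y" "y - s0"] by simp
          then show False using that by (simp add: K_def dist_norm norm_minus_commute)
        qed
        then obtain v where v: "field v" "\<And>x. x \<in> M \<Longrightarrow> div_M v x =
            (if x \<in> \<phi> ` B then frechet_derivative ?q (at (\<kappa> x)) (s0 - fst i) / J (\<kappa> x) else 0)"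
          using chart_field_divergence[OF ch(1) R B _ KB(1) bump_path_C1, of \<epsilon> "fst i" "s0 - fst i" "s0 - fst i"]
          by (auto simp: K_def)
        have "div_M v x = D1 i x" if "x \<in> M" for x
          unfolding v(2)[OF that] bump_path_derivative D1_def by simp
        then show ?thesis unfolding div_limits_def using v(1) by force
      qed
      let ?f = "\<lambda>x. \<Sum>i\<in>I. (m i / m0) * D1 i x"
      have "?f \<in> div_limits" by (rule div_limits_sum[OF I(1) D1])
      moreover have "\<bar>g x - ?f x\<bar> \<le> \<eta>" if x: "x \<in> M" for x
      proof (cases "x \<in> \<phi> ` B")
        case True
        then obtain s where s: "s \<in> B" "x = \<phi> s" by blast
        have sV: "s \<in> V" "\<kappa> x = s" using s B \<kappa>_\<phi> by auto
        have Js: "J s > 0" by (rule J_pos[OF sV(1)])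
        have gG: "g x = G s / J s"
          using Js gV[OF sV(1)] s by (simp add: G_def)
        \<comment> \<open>Here the zero integral enters: the weights sum to 0, so the bumps at
          \<open>s0\<close> cancel.\<close>
        have "(\<Sum>i\<in>I. m i * (bump \<epsilon> (s - fst i) - bump \<epsilon> (s - s0))) = (\<Sum>i\<in>I. m i * bump \<epsilon> (s - fst i))"
          using I(3) intG by (simp add: right_diff_distrib sum_subtractf flip: sum_distrib_right)
        moreover have "?f x = (1 / m0) * (\<Sum>i\<in>I. m i * (bump \<epsilon> (s - fst i) - bump \<epsilon> (s - s0))) / J s"
          using True by (simp add: D1_def sV(2) sum_distrib_left sum_divide_distrib)
        ultimately have f: "?f x = ((1 / m0) * (\<Sum>i\<in>I. m i * bump \<epsilon> (s - fst i))) / J s" by simp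
        have quot: "\<bar>u / j - w / j\<bar> = \<bar>w - u\<bar> / j" if "j > 0" for u w j :: real
        proof -
          have "u / j - w / j = (u - w) / j" by (rule diff_divide_distrib[symmetric])
          then have "\<bar>u / j - w / j\<bar> = \<bar>u - w\<bar> / j" using that by (simp only: abs_divide abs_of_pos)
          then show ?thesis by (simp only: abs_minus_commute)
        qed
        show ?thesis
        proof (cases "s \<in> K")
          case True
          have "\<bar>g x - ?f x\<bar> = \<bar>(1 / m0) * (\<Sum>i\<in>I. m i * bump \<epsilon> (s - fst i)) - G s\<bar> / J s"
            unfolding gG f by (rule quot[OF Js])
          also have "\<dots> \<le> (\<eta> * j0) / j0"
            using approx[OF True] j0 Js True eta by (intro frac_le) auto
          finally show ?thesis using j0(1) by simp
        next
          case False
          have "s \<notin> cbox a b"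
            using False Q[of s] r(1) by (auto simp: K_def dist_norm norm_minus_commute)
          then have "g x = 0" using gV[OF sV(1)] s by simp
          moreover have "?f x = 0" unfolding f using far[OF I(2) False] by simp
          ultimately show ?thesis using eta by simp
        qed
      next
        case False
        have "g x = 0"
        proof (rule g(2)[OF x], rule notI)
          assume "x \<in> N"
          then show False using MN x QB False by blast
        qed
        then show ?thesis using False eta by (simp add: D1_def)
      qed
      ultimately show "\<exists>f\<in>div_limits. \<forall>x\<in>M. \<bar>g x - f x\<bar> \<le> \<eta>" by (intro bexI[of _ ?f]) auto
    qed
  qed
  show ?thesis
    by (rule that[OF ch(1) _ _ oN pN _ MN main]) (use QB B s0Q in \<open>auto simp: N_def\<close>)
qed

section \<open>Change of variables for arbitrary finite index types\<close>

text \<open>The library's change of variables formula is stated for index types of class \<open>wellorder\<close>;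
  this copy of a finite type carries an arbitrary well-order.\<close>

typedef 'a ordered_copy = "UNIV :: 'a set" by simp

lemma inj_Rep_ordered_copy: "inj Rep_ordered_copy" and surj_Rep_ordered_copy: "surj Rep_ordered_copy"
  by (auto simp: Rep_ordered_copy_inject inj_def intro!: surjI[of _ Abs_ordered_copy] Abs_ordered_copy_inverse)

instance ordered_copy :: (finite) finite
proof
  have "finite (range (Rep_ordered_copy :: 'a ordered_copy \<Rightarrow> 'a))" by simp
  then show "finite (UNIV :: 'a ordered_copy set)" using inj_Rep_ordered_copy finite_imageD by blast
qed

definition ordered_copy_index :: "'a::finite ordered_copy \<Rightarrow> nat" where
  "ordered_copy_index = (SOME f. inj f)"

lemma inj_ordered_copy_index: "inj (ordered_copy_index :: 'a::finite ordered_copy \<Rightarrow> nat)"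
  unfolding ordered_copy_index_def by (rule someI_ex[of inj]) (use finite_imp_inj_to_nat_seg[of "UNIV :: 'a ordered_copy set"] in blast)

instantiation ordered_copy :: (finite) wellorder
begin

definition less_eq_ordered_copy :: "'a ordered_copy \<Rightarrow> 'a ordered_copy \<Rightarrow> bool" where
  "x \<le> y \<longleftrightarrow> ordered_copy_index x \<le> ordered_copy_index y"

definition less_ordered_copy :: "'a ordered_copy \<Rightarrow> 'a ordered_copy \<Rightarrow> bool" where
  "x < y \<longleftrightarrow> ordered_copy_index x < ordered_copy_index y"

instance
proof
  fix x y :: "'a ordered_copy"
  assume "x \<le> y" "y \<le> x"
  then have "ordered_copy_index x = ordered_copy_index y" by (simp add: less_eq_ordered_copy_def)
  then show "x = y" by (rule injD[OF inj_ordered_copy_index])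
next
  fix P :: "'a ordered_copy \<Rightarrow> bool" and a
  assume step: "\<And>x. (\<And>y. y < x \<Longrightarrow> P y) \<Longrightarrow> P x"
  show "P a"
  proof (induction a rule: measure_induct_rule[where f = ordered_copy_index])
    case (less x)
    show ?case by (rule step) (rule less, simp add: less_ordered_copy_def)
  qed
qed (auto simp: less_eq_ordered_copy_def less_ordered_copy_def)

end

section \<open>Transport of integrals along a reindexing of coordinates\<close>

definition to_copy :: "real^'n \<Rightarrow> real^('n::finite ordered_copy)" where
  "to_copy x = (\<chi> i. x $ Rep_ordered_copy i)"

definition of_copy :: "real^('n::finite ordered_copy) \<Rightarrow> real^'n" where
  "of_copy y = (\<chi> i. y $ Abs_ordered_copy i)"

lemma of_copy_to_copy [simp]: "of_copy (to_copy x) = x"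
  by (simp add: to_copy_def of_copy_def vec_eq_iff Abs_ordered_copy_inverse)

lemma to_copy_of_copy [simp]: "to_copy (of_copy x) = x"
  by (simp add: to_copy_def of_copy_def vec_eq_iff Rep_ordered_copy_inverse)

lemma linear_to_copy: "linear to_copy" and linear_of_copy: "linear of_copy"
  by (auto intro!: linearI simp: to_copy_def of_copy_def vec_eq_iff)

lemma to_copy_cbox: "to_copy ` cbox a b = cbox (to_copy a) (to_copy b)"
proof
  show "to_copy ` cbox a b \<subseteq> cbox (to_copy a) (to_copy b)" by (auto simp: mem_box_cart to_copy_def)
  show "cbox (to_copy a) (to_copy b) \<subseteq> to_copy ` cbox a b"
  proof
    fix y assume y: "y \<in> cbox (to_copy a) (to_copy b)"
    have "a $ i \<le> y $ Abs_ordered_copy i \<and> y $ Abs_ordered_copy i \<le> b $ i" for i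
      using y by (auto simp: mem_box_cart to_copy_def Abs_ordered_copy_inverse dest: spec[of _ "Abs_ordered_copy i"])
    then have "of_copy y \<in> cbox a b" by (auto simp: mem_box_cart of_copy_def)
    then show "y \<in> to_copy ` cbox a b" by (metis imageI to_copy_of_copy)
  qed
qed

lemma of_copy_cbox: "of_copy ` cbox a b = cbox (of_copy a) (of_copy b)"
proof -
  have "cbox a b = to_copy ` cbox (of_copy a) (of_copy b)" by (simp add: to_copy_cbox)
  then show ?thesis by (simp add: image_image)
qed

lemma bij_Rep_ordered_copy: "bij Rep_ordered_copy"
  by (simp add: bij_def inj_Rep_ordered_copy surj_Rep_ordered_copy)

lemma content_to_copy: "measure lborel (to_copy ` cbox a b) = measure lborel (cbox a b)"
proof (cases "cbox a b = {}")
  case False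
  then have "cbox (to_copy a) (to_copy b) \<noteq> {}" using to_copy_cbox[of a b] by (metis image_is_empty)
  then have "measure lborel (to_copy ` cbox a b) = (\<Prod>i\<in>UNIV. b $ Rep_ordered_copy i - a $ Rep_ordered_copy i)"
    unfolding to_copy_cbox by (subst content_cbox_cart) (simp_all add: to_copy_def)
  also have "\<dots> = (\<Prod>i\<in>UNIV. b $ i - a $ i)"
    using bij_Rep_ordered_copy by (rule prod.reindex_bij_betw)
  finally show ?thesis using False by (simp add: content_cbox_cart)
qed simp

lemma norm_to_copy: "norm (to_copy x) = norm x"
proof -
  have "(\<Sum>i\<in>UNIV. (x $ Rep_ordered_copy i)\<^sup>2) = (\<Sum>i\<in>UNIV. (x $ i)\<^sup>2)"
    using bij_Rep_ordered_copy by (rule sum.reindex_bij_betw)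
  then show ?thesis by (simp add: norm_vec_def L2_set_def to_copy_def)
qed

lemma norm_of_copy: "norm (of_copy y) = norm y"
  by (metis norm_to_copy to_copy_of_copy)

lemma isCont_to_copy: "isCont to_copy x" and isCont_of_copy: "isCont of_copy y"
  by (auto intro!: linear_continuous_at simp: linear_to_copy linear_of_copy simp flip: linear_conv_bounded_linear)

lemma has_integral_to_copy_cbox:
  fixes f :: "real^('n::finite ordered_copy) \<Rightarrow> 'b::banach"
  assumes "(f has_integral i) (cbox a b)"
  shows "((\<lambda>x. f (to_copy x)) has_integral i) (cbox (of_copy a) (of_copy b))"
proof -
  have "((\<lambda>x. f (to_copy x)) has_integral (1 / 1) *\<^sub>R i) (of_copy ` cbox a b)"
  proof (rule has_integral_twiddle[OF _ of_copy_to_copy to_copy_of_copy isCont_to_copy _ _ _ assms])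
    show "\<exists>w z. to_copy ` cbox u v = cbox w z" for u v :: "real^'n" using to_copy_cbox by blast
    show "\<exists>w z. of_copy ` cbox u v = cbox w z" for u v :: "real^('n ordered_copy)" using of_copy_cbox by blast
    show "measure lborel (to_copy ` cbox u v) = 1 * measure lborel (cbox u v)" for u v :: "real^'n"
      by (simp add: content_to_copy)
  qed simp
  then show ?thesis by (simp add: of_copy_cbox)
qed

text \<open>The box case extends to arbitrary sets by describing an integral through integrals over
  large boxes; reindexing is an isometry, so the balls contained in those boxes correspond.\<close>

lemma has_integral_to_copy:
  fixes f :: "real^('n::finite ordered_copy) \<Rightarrow> 'b::banach"
  assumes "(f has_integral i) (to_copy ` S)"
  shows "((\<lambda>x. f (to_copy x)) has_integral i) S"
proof -
  let ?g = "\<lambda>y. if y \<in> to_copy ` S then f y else 0" and ?h = "\<lambda>x. if x \<in> S then f (to_copy x) else 0"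
  have gh: "?g (to_copy x) = ?h x" for x by (auto dest: arg_cong[of _ _ of_copy])
  have int: "?g integrable_on cbox a b" for a b using assms unfolding has_integral_alt' by blast
  have box: "(?h has_integral integral (cbox (to_copy a) (to_copy b)) ?g) (cbox a b)" for a b
    using has_integral_to_copy_cbox[OF integrable_integral[OF int], of "to_copy a" "to_copy b"] by (simp add: gh)
  show ?thesis
    unfolding has_integral_alt'
  proof (intro conjI allI impI)
    show "?h integrable_on cbox a b" for a b using box by blast
    fix e :: real assume "e > 0"
    then obtain B where B: "B > 0" "\<And>a b. ball 0 B \<subseteq> cbox a b \<Longrightarrow> norm (integral (cbox a b) ?g - i) < e"
      using assms unfolding has_integral_alt' by blast
    have "norm (integral (cbox a b) ?h - i) < e" if ab: "ball 0 B \<subseteq> cbox a b" for a b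
    proof -
      have "ball 0 B \<subseteq> cbox (to_copy a) (to_copy b)"
      proof
        fix y :: "real^('n ordered_copy)" assume "y \<in> ball 0 B"
        then have "of_copy y \<in> cbox a b" using ab by (auto simp: norm_of_copy)
        then show "y \<in> cbox (to_copy a) (to_copy b)" unfolding to_copy_cbox[symmetric] by (metis imageI to_copy_of_copy)
      qed
      from B(2)[OF this] show ?thesis by (simp add: integral_unique[OF box])
    qed
    then show "\<exists>B>0. \<forall>a b. ball 0 B \<subseteq> cbox a b \<longrightarrow> norm (integral (cbox a b) ?h - i) < e" using B(1) by blast
  qed
qed

lemma has_integral_of_copy_cbox:
  fixes f :: "real^'n::finite \<Rightarrow> 'b::banach"
  assumes "(f has_integral i) (cbox a b)"
  shows "((\<lambda>x. f (of_copy x)) has_integral i) (cbox (to_copy a) (to_copy b))"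
proof -
  have "measure lborel (of_copy ` cbox u v) = measure lborel (cbox u v)" for u v :: "real^('n ordered_copy)"
    using content_to_copy[of "of_copy u" "of_copy v"] by (simp add: to_copy_cbox of_copy_cbox)
  then have "((\<lambda>x. f (of_copy x)) has_integral (1 / 1) *\<^sub>R i) (to_copy ` cbox a b)"
  proof (intro has_integral_twiddle[OF _ to_copy_of_copy of_copy_to_copy isCont_of_copy _ _ _ assms])
    show "\<exists>w z. to_copy ` cbox u v = cbox w z" for u v :: "real^'n" using to_copy_cbox by blast
    show "\<exists>w z. of_copy ` cbox u v = cbox w z" for u v :: "real^('n ordered_copy)" using of_copy_cbox by blast
  qed auto
  then show ?thesis by (simp add: to_copy_cbox)
qed

lemma has_integral_of_copy:
  fixes f :: "real^'n::finite \<Rightarrow> 'b::banach"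
  assumes "(f has_integral i) S"
  shows "((\<lambda>x. f (of_copy x)) has_integral i) (to_copy ` S)"
proof -
  let ?g = "\<lambda>y. if y \<in> S then f y else 0" and ?h = "\<lambda>x. if x \<in> to_copy ` S then f (of_copy x) else 0"
  have gh: "?g (of_copy x) = ?h x" for x by (auto simp: image_iff)
  have int: "?g integrable_on cbox a b" for a b using assms unfolding has_integral_alt' by blast
  have box: "(?h has_integral integral (cbox (of_copy a) (of_copy b)) ?g) (cbox a b)" for a b
    using has_integral_of_copy_cbox[OF integrable_integral[OF int], of "of_copy a" "of_copy b"] by (simp add: gh)
  show ?thesis
    unfolding has_integral_alt'
  proof (intro conjI allI impI)
    show "?h integrable_on cbox a b" for a b using box by blast
    fix e :: real assume "e > 0"
    then obtain B where B: "B > 0" "\<And>a b. ball 0 B \<subseteq> cbox a b \<Longrightarrow> norm (integral (cbox a b) ?g - i) < e"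
      using assms unfolding has_integral_alt' by blast
    have "norm (integral (cbox a b) ?h - i) < e" if ab: "ball 0 B \<subseteq> cbox a b" for a b
    proof -
      have "ball 0 B \<subseteq> cbox (of_copy a) (of_copy b)"
      proof
        fix y :: "real^'n" assume "y \<in> ball 0 B"
        then have "to_copy y \<in> cbox a b" using ab by (auto simp: norm_to_copy)
        then show "y \<in> cbox (of_copy a) (of_copy b)" unfolding of_copy_cbox[symmetric] by (metis imageI of_copy_to_copy)
      qed
      from B(2)[OF this] show ?thesis by (simp add: integral_unique[OF box])
    qed
    then show "\<exists>B>0. \<forall>a b. ball 0 B \<subseteq> cbox a b \<longrightarrow> norm (integral (cbox a b) ?h - i) < e" using B(1) by blast
  qed
qed

lemma absolutely_integrable_of_copy:
  fixes f :: "real^'n::finite \<Rightarrow> 'b::euclidean_space"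
  assumes "f absolutely_integrable_on S"
  shows "(\<lambda>x. f (of_copy x)) absolutely_integrable_on (to_copy ` S)"
proof -
  obtain i j where "(f has_integral i) S" "((\<lambda>x. norm (f x)) has_integral j) S"
    using assms unfolding absolutely_integrable_on_def integrable_on_def by blast
  from this[THEN has_integral_of_copy] show ?thesis
    unfolding absolutely_integrable_on_def integrable_on_def by blast
qed

text \<open>Conjugation with the bijection of index sets is a sign-preserving bijection of
  permutations, and it merely reorders the factors of each product.\<close>

lemma det_reindex:
  fixes A :: "real^'n::finite^'n"
  shows "det (\<chi> i j. A $ Rep_ordered_copy i $ Rep_ordered_copy j) = det A"
proof -
  let ?R = "Rep_ordered_copy :: 'n ordered_copy \<Rightarrow> 'n" and ?A = "Abs_ordered_copy :: 'n \<Rightarrow> 'n ordered_copy"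
  have AR: "?A (?R x) = x" "?R (?A y) = y" for x y
    by (simp_all add: Rep_ordered_copy_inverse Abs_ordered_copy_inverse)
  have inv: "inv ?R = ?A" by (rule inv_unique_comp) (auto simp: AR fun_eq_iff)
  have mp: "map_permutation UNIV ?R p = ?R \<circ> p \<circ> ?A" for p
    by (simp add: map_permutation_def restrict_id_def inv fun_eq_iff surj_Rep_ordered_copy)
  have "bij_betw (map_permutation UNIV ?R) {p. p permutes UNIV} {p. p permutes UNIV}"
  proof (rule bij_betw_byWitness[where f' = "\<lambda>q. ?A \<circ> q \<circ> ?R"])
    have "bij (?A \<circ> q \<circ> ?R)" if "bij q" for q
    proof -
      have "bij ?A" by (rule o_bij[of ?R]) (auto simp: AR fun_eq_iff)
      then show ?thesis using that bij_Rep_ordered_copy by (intro bij_comp)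
    qed
    then show "(\<lambda>q. ?A \<circ> q \<circ> ?R) ` {p. p permutes UNIV} \<subseteq> {p. p permutes UNIV}"
      by (auto intro!: bij_imp_permutes dest: permutes_bij)
    show "map_permutation UNIV ?R ` {p. p permutes UNIV} \<subseteq> {p. p permutes UNIV}"
      using map_permutation_permutes[OF bij_Rep_ordered_copy] by auto
  qed (auto simp: mp AR fun_eq_iff)
  then have "det A = (\<Sum>p | p permutes (UNIV :: 'n ordered_copy set).
      of_int (sign (map_permutation UNIV ?R p)) * (\<Prod>i\<in>UNIV. A $ i $ map_permutation UNIV ?R p i))"
    unfolding det_def by (rule sum.reindex_bij_betw[symmetric])
  also have "\<dots> = (\<Sum>p | p permutes (UNIV :: 'n ordered_copy set). of_int (sign p) * (\<Prod>i\<in>UNIV. A $ ?R i $ ?R (p i)))"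
  proof (rule sum.cong)
    fix p :: "'n ordered_copy \<Rightarrow> 'n ordered_copy" assume "p \<in> {p. p permutes UNIV}"
    then have "sign (map_permutation UNIV ?R p) = sign p"
      using inj_Rep_ordered_copy by (intro sign_map_permutation) auto
    moreover have "(\<Prod>i\<in>UNIV. A $ i $ map_permutation UNIV ?R p i) = (\<Prod>i\<in>UNIV. A $ ?R i $ map_permutation UNIV ?R p (?R i))"
      using bij_Rep_ordered_copy by (rule prod.reindex_bij_betw[symmetric])
    ultimately show "of_int (sign (map_permutation UNIV ?R p)) * (\<Prod>i\<in>UNIV. A $ i $ map_permutation UNIV ?R p i) =
        of_int (sign p) * (\<Prod>i\<in>UNIV. A $ ?R i $ ?R (p i))" by (simp add: mp AR)
  qed simp
  finally show ?thesis by (simp add: det_def)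
qed

text \<open>Everything is moved to the ordered index type, where the reindexed Jacobian matrix has
  the same determinant, and moved back afterwards.\<close>

lemma has_integral_change_of_variables:
  fixes g :: "real^'n::finite \<Rightarrow> real^'n" and f :: "real^'n \<Rightarrow> real"
  assumes S: "S \<in> sets borel" and g: "\<And>x. x \<in> S \<Longrightarrow> (g has_derivative g' x) (at x)"
    and inj: "inj_on g S" and f: "f absolutely_integrable_on (g ` S)"
  shows "((\<lambda>x. \<bar>det (matrix (g' x))\<bar> * f (g x)) has_integral (integral (g ` S) f)) S"
proof -
  let ?S = "to_copy ` S" and ?g = "\<lambda>y. to_copy (g (of_copy y))"
  let ?g' = "\<lambda>y h. to_copy (g' (of_copy y) (of_copy h))"
  \<comment> \<open>Values in \<open>real^1\<close> match the vector-valued form of the formula; the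
    single component is extracted at the end.\<close>
  let ?f = "\<lambda>y. vec (f (of_copy y)) :: real^1"
  have "?S = of_copy -` S \<inter> space borel" by (auto simp: image_iff) (metis to_copy_of_copy)
  moreover have "of_copy \<in> borel_measurable borel"
    using isCont_of_copy by (intro borel_measurable_continuous_onI continuous_at_imp_continuous_on) auto
  ultimately have "?S \<in> sets borel" using S by (metis measurable_sets)
  then have Sl: "?S \<in> sets lebesgue" by (metis sets_completionI_sets sets_lborel)
  have bl: "bounded_linear to_copy" "bounded_linear of_copy"
    using linear_to_copy linear_of_copy by (auto simp: linear_conv_bounded_linear)
  have d: "(?g has_derivative ?g' y) (at y within ?S)" if "y \<in> ?S" for y
  proof -
    have "of_copy y \<in> S" using that by auto
    then have "((\<lambda>y. g (of_copy y)) has_derivative (\<lambda>h. g' (of_copy y) (of_copy h))) (at y)"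
      by (intro has_derivative_compose[OF bounded_linear_imp_has_derivative[OF bl(2)] g])
    then show ?thesis by (rule bounded_linear.has_derivative[OF bl(1) has_derivative_at_withinI])
  qed
  have injc: "inj_on ?g ?S"
  proof (rule inj_onI)
    fix x y assume xy: "x \<in> ?S" "y \<in> ?S" "?g x = ?g y"
    then have "g (of_copy x) = g (of_copy y)" by (metis of_copy_to_copy)
    moreover have "of_copy x \<in> S" "of_copy y \<in> S" using xy by auto
    ultimately have "of_copy x = of_copy y" using inj by (metis inj_onD)
    then show "x = y" by (metis to_copy_of_copy)
  qed
  have img: "?g ` ?S = to_copy ` (g ` S)" by (auto simp: image_image)
  have blv: "bounded_linear (vec :: real \<Rightarrow> real^1)"
    by (simp add: linear_conv_bounded_linear[symmetric] linearI vec_eq_iff)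
  have "?f absolutely_integrable_on (?g ` ?S)"
    unfolding img by (rule absolutely_integrable_linear[OF absolutely_integrable_of_copy[OF f] blv, unfolded o_def])
  then have "(\<lambda>y. \<bar>det (matrix (?g' y))\<bar> *\<^sub>R ?f (?g y)) absolutely_integrable_on ?S \<and>
      integral ?S (\<lambda>y. \<bar>det (matrix (?g' y))\<bar> *\<^sub>R ?f (?g y)) = integral (?g ` ?S) ?f"
    by (intro has_absolute_integral_change_of_variables[OF Sl d injc, THEN iffD2] conjI refl)
  then have ai: "(\<lambda>y. \<bar>det (matrix (?g' y))\<bar> *\<^sub>R ?f (?g y)) absolutely_integrable_on ?S"
    and ie: "integral ?S (\<lambda>y. \<bar>det (matrix (?g' y))\<bar> *\<^sub>R ?f (?g y)) = integral (?g ` ?S) ?f" by auto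
  have "((\<lambda>y. \<bar>det (matrix (?g' y))\<bar> *\<^sub>R ?f (?g y)) has_integral integral (?g ` ?S) ?f) ?S"
    using integrable_integral[OF set_lebesgue_integral_eq_integral(1)[OF ai]] unfolding ie .
  from has_integral_to_copy[OF this]
  have "((\<lambda>x. \<bar>det (matrix (?g' (to_copy x)))\<bar> *\<^sub>R ?f (?g (to_copy x))) has_integral integral (?g ` ?S) ?f) S" .
  moreover have "integral (?g ` ?S) ?f = vec (integral (g ` S) f)"
  proof -
    have "f integrable_on g ` S" using f by (simp add: absolutely_integrable_on_def)
    from has_integral_linear[OF has_integral_of_copy[OF integrable_integral[OF this]] blv]
    show ?thesis unfolding img by (simp add: o_def integral_unique)
  qed
  moreover have "det (matrix (?g' (to_copy x))) = det (matrix (g' x))" for x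
  proof -
    have ax: "of_copy (axis j 1) = axis (Rep_ordered_copy j) (1::real)" for j :: "'n ordered_copy"
      by (auto simp: of_copy_def axis_def vec_eq_iff Rep_ordered_copy_inverse Abs_ordered_copy_inverse)
    have "matrix (?g' (to_copy x)) = (\<chi> i j. matrix (g' x) $ Rep_ordered_copy i $ Rep_ordered_copy j)"
      by (simp add: matrix_def ax vec_eq_iff) (simp add: to_copy_def)
    then show ?thesis by (simp add: det_reindex)
  qed
  ultimately have "((\<lambda>x. \<bar>det (matrix (g' x))\<bar> *\<^sub>R (vec (f (g x)) :: real^1)) has_integral vec (integral (g ` S) f)) S"
    by simp
  from has_integral_linear[OF this bounded_linear_vec_nth[of 1]] show ?thesis by (simp add: o_def)
qed

section \<open>Integration over the submanifold\<close>

definition vol_density :: "(real^'n \<Rightarrow> real^'d) \<Rightarrow> real^'n \<Rightarrow> real" where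
  "vol_density \<psi> u = sqrt (det (transpose (matrix (frechet_derivative \<psi> (at u))) ** matrix (frechet_derivative \<psi> (at u))))"

text \<open>Decomposition and integrand are separated here, whereas
  \<open>manifold_has_integral\<close> lets each integrand bring its own decomposition: linearity
  and uniqueness are immediate only over a fixed one.\<close>

definition pieces :: "(real^'d) set \<Rightarrow> ((real^'n) set \<times> (real^'n \<Rightarrow> real^'d) \<times> (real^'n) set) list \<Rightarrow> bool" where
  "pieces M ps \<longleftrightarrow>
     (\<forall>i<length ps. case ps ! i of (U, \<psi>, E) \<Rightarrow> local_param M U \<psi> \<and> E \<in> sets borel \<and> E \<subseteq> U) \<and>
     (\<forall>i<length ps. \<forall>j<length ps. i \<noteq> j \<longrightarrow>
        (case ps ! i of (_, \<psi>, E) \<Rightarrow> \<psi> ` E) \<inter> (case ps ! j of (_, \<psi>, E) \<Rightarrow> \<psi> ` E) = {}) \<and>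
     M = (\<Union>i<length ps. case ps ! i of (_, \<psi>, E) \<Rightarrow> \<psi> ` E)"

definition pieces_integral :: "((real^'n) set \<times> (real^'n \<Rightarrow> real^'d) \<times> (real^'n) set) list \<Rightarrow> (real^'d \<Rightarrow> real) \<Rightarrow> real \<Rightarrow> bool" where
  "pieces_integral ps f c \<longleftrightarrow> (\<exists>I. (\<forall>i<length ps. case ps ! i of (U, \<psi>, E) \<Rightarrow>
      ((\<lambda>u. f (\<psi> u) * vol_density \<psi> u) has_integral I i) E) \<and> c = (\<Sum>i<length ps. I i))"

lemma manifold_has_integral_pieces:
  fixes M :: "(real^'d) set"
  assumes "manifold_has_integral TYPE('n::finite) M f c"
  obtains ps :: "((real^'n) set \<times> (real^'n \<Rightarrow> real^'d) \<times> (real^'n) set) list" where "pieces M ps" "pieces_integral ps f c"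
proof -
  obtain ps :: "((real^'n) set \<times> (real^'n \<Rightarrow> real^'d) \<times> (real^'n) set) list" and Is where *: "length Is = length ps"
    "\<forall>i<length ps. case ps ! i of (U, \<phi>, E) \<Rightarrow> local_param M U \<phi> \<and> E \<in> sets borel \<and> E \<subseteq> U \<and>
       ((\<lambda>u. f (\<phi> u) * vol_density \<phi> u) has_integral (Is ! i)) E"
    "\<forall>i<length ps. \<forall>j<length ps. i \<noteq> j \<longrightarrow>
            (case ps ! i of (_, \<phi>, E) \<Rightarrow> \<phi> ` E) \<inter> (case ps ! j of (_, \<phi>, E) \<Rightarrow> \<phi> ` E) = {}"
    "M = (\<Union>i<length ps. case ps ! i of (_, \<phi>, E) \<Rightarrow> \<phi> ` E)" "sum_list Is = c"
    using assms unfolding manifold_has_integral_def vol_density_def[symmetric] by blast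
  have "pieces M ps" using *(2,3,4) unfolding pieces_def by (force split: prod.splits)
  moreover have "pieces_integral ps f c"
    unfolding pieces_integral_def
  proof (intro exI[of _ "\<lambda>i. Is ! i"] conjI)
    show "\<forall>i<length ps. case ps ! i of (U, \<psi>, E) \<Rightarrow> ((\<lambda>u. f (\<psi> u) * vol_density \<psi> u) has_integral Is ! i) E"
      using *(2) by (force split: prod.splits)
    show "c = (\<Sum>i<length ps. Is ! i)" using *(1,5) by (simp add: sum_list_sum_nth atLeast0LessThan)
  qed
  ultimately show ?thesis using that by blast
qed

lemma pieces_integral_unique:
  assumes "pieces_integral ps f c" "pieces_integral ps f c'"
  shows "c = c'"
proof -
  obtain I where I: "\<forall>i<length ps. case ps ! i of (U, \<psi>, E) \<Rightarrow>
      ((\<lambda>u. f (\<psi> u) * vol_density \<psi> u) has_integral I i) E" "c = (\<Sum>i<length ps. I i)"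
    using assms(1) unfolding pieces_integral_def by blast
  obtain I' where I': "\<forall>i<length ps. case ps ! i of (U, \<psi>, E) \<Rightarrow>
      ((\<lambda>u. f (\<psi> u) * vol_density \<psi> u) has_integral I' i) E" "c' = (\<Sum>i<length ps. I' i)"
    using assms(2) unfolding pieces_integral_def by blast
  have "I i = I' i" if "i < length ps" for i
  proof -
    obtain U \<psi> E where e: "ps ! i = (U, \<psi>, E)" by (cases "ps ! i")
    have "((\<lambda>u. f (\<psi> u) * vol_density \<psi> u) has_integral I i) E" "((\<lambda>u. f (\<psi> u) * vol_density \<psi> u) has_integral I' i) E"
      using I(1) I'(1) that e by force+
    then show ?thesis by (rule has_integral_unique)
  qed
  then show ?thesis using I(2) I'(2) by simp
qed

lemma pieces_integral_linear:
  assumes "pieces_integral ps f c" "pieces_integral ps g d"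
  shows "pieces_integral ps (\<lambda>x. a * f x + g x) (a * c + d)"
proof -
  obtain I where I: "\<forall>i<length ps. case ps ! i of (U, \<psi>, E) \<Rightarrow>
      ((\<lambda>u. f (\<psi> u) * vol_density \<psi> u) has_integral I i) E" "c = (\<Sum>i<length ps. I i)"
    using assms(1) unfolding pieces_integral_def by blast
  obtain I' where I': "\<forall>i<length ps. case ps ! i of (U, \<psi>, E) \<Rightarrow>
      ((\<lambda>u. g (\<psi> u) * vol_density \<psi> u) has_integral I' i) E" "d = (\<Sum>i<length ps. I' i)"
    using assms(2) unfolding pieces_integral_def by blast
  show ?thesis
    unfolding pieces_integral_def
  proof (intro exI[of _ "\<lambda>i. a * I i + I' i"] conjI allI impI)
    fix i assume i: "i < length ps"
    obtain U \<psi> E where e: "ps ! i = (U, \<psi>, E)" by (cases "ps ! i")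
    have "((\<lambda>u. a * (f (\<psi> u) * vol_density \<psi> u) + g (\<psi> u) * vol_density \<psi> u) has_integral a * I i + I' i) E"
      using I(1) I'(1) i e by (intro has_integral_add has_integral_mult_right) force+
    then show "case ps ! i of (U, \<psi>, E) \<Rightarrow> ((\<lambda>u. (a * f (\<psi> u) + g (\<psi> u)) * vol_density \<psi> u) has_integral a * I i + I' i) E"
      by (simp add: e algebra_simps)
  qed (simp add: I(2) I'(2) sum.distrib sum_distrib_left)
qed

lemma pieces_integral_zero: "pieces_integral ps (\<lambda>x. 0) 0"
  unfolding pieces_integral_def by (intro exI[of _ "\<lambda>_. 0"]) (auto split: prod.splits)

lemma pieces_integral_sum:
  assumes "finite I" "\<And>i. i \<in> I \<Longrightarrow> pieces_integral ps (f i) (c i)"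
  shows "pieces_integral ps (\<lambda>x. \<Sum>i\<in>I. f i x) (\<Sum>i\<in>I. c i)"
  using assms
proof (induction I rule: finite_induct)
  case (insert i I)
  then show ?case using pieces_integral_linear[of ps "f i" "c i" _ _ 1] by simp
qed (simp add: pieces_integral_zero)

lemma pieces_integral_cong:
  assumes "pieces M ps" "pieces_integral ps f c" "\<And>x. x \<in> M \<Longrightarrow> f x = g x"
  shows "pieces_integral ps g c"
proof -
  obtain I where I: "\<forall>i<length ps. case ps ! i of (U, \<psi>, E) \<Rightarrow>
      ((\<lambda>u. f (\<psi> u) * vol_density \<psi> u) has_integral I i) E" "c = (\<Sum>i<length ps. I i)"
    using assms(2) unfolding pieces_integral_def by blast
  show ?thesis
    unfolding pieces_integral_def
  proof (intro exI[of _ I] conjI allI impI I(2))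
    fix i assume i: "i < length ps"
    obtain U \<psi> E where e: "ps ! i = (U, \<psi>, E)" by (cases "ps ! i")
    have "((\<lambda>u. f (\<psi> u) * vol_density \<psi> u) has_integral I i) E" using I(1) i e by force
    moreover have "\<psi> u \<in> M" if "u \<in> E" for u
    proof -
      have "local_param M U \<psi>" "E \<subseteq> U" using assms(1) i e unfolding pieces_def by force+
      then show ?thesis using that by (auto simp: local_param_def)
    qed
    ultimately have "((\<lambda>u. g (\<psi> u) * vol_density \<psi> u) has_integral I i) E"
      using assms(3) by (subst has_integral_cong[of _ _ "\<lambda>u. f (\<psi> u) * vol_density \<psi> u"]) auto
    then show "case ps ! i of (U, \<psi>, E) \<Rightarrow> ((\<lambda>u. g (\<psi> u) * vol_density \<psi> u) has_integral I i) E"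
      by (simp add: e)
  qed
qed

section \<open>Independence of the integral from the decomposition\<close>

context chart
begin

lemma G_eq: "s \<in> V \<Longrightarrow> G s = transpose (matrix (D s)) ** matrix (D s)"
  by (simp add: G_def b_def matrix_def transpose_def matrix_matrix_mult_def inner_vec_def vec_eq_iff)

text \<open>By the chain rule the Gram matrix of \<psi> is A^T G A, with determinant (det A)^2 det
  G; its root carries the absolute Jacobian of the transition map.\<close>

lemma vol_density_transition:
  fixes \<psi> :: "real^'n \<Rightarrow> real^'d"
  assumes \<psi>: "local_param M U \<psi>" and u: "u \<in> U" and W: "\<psi> u \<in> W"
    and A: "((\<lambda>w. \<kappa> (\<psi> w)) has_derivative A) (at u)"
  shows "vol_density \<psi> u = \<bar>det (matrix A)\<bar> * J (\<kappa> (\<psi> u))"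
proof -
  let ?s = "\<kappa> (\<psi> u)"
  have s: "?s \<in> V" using \<kappa>_in[OF W] .
  obtain A' where A': "((\<lambda>w. \<kappa> (\<psi> w)) has_derivative A') (at u)" "frechet_derivative \<psi> (at u) = D ?s \<circ> A'"
    using transition[OF \<psi> u W] by blast
  then have eq: "frechet_derivative \<psi> (at u) = D ?s \<circ> A" using has_derivative_unique[OF A] by blast
  have "matrix (frechet_derivative \<psi> (at u)) = matrix (D ?s) ** matrix A"
    unfolding eq by (rule matrix_compose[OF has_derivative_linear[OF A] linear_D[OF s]])
  then have "transpose (matrix (frechet_derivative \<psi> (at u))) ** matrix (frechet_derivative \<psi> (at u)) =
      transpose (matrix A) ** G ?s ** matrix A"
    by (simp add: matrix_transpose_mul G_eq[OF s] matrix_mul_assoc)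
  then have "det (transpose (matrix (frechet_derivative \<psi> (at u))) ** matrix (frechet_derivative \<psi> (at u))) =
      det (matrix A) * det (G ?s) * det (matrix A)"
    by (simp add: det_mul)
  also have "\<dots> = (det (matrix A))\<^sup>2 * det (G ?s)" by (simp add: power2_eq_square)
  finally show ?thesis by (simp add: vol_density_def J_def real_sqrt_mult)
qed

text \<open>Change of variables along \<open>\<kappa> \<circ> \<psi>\<close>, which is injective on
  the part of \<open>E\<close> sent into \<open>N\<close> and has image \<open>Z\<close> there.
  Integrability in the chart comes from \<open>Z\<close> lying in a compact box on which the
  integrand is continuous.\<close>

lemma piece_integral:
  fixes \<psi> :: "real^'n \<Rightarrow> real^'d"
  assumes ab: "cbox lo hi \<subseteq> V" and N: "open N" "N \<subseteq> W" "M \<inter> N \<subseteq> \<phi> ` cbox lo hi"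
    and g: "continuous_on M g" "\<And>x. x \<in> M \<Longrightarrow> x \<notin> N \<Longrightarrow> g x = 0"
    and \<psi>: "local_param M U \<psi>" and E: "E \<in> sets borel" "E \<subseteq> U"
  defines "Z \<equiv> {s \<in> V. \<phi> s \<in> N \<and> \<phi> s \<in> \<psi> ` E}"
  shows "((\<lambda>u. g (\<psi> u) * vol_density \<psi> u) has_integral (integral Z (\<lambda>s. g (\<phi> s) * J s))) E"
    "(\<lambda>s. g (\<phi> s) * J s) integrable_on Z"
proof -
  have U: "open U" using \<psi> by (simp add: local_param_def)
  obtain \<theta> where \<theta>: "homeomorphism U (\<psi> ` U) \<psi> \<theta>" using \<psi> by (auto simp: local_param_def)
  obtain W0 where W0: "open W0" "\<psi> ` U = M \<inter> W0" using \<psi> by (auto simp: local_param_def)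
  have c\<psi>: "continuous_on U \<psi>" and c\<theta>: "continuous_on (M \<inter> W0) \<theta>" and \<theta>\<psi>: "\<And>u. u \<in> U \<Longrightarrow> \<theta> (\<psi> u) = u"
    using \<theta> by (auto simp: homeomorphism_def W0)
  have \<psi>M: "\<psi> u \<in> M" if "u \<in> U" for u using W0 that by blast
  define E' where "E' = E \<inter> (U \<inter> \<psi> -` N)"
  have oUN: "open (U \<inter> \<psi> -` N)" using c\<psi> U N(1) by (simp add: continuous_on_open_vimage Int_commute)
  have E'b: "E' \<in> sets borel" unfolding E'_def using E(1) oUN by auto
  let ?h = "\<lambda>u. \<kappa> (\<psi> u)"
  have E'D: "u \<in> U" "\<psi> u \<in> N" "\<psi> u \<in> W" "\<phi> (?h u) = \<psi> u" if "u \<in> E'" for u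
    using that N(2) \<phi>_\<kappa> \<psi>M by (auto simp: E'_def)
  have "\<exists>A. (?h has_derivative A) (at u)" if "u \<in> E'" for u
    using transition[OF \<psi> E'D(1)[OF that] E'D(3)[OF that]] by blast
  then obtain A where A: "\<And>u. u \<in> E' \<Longrightarrow> (?h has_derivative A u) (at u)" by metis
  have inj: "inj_on ?h E'"
  proof (rule inj_onI)
    fix x y assume xy: "x \<in> E'" "y \<in> E'" "?h x = ?h y"
    then have "\<psi> x = \<psi> y" using E'D(4) by metis
    then show "x = y" using \<theta>\<psi> E'D(1) xy by metis
  qed
  have img: "?h ` E' = Z"
  proof
    show "?h ` E' \<subseteq> Z"
    proof
      fix s assume "s \<in> ?h ` E'"
      then obtain u where u: "u \<in> E'" "s = ?h u" by blast
      then show "s \<in> Z" using E'D[OF u(1)] \<kappa>_in by (auto simp: Z_def E'_def)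
    qed
    show "Z \<subseteq> ?h ` E'"
    proof
      fix s assume s: "s \<in> Z"
      then obtain u where u: "u \<in> E" "\<phi> s = \<psi> u" by (auto simp: Z_def)
      then have "u \<in> E'" using s E(2) by (auto simp: E'_def Z_def)
      moreover have "?h u = s" using u s \<kappa>_\<phi> by (auto simp: Z_def simp flip: u(2))
      ultimately show "s \<in> ?h ` E'" by blast
    qed
  qed
  have Tab: "Z \<subseteq> cbox lo hi"
  proof
    fix s assume s: "s \<in> Z"
    then have sV: "s \<in> V" "\<phi> s \<in> N" by (auto simp: Z_def)
    then obtain t where "t \<in> cbox lo hi" "\<phi> s = \<phi> t" using N(3) \<phi>_in(1)[OF sV(1)] by blast
    then show "s \<in> cbox lo hi" using \<kappa>_\<phi> sV(1) ab by (metis subsetD)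
  qed
  have c\<phi>: "continuous_on V \<phi>" by (rule C1on_imp_continuous_on[OF C1_\<phi>])
  \<comment> \<open>On the open set \<open>V'\<close> the set is the preimage of the Borel set
    \<open>E\<close> under the continuous map \<open>\<theta> \<circ> \<phi>\<close>.\<close>
  have Tb: "Z \<in> sets borel"
  proof -
    define V' where "V' = V \<inter> \<phi> -` (N \<inter> W0)"
    have oV': "open V'" unfolding V'_def by (rule continuous_open_preimage[OF c\<phi> openV open_Int[OF N(1) W0(1)]])
    have "continuous_on V' (\<lambda>s. \<theta> (\<phi> s))"
      by (rule continuous_on_compose2[OF c\<theta> continuous_on_subset[OF c\<phi>]]) (auto simp: V'_def \<phi>_in)
    then have "(\<lambda>s. \<theta> (\<phi> s)) \<in> borel_measurable (restrict_space borel V')"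
      by (rule borel_measurable_continuous_on_restrict)
    then have "(\<lambda>s. \<theta> (\<phi> s)) -` E \<inter> space (restrict_space borel V') \<in> sets (restrict_space borel V')"
      using E(1) by (rule measurable_sets)
    moreover have "(\<lambda>s. \<theta> (\<phi> s)) -` E \<inter> space (restrict_space borel V') = Z"
    proof -
      have "s \<in> Z \<longleftrightarrow> s \<in> V' \<and> \<theta> (\<phi> s) \<in> E" for s
      proof
        assume s: "s \<in> Z"
        then obtain u where u: "u \<in> E" "\<phi> s = \<psi> u" by (auto simp: Z_def)
        then have "\<psi> u \<in> M \<inter> W0" using W0(2) E(2) by blast
        then show "s \<in> V' \<and> \<theta> (\<phi> s) \<in> E" using s u \<theta>\<psi> E(2) by (auto simp: Z_def V'_def)
      next
        assume s: "s \<in> V' \<and> \<theta> (\<phi> s) \<in> E"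
        then have "\<phi> s \<in> \<psi> ` U" unfolding W0(2) using \<phi>_in(1) by (auto simp: V'_def)
        then obtain u where u: "u \<in> U" "\<phi> s = \<psi> u" by blast
        then have "u \<in> E" using s \<theta>\<psi> by auto
        then show "s \<in> Z" using s u by (auto simp: Z_def V'_def)
      qed
      then show ?thesis by (auto simp: space_restrict_space)
    qed
    ultimately show ?thesis using oV' by (simp add: sets_restrict_space_iff borel_open)
  qed
  let ?f = "\<lambda>s. g (\<phi> s) * J s"
  have cf: "continuous_on (cbox lo hi) ?f"
    by (intro continuous_on_mult continuous_on_compose2[OF g(1) continuous_on_subset[OF c\<phi> ab]]
        continuous_on_subset[OF C1on_imp_continuous_on[OF C1_J] ab]) (use ab \<phi>_in in auto)
  have "?f absolutely_integrable_on cbox lo hi" by (rule absolutely_integrable_continuous[OF cf])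
  then have ai: "?f absolutely_integrable_on Z"
    by (rule set_integrable_subset[OF _ sets_completionI_sets Tab]) (use Tb in simp)
  then show "?f integrable_on Z" by (rule set_lebesgue_integral_eq_integral(1))
  have hi: "((\<lambda>u. \<bar>det (matrix (A u))\<bar> * ?f (?h u)) has_integral integral Z ?f) E'"
    using has_integral_change_of_variables[OF E'b A inj, of ?f] ai unfolding img by blast
  have "((\<lambda>u. g (\<psi> u) * vol_density \<psi> u) has_integral integral Z ?f) E'"
  proof (rule has_integral_eq[OF _ hi])
    fix u assume u: "u \<in> E'"
    show "\<bar>det (matrix (A u))\<bar> * ?f (?h u) = g (\<psi> u) * vol_density \<psi> u"
      using vol_density_transition[OF \<psi> E'D(1)[OF u] E'D(3)[OF u] A[OF u]] E'D(4)[OF u] by simp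
  qed
  then have "((\<lambda>u. if u \<in> E' then g (\<psi> u) * vol_density \<psi> u else 0) has_integral integral Z ?f) UNIV"
    by (simp only: has_integral_restrict_UNIV)
  \<comment> \<open>For \<open>u\<close> in \<open>E\<close> but not in \<open>E'\<close> the point
    \<open>\<psi> u\<close> lies off \<open>N\<close>, so \<open>g\<close> is zero there.\<close>
  moreover have "(\<lambda>u. if u \<in> E' then g (\<psi> u) * vol_density \<psi> u else 0) = (\<lambda>u. if u \<in> E then g (\<psi> u) * vol_density \<psi> u else 0)"
    using g(2) \<psi>M E(2) by (auto simp: E'_def fun_eq_iff)
  ultimately show "((\<lambda>u. g (\<psi> u) * vol_density \<psi> u) has_integral integral Z ?f) E"
    by (simp only: has_integral_restrict_UNIV)
qed

text \<open>The value does not mention \<open>ps\<close>: the pieces cut the coordinate domain of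
  \<open>N\<close> into disjoint sets \<open>Z i\<close> that exhaust it, and on the rest of the box
  the integrand vanishes.\<close>

lemma patch_pieces_integral:
  fixes ps :: "((real^'n) set \<times> (real^'n \<Rightarrow> real^'d) \<times> (real^'n) set) list"
  assumes ab: "cbox lo hi \<subseteq> V" and N: "open N" "N \<subseteq> W" "M \<inter> N \<subseteq> \<phi> ` cbox lo hi"
    and g: "continuous_on M g" "\<And>x. x \<in> M \<Longrightarrow> x \<notin> N \<Longrightarrow> g x = 0" and ps: "pieces M ps"
  shows "pieces_integral ps g (integral (cbox lo hi) (\<lambda>s. g (\<phi> s) * J s))"
proof -
  let ?f = "\<lambda>s. g (\<phi> s) * J s"
  define img where "img = (\<lambda>i. case ps ! i of (_, \<psi>, E) \<Rightarrow> \<psi> ` E)"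
  define Z where "Z = (\<lambda>i. {s \<in> V. \<phi> s \<in> N \<and> \<phi> s \<in> img i})"
  have piece: "(case ps ! i of (U, \<psi>, E) \<Rightarrow> ((\<lambda>u. g (\<psi> u) * vol_density \<psi> u) has_integral integral (Z i) ?f) E) \<and>
      ?f integrable_on Z i" if i: "i < length ps" for i
  proof -
    obtain U \<psi> E where e: "ps ! i = (U, \<psi>, E)" by (cases "ps ! i")
    have "local_param M U \<psi>" "E \<in> sets borel" "E \<subseteq> U" using ps i e unfolding pieces_def by force+
    from piece_integral[OF ab N g this] show ?thesis by (simp add: e Z_def img_def)
  qed
  have disj: "img i \<inter> img j = {}" if "i < length ps" "j < length ps" "i \<noteq> j" for i j
    using ps that by (simp add: pieces_def img_def)
  have Mimg: "M = (\<Union>i<length ps. img i)" using ps by (simp add: pieces_def img_def)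
  have "(?f has_integral (\<Sum>i<length ps. integral (Z i) ?f)) (\<Union>i<length ps. Z i)"
  proof (rule has_integral_UN)
    show "(?f has_integral integral (Z i) ?f) (Z i)" if "i \<in> {..<length ps}" for i
      using piece that by (simp add: integrable_integral)
    show "pairwise (\<lambda>i j. negligible (Z i \<inter> Z j)) {..<length ps}"
    proof (rule pairwiseI)
      fix i j assume "i \<in> {..<length ps}" "j \<in> {..<length ps}" "i \<noteq> j"
      then have "Z i \<inter> Z j = {}" using disj by (force simp: Z_def)
      then show "negligible (Z i \<inter> Z j)" by simp
    qed
  qed simp
  moreover have "(\<Union>i<length ps. Z i) = {s \<in> V. \<phi> s \<in> N}"
    using Mimg \<phi>_in(1) by (force simp: Z_def)
  ultimately have hi: "(?f has_integral (\<Sum>i<length ps. integral (Z i) ?f)) {s \<in> V. \<phi> s \<in> N}" by simp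
  have sub: "s \<in> cbox lo hi" if s: "s \<in> V" "\<phi> s \<in> N" for s
  proof -
    obtain t where "t \<in> cbox lo hi" "\<phi> s = \<phi> t" using N(3) \<phi>_in(1)[OF s(1)] s(2) by blast
    then show "s \<in> cbox lo hi" using \<kappa>_\<phi> s(1) ab by (metis subsetD)
  qed
  have "(\<lambda>s. if s \<in> {s \<in> V. \<phi> s \<in> N} then ?f s else 0) = (\<lambda>s. if s \<in> cbox lo hi then ?f s else 0)"
    using sub g(2) \<phi>_in(1) ab by (auto simp: fun_eq_iff)
  moreover have "((\<lambda>s. if s \<in> {s \<in> V. \<phi> s \<in> N} then ?f s else 0) has_integral (\<Sum>i<length ps. integral (Z i) ?f)) UNIV"
    using hi by (simp only: has_integral_restrict_UNIV)
  ultimately have "(?f has_integral (\<Sum>i<length ps. integral (Z i) ?f)) (cbox lo hi)"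
    by (simp only: has_integral_restrict_UNIV)
  then have "integral (cbox lo hi) ?f = (\<Sum>i<length ps. integral (Z i) ?f)" by (rule integral_unique)
  then show ?thesis
    unfolding pieces_integral_def using piece by (intro exI[of _ "\<lambda>i. integral (Z i) ?f"]) simp
qed

end

section \<open>Patches and transport of mass\<close>

context compact_submanifold
begin

text \<open>The number \<open>c\<close> is the integral of \<open>g\<close>, the same for every decomposition of \<open>M\<close> into pieces.\<close>

definition patch :: "(real^'d) set \<Rightarrow> bool" where
  "patch N \<longleftrightarrow> open N \<and>
     (\<forall>g. continuous_on M g \<and> (\<forall>x\<in>M. x \<notin> N \<longrightarrow> g x = 0) \<longrightarrow>
        (\<exists>c. (\<forall>ps :: ((real^'n) set \<times> (real^'n \<Rightarrow> real^'d) \<times> (real^'n) set) list. pieces M ps \<longrightarrow> pieces_integral ps g c) \<and>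
             (c = 0 \<longrightarrow> g \<in> div_limits) \<and>
             ((\<forall>x\<in>M. g x \<ge> 0) \<and> (\<exists>x\<in>M. g x > 0) \<longrightarrow> c > 0)))"

text \<open>Strict positivity of the integral holds because a continuous nonnegative function with
  zero integral over a box with nonempty interior vanishes on it.\<close>

lemma patch_at:
  assumes p: "p \<in> M"
  obtains N where "patch N" "p \<in> N"
proof (rule patch_exists[OF p])
  fix \<phi> :: "real^'n \<Rightarrow> real^'d" and \<kappa> V W lo hi N
  assume pa: "chart M \<phi> \<kappa> V W" "cbox lo hi \<subseteq> V" "box lo hi \<noteq> {}" "open N" "p \<in> N"
    "N \<subseteq> W" "M \<inter> N \<subseteq> \<phi> ` cbox lo hi"
    "\<And>g. continuous_on M g \<Longrightarrow> (\<And>x. x \<in> M \<Longrightarrow> x \<notin> N \<Longrightarrow> g x = 0) \<Longrightarrow>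
       integral (cbox lo hi) (\<lambda>s. g (\<phi> s) * chart.J \<phi> s) = 0 \<Longrightarrow> g \<in> div_limits"
  interpret chart M \<phi> \<kappa> V W by fact
  have "patch N"
    unfolding patch_def
  proof (intro conjI allI impI pa(4))
    fix g :: "real^'d \<Rightarrow> real"
    assume g: "continuous_on M g \<and> (\<forall>x\<in>M. x \<notin> N \<longrightarrow> g x = 0)"
    let ?f = "\<lambda>s. g (\<phi> s) * J s"
    define c where "c = integral (cbox lo hi) ?f"
    have "c > 0" if pos: "\<forall>x\<in>M. g x \<ge> 0" "x \<in> M" "g x > 0" for x
    proof -
      have cf: "continuous_on (cbox lo hi) ?f"
        by (intro continuous_on_mult continuous_on_compose2[OF conjunct1[OF g] continuous_on_subset[OF C1on_imp_continuous_on[OF C1_\<phi>] pa(2)]]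
            continuous_on_subset[OF C1on_imp_continuous_on[OF C1_J] pa(2)]) (use pa(2) \<phi>_in in auto)
      have f0: "?f s \<ge> 0" if "s \<in> cbox lo hi" for s
      proof -
        have "s \<in> V" using that pa(2) by blast
        then show ?thesis using pos(1) \<phi>_in(1) J_pos by (intro mult_nonneg_nonneg) (auto intro: less_imp_le)
      qed
      have "c \<ge> 0" unfolding c_def using f0 by (intro integral_nonneg integrable_continuous cf)
      moreover have "c \<noteq> 0"
      proof
        assume "c = 0"
        then have hi: "(?f has_integral 0) (cbox lo hi)"
          unfolding c_def using integrable_integral[OF integrable_continuous[OF cf]] by simp
        have "x \<in> N" using g pos by force
        then obtain s where s: "s \<in> cbox lo hi" "x = \<phi> s" using pa(7) pos(2) by blast
        have "?f s = 0" by (rule has_integral_0_cbox_imp_0[OF cf f0[OF subsetD[OF box_subset_cbox]] hi pa(3) s(1)])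
        then show False using pos(3) s J_pos[of s] pa(2) by auto
      qed
      ultimately show ?thesis by simp
    qed
    then show "\<exists>c. (\<forall>ps :: ((real^'n) set \<times> (real^'n \<Rightarrow> real^'d) \<times> (real^'n) set) list. pieces M ps \<longrightarrow> pieces_integral ps g c) \<and> (c = 0 \<longrightarrow> g \<in> div_limits) \<and>
             ((\<forall>x\<in>M. g x \<ge> 0) \<and> (\<exists>x\<in>M. g x > 0) \<longrightarrow> c > 0)"
      using patch_pieces_integral[OF pa(2,4,6,7)] pa(8)[of g] g by (intro exI[of _ c]) (auto simp: c_def)
  qed
  then show ?thesis using that pa(5) by blast
qed

lemma patchD:
  assumes "patch N" "continuous_on M g" "\<And>x. x \<in> M \<Longrightarrow> x \<notin> N \<Longrightarrow> g x = 0"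
  shows "\<exists>c. (\<forall>ps :: ((real^'n) set \<times> (real^'n \<Rightarrow> real^'d) \<times> (real^'n) set) list. pieces M ps \<longrightarrow> pieces_integral ps g c) \<and> (c = 0 \<longrightarrow> g \<in> div_limits) \<and>
             ((\<forall>x\<in>M. g x \<ge> 0) \<and> (\<exists>x\<in>M. g x > 0) \<longrightarrow> c > 0)"
proof -
  have "continuous_on M g \<and> (\<forall>x\<in>M. x \<notin> N \<longrightarrow> g x = 0)" using assms(2,3) by simp
  then show ?thesis by (rule mp[OF spec[OF conjunct2[OF assms(1)[unfolded patch_def]]]])
qed

lemma patch_pintE:
  assumes "patch N" "continuous_on M g" "\<And>x. x \<in> M \<Longrightarrow> x \<notin> N \<Longrightarrow> g x = 0"
  obtains c where "\<And>ps :: ((real^'n) set \<times> (real^'n \<Rightarrow> real^'d) \<times> (real^'n) set) list. pieces M ps \<Longrightarrow> pieces_integral ps g c"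
    "(\<forall>x\<in>M. g x \<ge> 0) \<Longrightarrow> (\<exists>x\<in>M. g x > 0) \<Longrightarrow> c > 0"
proof -
  obtain c where c: "\<forall>ps :: ((real^'n) set \<times> (real^'n \<Rightarrow> real^'d) \<times> (real^'n) set) list. pieces M ps \<longrightarrow> pieces_integral ps g c"
    "(\<forall>x\<in>M. g x \<ge> 0) \<and> (\<exists>x\<in>M. g x > 0) \<longrightarrow> c > 0"
    by (rule exE[OF patchD[OF assms(1,2)]]) (use assms(3) in auto)
  show ?thesis by (rule that[of c]) (use c in simp_all)
qed

lemma patch_div_limits:
  fixes ps :: "((real^'n) set \<times> (real^'n \<Rightarrow> real^'d) \<times> (real^'n) set) list"
  assumes "patch N" "continuous_on M g" "\<And>x. x \<in> M \<Longrightarrow> x \<notin> N \<Longrightarrow> g x = 0" "pieces M ps" "pieces_integral ps g 0"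
  shows "g \<in> div_limits"
proof -
  obtain c where c: "\<forall>ps :: ((real^'n) set \<times> (real^'n \<Rightarrow> real^'d) \<times> (real^'n) set) list. pieces M ps \<longrightarrow> pieces_integral ps g c" "c = 0 \<longrightarrow> g \<in> div_limits"
    by (rule exE[OF patchD[OF assms(1,2)]]) (use assms(3) in auto)
  have "c = 0" using c(1) assms(4,5) by (intro pieces_integral_unique[of ps g]) simp_all
  then show ?thesis using c(2) by simp
qed

text \<open>A tent function divided by its integral. The mass is 1 for every decomposition, so one
  bump can be compared with densities that come with different ones.\<close>

lemma unit_bump:
  assumes N: "patch N" and p: "p \<in> M" "p \<in> N" and N': "open N'" "p \<in> N'"
  obtains \<beta> where "continuous_on M \<beta>" "\<And>x. x \<in> M \<Longrightarrow> x \<notin> N \<inter> N' \<Longrightarrow> \<beta> x = 0"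
    "\<And>ps :: ((real^'n) set \<times> (real^'n \<Rightarrow> real^'d) \<times> (real^'n) set) list. pieces M ps \<Longrightarrow> pieces_integral ps \<beta> 1"
proof -
  have "open (N \<inter> N')" using N N'(1) by (simp add: patch_def open_Int)
  then obtain r where r: "r > 0" "ball p r \<subseteq> N \<inter> N'" using p N' open_contains_ball by blast
  define \<gamma> where "\<gamma> = (\<lambda>x. max 0 (r - dist p x))"
  have c: "continuous_on M \<gamma>" unfolding \<gamma>_def by (intro continuous_intros)
  have z: "\<gamma> x = 0" if "x \<notin> N \<inter> N'" for x
  proof -
    have "x \<notin> ball p r" using that r(2) by blast
    then show ?thesis by (simp add: \<gamma>_def)
  qed
  obtain a where a: "\<And>ps :: ((real^'n) set \<times> (real^'n \<Rightarrow> real^'d) \<times> (real^'n) set) list. pieces M ps \<Longrightarrow> pieces_integral ps \<gamma> a" "a > 0"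
  proof (rule patch_pintE[OF N c])
    show "\<gamma> x = 0" if "x \<notin> N" for x using z that by blast
    fix a assume *: "\<And>ps :: ((real^'n) set \<times> (real^'n \<Rightarrow> real^'d) \<times> (real^'n) set) list. pieces M ps \<Longrightarrow> pieces_integral ps \<gamma> a"
      "(\<forall>x\<in>M. \<gamma> x \<ge> 0) \<Longrightarrow> (\<exists>x\<in>M. \<gamma> x > 0) \<Longrightarrow> a > 0"
    have "a > 0" using p(1) r(1) by (intro *(2)) (auto simp: \<gamma>_def intro!: bexI[of _ p])
    then show thesis using that[OF *(1)] by blast
  qed
  show ?thesis
  proof (rule that[of "\<lambda>x. (1 / a) * \<gamma> x"])
    show "continuous_on M (\<lambda>x. (1 / a) * \<gamma> x)" by (intro continuous_intros c)
    show "(1 / a) * \<gamma> x = 0" if "x \<notin> N \<inter> N'" for x using z[OF that] by simp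
    show "pieces_integral ps (\<lambda>x. (1 / a) * \<gamma> x) 1" if "pieces M ps" for ps :: "((real^'n) set \<times> (real^'n \<Rightarrow> real^'d) \<times> (real^'n) set) list"
      using pieces_integral_linear[OF a(1)[OF that] pieces_integral_zero, of "1 / a"] a(2) by simp
  qed
qed

text \<open>All mass is collected in the single bump \<beta>. A patch is good if every function
  supported in it may be exchanged for its mass times \<beta>. Goodness spreads to each patch that
  meets a good one on M, hence by connectedness the good patches cover M, and a partition of unity
  over finitely many of them treats \<open>f\<close>.\<close>

lemma density_minus_bump_in_div_limits:
  fixes ps :: "((real^'n) set \<times> (real^'n \<Rightarrow> real^'d) \<times> (real^'n) set) list"
  assumes conn: "connected M" and ps: "pieces M ps"
    and N0: "patch N0" "p0 \<in> M" "p0 \<in> N0" and \<beta>: "continuous_on M \<beta>" "\<And>x. x \<in> M \<Longrightarrow> x \<notin> N0 \<Longrightarrow> \<beta> x = 0" "pieces_integral ps \<beta> 1"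
    and f: "continuous_on M f" "pieces_integral ps f 1"
  shows "(\<lambda>x. f x - \<beta> x) \<in> div_limits"
proof -
  define good where "good = (\<lambda>N. patch N \<and> (\<forall>g c. continuous_on M g \<longrightarrow> (\<forall>x\<in>M. x \<notin> N \<longrightarrow> g x = 0) \<longrightarrow>
      pieces_integral ps g c \<longrightarrow> (\<lambda>x. g x - c * \<beta> x) \<in> div_limits))"
  have diff: "pieces_integral ps (\<lambda>x. g x - c * h x) 0" if "pieces_integral ps g c" "pieces_integral ps h 1" for g c h
    using pieces_integral_linear[OF that(2,1), of "-c"] by (simp add: algebra_simps)
  have good0: "good N0"
    unfolding good_def
  proof (intro conjI N0 allI impI)
    fix g c assume g: "continuous_on M g" "\<forall>x\<in>M. x \<notin> N0 \<longrightarrow> g x = 0" "pieces_integral ps g c"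
    show "(\<lambda>x. g x - c * \<beta> x) \<in> div_limits"
      using g \<beta>(2) by (intro patch_div_limits[OF N0(1) _ _ ps diff[OF g(3) \<beta>(3)]] continuous_intros \<beta>(1)) auto
  qed
  \<comment> \<open>The mass is gathered by the patch \<open>N\<close> in a unit bump supported in
    the overlap with \<open>Q\<close>, and carried from there to \<beta> by the good patch
    \<open>Q\<close>.\<close>
  have propagate: "good N" if N: "patch N" and Q: "good Q" and q: "q \<in> M" "q \<in> N" "q \<in> Q" for N Q q
    unfolding good_def
  proof (intro conjI N allI impI)
    fix g c assume g: "continuous_on M g" "\<forall>x\<in>M. x \<notin> N \<longrightarrow> g x = 0" "pieces_integral ps g c"
    have "open Q" using Q by (simp add: good_def patch_def)
    then obtain \<gamma> where \<gamma>: "continuous_on M \<gamma>" "\<And>x. x \<in> M \<Longrightarrow> x \<notin> N \<inter> Q \<Longrightarrow> \<gamma> x = 0" "pieces_integral ps \<gamma> 1"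
      using unit_bump[OF N q(1,2) _ q(3)] ps by metis
    have "(\<lambda>x. \<gamma> x - 1 * \<beta> x) \<in> div_limits" using Q \<gamma> unfolding good_def by blast
    moreover have "(\<lambda>x. g x - c * \<gamma> x) \<in> div_limits"
      using g \<gamma>(2) by (intro patch_div_limits[OF N _ _ ps diff[OF g(3) \<gamma>(3)]] continuous_intros \<gamma>(1)) auto
    ultimately have "(\<lambda>x. c * (\<gamma> x - 1 * \<beta> x) + (g x - c * \<gamma> x)) \<in> div_limits" by (rule div_limits_linear)
    then show "(\<lambda>x. g x - c * \<beta> x) \<in> div_limits" by (simp add: algebra_simps)
  qed
  \<comment> \<open>The good patches and the others form two open sets that cover M and, by
    propagation, are disjoint on M; as the first meets M, connectedness leaves nothing for the
    second.\<close>
  define A where "A = \<Union>{N. good N}"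
  define B where "B = \<Union>{N. patch N \<and> \<not> good N}"
  have patch_open: "open N" if "patch N" for N using that by (simp add: patch_def)
  have "B \<inter> M = {}"
  proof -
    have "open A" "open B" unfolding A_def B_def using patch_open by (auto simp: good_def)
    moreover have "A \<inter> B \<inter> M = {}" using propagate by (auto simp: A_def B_def)
    moreover have "M \<subseteq> A \<union> B"
    proof
      fix p assume "p \<in> M"
      then obtain N where "patch N" "p \<in> N" using patch_at by blast
      then show "p \<in> A \<union> B" by (auto simp: A_def B_def)
    qed
    moreover have "A \<inter> M \<noteq> {}" using good0 N0 by (auto simp: A_def)
    ultimately show ?thesis using connectedD[OF conn, of A B] by blast
  qed
  then have cover: "\<exists>N. good N \<and> p \<in> N" if p: "p \<in> M" for p
  proof -
    obtain N where N: "patch N" "p \<in> N" by (rule patch_at[OF p])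
    have "p \<notin> B" using p \<open>B \<inter> M = {}\<close> by blast
    then have "good N" using N by (auto simp: B_def)
    then show ?thesis using N by blast
  qed
  obtain C where C: "C \<subseteq> {N. good N}" "finite C" "M \<subseteq> \<Union>C"
  proof (rule compactE[OF M_compact, of "{N. good N}"])
    show "M \<subseteq> \<Union>{N. good N}" using cover by blast
    show "open N" if "N \<in> {N. good N}" for N using that patch_open by (simp add: good_def)
  qed blast
  obtain F :: "(real^'d) set \<Rightarrow> real^'d \<Rightarrow> real" where F: "\<And>U. U \<in> C \<Longrightarrow> continuous_on M (F U)"
    "\<And>x U. \<lbrakk>U \<in> C; x \<in> M; x \<notin> U\<rbrakk> \<Longrightarrow> F U x = 0"
    "\<And>x. x \<in> M \<Longrightarrow> supp_sum (\<lambda>W. F W x) C = 1"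
  proof (rule subordinate_partition_of_unity[OF C(3)])
    show "open Z" if "Z \<in> C" for Z using that C(1) patch_open by (auto simp: good_def)
    show "\<exists>V. open V \<and> x \<in> V \<and> finite {U \<in> C. U \<inter> V \<noteq> {}}" for x
      using C(2) by (intro exI[of _ UNIV]) simp
  qed blast
  \<comment> \<open>Over a finite index set the sum over the support is an ordinary sum.\<close>
  have F1: "(\<Sum>U\<in>C. F U x) = 1" if "x \<in> M" for x
  proof -
    have "(\<Sum>U\<in>C. F U x) = sum (\<lambda>W. F W x) (support_on C (\<lambda>W. F W x))"
      using C(2) by (intro sum.mono_neutral_right) (auto simp: support_on_def)
    then show ?thesis using F(3)[OF that] by (simp add: supp_sum_def)
  qed
  define g where "g = (\<lambda>U x. F U x * f x)"
  have g: "continuous_on M (g U)" "\<And>x. x \<in> M \<Longrightarrow> x \<notin> U \<Longrightarrow> g U x = 0" if "U \<in> C" for U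
    unfolding g_def using F(1,2)[OF that] by (auto intro!: continuous_intros f)
  have "\<exists>c. pieces_integral ps (g U) c" if "U \<in> C" for U
  proof -
    have "patch U" using C(1) that by (auto simp: good_def)
    from patch_pintE[OF this g[OF that]] show ?thesis using ps by metis
  qed
  then obtain c where c: "\<And>U. U \<in> C \<Longrightarrow> pieces_integral ps (g U) (c U)" by metis
  have gf: "(\<Sum>U\<in>C. g U x) = f x" if "x \<in> M" for x
    using F1[OF that] by (simp add: g_def flip: sum_distrib_right)
  have "pieces_integral ps (\<lambda>x. \<Sum>U\<in>C. g U x) (\<Sum>U\<in>C. c U)" by (rule pieces_integral_sum[OF C(2) c])
  \<comment> \<open>The mass 1 of \<open>f\<close> is split among the patches, so the multiples of
    \<beta> add up to exactly one \<beta>.\<close>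
  from pieces_integral_cong[OF ps this gf] have c1: "(\<Sum>U\<in>C. c U) = 1" using f(2) pieces_integral_unique by blast
  have gU: "(\<lambda>x. g U x - c U * \<beta> x) \<in> div_limits" if "U \<in> C" for U
    using C(1) that g[OF that] c[OF that] unfolding good_def by blast
  have D: "(\<lambda>x. \<Sum>U\<in>C. 1 * (g U x - c U * \<beta> x)) \<in> div_limits"
    by (rule div_limits_sum[where f = "\<lambda>U x. g U x - c U * \<beta> x", OF C(2) gU])
  show ?thesis
  \<comment> \<open>The two functions agree on M only, so the equality is passed on as an
    approximation there.\<close>
  proof (rule div_limits_closed)
    fix \<epsilon> :: real assume "\<epsilon> > 0"
    have "\<bar>(f x - \<beta> x) - (\<Sum>U\<in>C. 1 * (g U x - c U * \<beta> x))\<bar> \<le> \<epsilon>" if "x \<in> M" for x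
      using \<open>\<epsilon> > 0\<close> gf[OF that] c1 by (simp add: sum_subtractf flip: sum_distrib_right)
    then show "\<exists>h\<in>div_limits. \<forall>x\<in>M. \<bar>(f x - \<beta> x) - h x\<bar> \<le> \<epsilon>" by (intro bexI[OF _ D]) simp
  qed
qed

end

theorem theorem3:
  fixes M :: "(real^'d) set" and \<nu> \<mu> :: "real^'d \<Rightarrow> real"
    and \<sigma> :: "real \<Rightarrow> real" and l :: nat
  assumes "submanifold TYPE('n::finite) M"
    and "CARD('n) < CARD('d)"
    and "orientable TYPE('n) M"
    and "compact M" and "connected M"
    and "prob_density TYPE('n) M \<nu>" and "continuous_on M \<nu>"
    and "prob_density TYPE('n) M \<mu>" and "continuous_on M \<mu>"
    and "l \<ge> 2" and "smooth_real_fun \<sigma>" and "l_finite l \<sigma>"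
  shows "\<forall>\<epsilon>>0. \<exists>v. mlp \<sigma> v \<and>
           (\<forall>x\<in>M.
              (\<lambda>y. tangent_proj TYPE('n) M (closest_point M y) (v (closest_point M y)))
                differentiable (at x) \<and>
              \<bar>\<mu> x - (\<nu> x - div_E (\<lambda>y. tangent_proj TYPE('n) M (closest_point M y)
                                               (v (closest_point M y))) x)\<bar> < \<epsilon>)"
proof -
  interpret compact_submanifold M "TYPE('n)"
    by unfold_locales (use assms in auto)
  have np: "nonpoly \<sigma>" using assms(11,12) by (rule l_finite_nonpoly)
  \<comment> \<open>The order of the difference fits \<mu> = \<nu> - div u.\<close>
  have "(\<lambda>x. \<nu> x - \<mu> x) \<in> div_limits"
  proof (cases "M = {}")
    case True
    \<comment> \<open>With M empty there is no base point for a bump, and any function is a limit of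
      divergences.\<close>
    show ?thesis by (rule div_limits_closed) (use True div_limits_zero in auto)
  next
    case False
    then obtain p where p: "p \<in> M" by blast
    obtain N where N: "patch N" "p \<in> N" using patch_at[OF p] by blast
    obtain \<beta> where \<beta>: "continuous_on M \<beta>" "\<And>x. x \<in> M \<Longrightarrow> x \<notin> N \<inter> UNIV \<Longrightarrow> \<beta> x = 0"
      "\<And>ps :: ((real^'n) set \<times> (real^'n \<Rightarrow> real^'d) \<times> (real^'n) set) list. pieces M ps \<Longrightarrow> pieces_integral ps \<beta> 1"
      using unit_bump[OF N(1) p N(2) open_UNIV UNIV_I] by metis
    have \<beta>0: "\<beta> x = 0" if "x \<in> M" "x \<notin> N" for x using \<beta>(2) that by simp
    \<comment> \<open>\<beta> is fixed before any decomposition is chosen, so each density is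
      reduced to the same \<beta> over its own pieces.\<close>
    have *: "(\<lambda>x. f x - \<beta> x) \<in> div_limits" if fd: "prob_density TYPE('n) M f" "continuous_on M f" for f
    proof -
      obtain ps :: "((real^'n) set \<times> (real^'n \<Rightarrow> real^'d) \<times> (real^'n) set) list" where ps: "pieces M ps" "pieces_integral ps f 1"
        by (rule manifold_has_integral_pieces[OF conjunct2[OF fd(1)[unfolded prob_density_def]]])
      show ?thesis
        by (rule density_minus_bump_in_div_limits[OF assms(5) ps(1) N(1) p N(2) \<beta>(1) \<beta>0 \<beta>(3)[OF ps(1)] fd(2) ps(2)])
    qed
    from div_limits_linear[OF *[OF assms(8,9)] *[OF assms(6,7)], of "-1"] show ?thesis by (simp add: algebra_simps)
  qed
  note div = div_limits_mlp[OF this assms(11) np]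
  show ?thesis
  proof (intro allI impI)
    fix \<epsilon> :: real assume "\<epsilon> > 0"
    from div[OF this] obtain v where v: "mlp \<sigma> v"
      "\<And>x. x \<in> M \<Longrightarrow> proj_field TYPE('n) M v differentiable (at x) \<and> \<bar>\<nu> x - \<mu> x - div_M v x\<bar> < \<epsilon>" by blast
    have "\<bar>\<mu> x - (\<nu> x - div_E (proj_field TYPE('n) M v) x)\<bar> < \<epsilon>" if "x \<in> M" for x
      using v(2)[OF that] unfolding div_M_def by linarith
    then show "\<exists>v. mlp \<sigma> v \<and>
           (\<forall>x\<in>M.
              (\<lambda>y. tangent_proj TYPE('n) M (closest_point M y) (v (closest_point M y)))
                differentiable (at x) \<and>
              \<bar>\<mu> x - (\<nu> x - div_E (\<lambda>y. tangent_proj TYPE('n) M (closest_point M y)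
                                               (v (closest_point M y))) x)\<bar> < \<epsilon>)"
      using v by (intro exI[of _ v]) (simp add: proj_field_def)
  qed
qed

end
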